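(* Let $\tau>0$, let $A$ be a real symmetric $m\times m$ matrix with eigenvalues $0>\lambda_1\ge\lambda_2\ge\dots\ge\lambda_m$, and let $f:\mathbb R\times\mathbb R^m\to\mathbb R^m$, $g:\mathbb R\times\mathbb R^m\to\mathbb R^{m\times d}$ satisfy $f(t+\tau,x)=f(t,x)$, $g(t+\tau,x)=g(t,x)$ for all $t\in\mathbb R$, $x\in\mathbb R^m$. Assume there are constants $C_0,\beta_1,\beta_2>0$ with $\beta_1+\frac{\beta_2^2}{2}<|\lambda_1|$ such that for all $s,t\in\mathbb R$, $x,y\in\mathbb R^m$, $$|f(s,x)-f(t,y)|\le C_0|s-t|^{1/2}+\beta_1|x-y|,\qquad |g(s,x)-g(t,y)|\le C_0|s-t|^{1/2}+\beta_2|x-y|.$$ Let $\xi$ be an initial value with $\|\xi\|_2\le K^*$ for some constant $K^*>0$. Let $\rho_r$ be the periodic measure of the SDE $dX_t=[AX_t+f(t,X_t)]dt+g(t,X_t)dW_t$ and, for sufficiently small $\Delta t=\tau/n$, let $\widehat\rho_r$ be the periodic measure of its Euler-Maruyama scheme with step $\Delta t$, and let $P(r,-k\tau,\xi)$, $\widehat P(r,-k\tau,\xi)$ be the corresponding transition probabilities. Then, for $r\ge0$, as $k\to\infty$, $$P(r,-k\tau,\xi)\to\rho_r,\qquad \widehat P(r,-k\tau,\xi)\to\widehat\rho_r\qquad\text{weakly},$$ and $$d_{\mathbb L}(\rho_r,\widehat\rho_r)\le\widetilde K\sqrt{\Delta t},$$ where $\widetilde K$ is a constant independent of $\Delta t$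 and $r$.
   Context: $|\cdot|$ is the Euclidean norm of vectors and the Frobenius norm of matrices; $\|\xi\|_p=(\mathbb E|\xi|^p)^{1/p}$. $W$ is a two-sided Wiener process in $\mathbb R^d$ on $(\Omega,\mathcal F,\mathbb P)$, $\mathcal F^t=\bigvee_{s\le t}\sigma\{W_u-W_v:s\le v\le u\le t\}$. Initial values $\xi$ at time $-k\tau$ are $\mathcal F^{-k\tau}$-measurable (for each $k\in\mathbb N$). $X_r^{-k\tau}(\xi)$ is the solution of the SDE with value $\xi$ at time $-k\tau$. Euler-Maruyama scheme: $\Delta t=\tau/n$, $n\in\mathbb N$, with $\Delta t\le1/\rho$, $\rho=|\lambda_m|$; $\widehat X_{-k\tau}^{-k\tau}=\xi$ and, for $i\ge0$, $$\widehat X_{-k\tau+(i+1)\Delta t}^{-k\tau}=\widehat X_{-k\tau+i\Delta t}^{-k\tau}+A\widehat X_{-k\tau+i\Delta t}^{-k\tau}\Delta t+f(i\Delta t,\widehat X_{-k\tau+i\Delta t}^{-k\tau})\Delta t+g(i\Delta t,\widehat X_{-k\tau+i\Delta t}^{-k\tau})\big(W_{-k\tau+(i+1)\Delta t}-W_{-k\tau+i\Delta t}\big).$$ For $r\ge0$ with $N'\Delta t\le r<(N'+1)\Delta t$: $\widehat X_r^{-k\tau}$ is this iterate if $r=N'\Delta t$, and otherwise $\widehat X_r^{-k\tau}=\widehat X_{N'\Delta t}^{-k\tau}+f(N'\Delta t,\widehat X_{N'\Delta t}^{-k\tau})(r-N'\Delta t)+g(N'\Delta t,\widehat X_{N'\Delta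 t}^{-k\tau})(W_r-W_{N'\Delta t})$. For $r\ge0$, $X_r^*$ and $\widehat X_r^*$ are the $L^2(\Omega)$-limits of $X_r^{-k\tau}(\xi)$ and $\widehat X_r^{-k\tau}(\xi)$ as $k\to\infty$ (the exact and approximating random periodic solutions; the limits exist for $\Delta t$ small enough and do not depend on $\xi$). Transition probabilities: $P(r,-k\tau,\xi,\Gamma)=\mathbb P(X_r^{-k\tau}(\xi)\in\Gamma)$, $\widehat P(r,-k\tau,\xi,\Gamma)=\mathbb P(\widehat X_r^{-k\tau}(\xi)\in\Gamma)$, $\Gamma\in\mathcal B(\mathbb R^m)$. The periodic measures are the laws $\rho_r(\Gamma)=\mathbb P(X_r^*\in\Gamma)$ and $\widehat\rho_r(\Gamma)=\mathbb P(\widehat X_r^*\in\Gamma)$. For probability measures $P_1,P_2$ on $\mathbb R^m$, $d_{\mathbb L}(P_1,P_2)=\sup_{\varphi\in\mathbb L}\big|\int\varphi\,dP_1-\int\varphi\,dP_2\big|$ with $\mathbb L=\{\varphi:\mathbb R^m\to\mathbb R:\ |\varphi(x)-\varphi(y)|\le|x-y|\text{ and }|\varphi(\cdot)|\le1\}$. *)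

theory Defs
  imports "HOL-Probability.Probability"
begin

section \<open>Square-integrable random variables\<close>

definition in_L2 :: "'w measure \<Rightarrow> ('w \<Rightarrow> 'a::euclidean_space) \<Rightarrow> bool" where
  "in_L2 M Y \<longleftrightarrow> Y \<in> borel_measurable M \<and> integrable M (\<lambda>\<omega>. (norm (Y \<omega>))\<^sup>2)"

text \<open>Only meaningful together with \<^const>\<open>in_L2\<close>: the Bochner integral of a non-integrable
  function is 0.\<close>

definition L2_norm :: "'w measure \<Rightarrow> ('w \<Rightarrow> 'a::euclidean_space) \<Rightarrow> real" where
  "L2_norm M Y = sqrt (\<integral>\<omega>. (norm (Y \<omega>))\<^sup>2 \<partial>M)"

definition L2_limit :: "'w measure \<Rightarrow> (nat \<Rightarrow> 'w \<Rightarrow> 'a::euclidean_space) \<Rightarrow> ('w \<Rightarrow> 'a) \<Rightarrow> bool" where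
  "L2_limit M Y Z \<longleftrightarrow> (\<forall>k. in_L2 M (Y k)) \<and> in_L2 M Z \<and>
     (\<lambda>k. L2_norm M (\<lambda>\<omega>. Y k \<omega> - Z \<omega>)) \<longlonglongrightarrow> 0"


section \<open>Two-sided Wiener process and its filtration\<close>

definition two_sided_wiener :: "'w measure \<Rightarrow> (real \<Rightarrow> 'w \<Rightarrow> real ^ 'd) \<Rightarrow> bool" where
  "two_sided_wiener M W \<longleftrightarrow>
     prob_space M \<and>
     (\<forall>t. W t \<in> borel_measurable M) \<and>
     (AE \<omega> in M. W 0 \<omega> = 0) \<and>
     (AE \<omega> in M. continuous_on UNIV (\<lambda>t. W t \<omega>)) \<and>
     (\<forall>N (t :: nat \<Rightarrow> real). mono t \<longrightarrow>
        prob_space.indep_vars M (\<lambda>_. borel) (\<lambda>i \<omega>. W (t (Suc i)) \<omega> - W (t i) \<omega>) {..<N}) \<and>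
     (\<forall>s t. s < t \<longrightarrow>
        prob_space.indep_vars M (\<lambda>_. borel) (\<lambda>j \<omega>. (W t \<omega> - W s \<omega>) $ j) UNIV \<and>
        (\<forall>j. distributed M lborel (\<lambda>\<omega>. (W t \<omega> - W s \<omega>) $ j)
               (\<lambda>x. ennreal (normal_density 0 (sqrt (t - s)) x))))"

text \<open>The join over all \<open>s \<le> t\<close> of the \<open>\<sigma>\<close>-algebras generated by the increments \<open>W\<^sub>u - W\<^sub>v\<close>
  with \<open>s \<le> v \<le> u \<le> t\<close>.\<close>

definition increment_filtration ::
    "'w measure \<Rightarrow> (real \<Rightarrow> 'w \<Rightarrow> real ^ 'd) \<Rightarrow> real \<Rightarrow> 'w measure" where
  "increment_filtration M W t = sigma (space M)
     {(\<lambda>\<omega>. W u \<omega> - W v \<omega>) -` B \<inter> space M | s u v B. s \<le> v \<and> v \<le> u \<and> u \<le> t \<and> B \<in> sets borel}"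

text \<open>Stochastic integrals are only determined up to null sets, so continuous solutions need not be
  adapted to the raw filtration; adaptedness of solutions refers to its augmentation.\<close>

definition augmented_filtration ::
    "'w measure \<Rightarrow> (real \<Rightarrow> 'w \<Rightarrow> real ^ 'd) \<Rightarrow> real \<Rightarrow> 'w measure" where
  "augmented_filtration M W t =
     sigma (space M) (sets (increment_filtration M W t) \<union> null_sets M)"


section \<open>The Ito integral\<close>

definition elementary_integrand ::
    "(real \<Rightarrow> 'w measure) \<Rightarrow> real \<Rightarrow> real \<Rightarrow> nat \<Rightarrow> (nat \<Rightarrow> real) \<Rightarrow>
     (nat \<Rightarrow> 'w \<Rightarrow> real ^ 'd ^ 'm) \<Rightarrow> bool" where
  "elementary_integrand F a b N t H \<longleftrightarrow>
     t 0 = a \<and> t N = b \<and> (\<forall>i<N. t i \<le> t (Suc i)) \<and>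
     (\<forall>i<N. H i \<in> borel_measurable (F (t i)) \<and> bounded (H i ` space (F (t i))))"

definition elementary_process ::
    "nat \<Rightarrow> (nat \<Rightarrow> real) \<Rightarrow> (nat \<Rightarrow> 'w \<Rightarrow> real ^ 'd ^ 'm) \<Rightarrow> real \<Rightarrow> 'w \<Rightarrow> real ^ 'd ^ 'm" where
  "elementary_process N t H s \<omega> = (\<Sum>i<N. indicator {t i..<t (Suc i)} s *\<^sub>R H i \<omega>)"

definition elementary_integral ::
    "(real \<Rightarrow> 'w \<Rightarrow> real ^ 'd) \<Rightarrow> nat \<Rightarrow> (nat \<Rightarrow> real) \<Rightarrow> (nat \<Rightarrow> 'w \<Rightarrow> real ^ 'd ^ 'm) \<Rightarrow>
     'w \<Rightarrow> real ^ 'm" where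
  "elementary_integral W N t H \<omega> = (\<Sum>i<N. H i \<omega> *v (W (t (Suc i)) \<omega> - W (t i) \<omega>))"

text \<open>\<open>I\<close> is a version of the integral of \<open>\<Phi>\<close> against \<open>W\<close> over \<open>[a, b]\<close>: the \<open>L\<^sup>2\<close>-limit of the
  integrals of elementary adapted processes approximating \<open>\<Phi>\<close> in \<open>L\<^sup>2([a, b] \<times> \<Omega>)\<close>.\<close>

definition has_ito_integral ::
    "'w measure \<Rightarrow> (real \<Rightarrow> 'w measure) \<Rightarrow> (real \<Rightarrow> 'w \<Rightarrow> real ^ 'd) \<Rightarrow> real \<Rightarrow> real \<Rightarrow>
     (real \<Rightarrow> 'w \<Rightarrow> real ^ 'd ^ 'm) \<Rightarrow> ('w \<Rightarrow> real ^ 'm) \<Rightarrow> bool" where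
  "has_ito_integral M F W a b \<Phi> I \<longleftrightarrow>
     (\<lambda>(s, \<omega>). indicator {a..b} s *\<^sub>R \<Phi> s \<omega>) \<in> borel_measurable (lborel \<Otimes>\<^sub>M M) \<and>
     (\<integral>\<^sup>+\<omega>. (\<integral>\<^sup>+s\<in>{a..b}. ennreal ((norm (\<Phi> s \<omega>))\<^sup>2) \<partial>lborel) \<partial>M) < \<infinity> \<and>
     (\<exists>N t H.
        (\<forall>j. elementary_integrand F a b (N j) (t j) (H j)) \<and>
        (\<lambda>j. \<integral>\<^sup>+\<omega>. (\<integral>\<^sup>+s\<in>{a..b}.
           ennreal ((norm (elementary_process (N j) (t j) (H j) s \<omega> - \<Phi> s \<omega>))\<^sup>2) \<partial>lborel) \<partial>M)
          \<longlonglongrightarrow> 0 \<and>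
        L2_limit M (\<lambda>j. elementary_integral W (N j) (t j) (H j)) I)"


section \<open>The stochastic differential equation and its Euler--Maruyama scheme\<close>

text \<open>The characteristic polynomial is compared as a function, so \<open>lam 1, \<dots>, lam m\<close> lists the
  eigenvalues with multiplicity.\<close>

definition eigenvalue_list :: "real ^ 'm ^ 'm \<Rightarrow> (nat \<Rightarrow> real) \<Rightarrow> bool" where
  "eigenvalue_list A lam \<longleftrightarrow> (\<forall>x. det (mat x - A) = (\<Prod>i = 1..CARD('m). x - lam i))"

text \<open>Continuous adapted solution on \<open>[t\<^sub>0, \<infinity>)\<close>, square-integrable on bounded time intervals, of
  \<open>dX\<^sub>t = [A X\<^sub>t + f(t, X\<^sub>t)] dt + g(t, X\<^sub>t) dW\<^sub>t\<close> with value \<open>\<xi>\<close> at time \<open>t\<^sub>0\<close>. The last conjunct is the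
  integral equation, solved for the stochastic integral.\<close>

definition sde_solution ::
    "'w measure \<Rightarrow> (real \<Rightarrow> 'w \<Rightarrow> real ^ 'd) \<Rightarrow> real ^ 'm ^ 'm \<Rightarrow>
     (real \<Rightarrow> real ^ 'm \<Rightarrow> real ^ 'm) \<Rightarrow> (real \<Rightarrow> real ^ 'm \<Rightarrow> real ^ 'd ^ 'm) \<Rightarrow>
     real \<Rightarrow> ('w \<Rightarrow> real ^ 'm) \<Rightarrow> (real \<Rightarrow> 'w \<Rightarrow> real ^ 'm) \<Rightarrow> bool" where
  "sde_solution M W A f g t0 \<xi> X \<longleftrightarrow>
     (\<forall>t\<ge>t0. X t \<in> borel_measurable (augmented_filtration M W t)) \<and>
     (AE \<omega> in M. continuous_on {t0..} (\<lambda>t. X t \<omega>)) \<and>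
     (\<lambda>(t, \<omega>). indicator {t0..} t *\<^sub>R X t \<omega>) \<in> borel_measurable (lborel \<Otimes>\<^sub>M M) \<and>
     (\<forall>t\<ge>t0. (\<integral>\<^sup>+\<omega>. (\<integral>\<^sup>+s\<in>{t0..t}. ennreal ((norm (X s \<omega>))\<^sup>2) \<partial>lborel) \<partial>M) < \<infinity>) \<and>
     (AE \<omega> in M. X t0 \<omega> = \<xi> \<omega>) \<and>
     (\<forall>t\<ge>t0. has_ito_integral M (augmented_filtration M W) W t0 t (\<lambda>s \<omega>. g s (X s \<omega>))
        (\<lambda>\<omega>. X t \<omega> - \<xi> \<omega> - (LINT s:{t0..t}|lborel. A *v X s \<omega> + f s (X s \<omega>))))"

primrec em_iterate ::
    "real ^ 'm ^ 'm \<Rightarrow> (real \<Rightarrow> real ^ 'm \<Rightarrow> real ^ 'm) \<Rightarrow> (real \<Rightarrow> real ^ 'm \<Rightarrow> real ^ 'd ^ 'm) \<Rightarrow>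
     (real \<Rightarrow> 'w \<Rightarrow> real ^ 'd) \<Rightarrow> real \<Rightarrow> real \<Rightarrow> ('w \<Rightarrow> real ^ 'm) \<Rightarrow> nat \<Rightarrow> 'w \<Rightarrow> real ^ 'm" where
  "em_iterate A f g W t0 h \<xi> 0 = \<xi>"
| "em_iterate A f g W t0 h \<xi> (Suc i) = (\<lambda>\<omega>.
     let x = em_iterate A f g W t0 h \<xi> i \<omega> in
       x + h *\<^sub>R (A *v x) + h *\<^sub>R f (real i * h) x
         + g (real i * h) x *v (W (t0 + real (Suc i) * h) \<omega> - W (t0 + real i * h) \<omega>))"

text \<open>The scheme with step \<open>h = \<tau>/n\<close>, started in \<open>\<xi>\<close> at time \<open>-k\<tau>\<close> and evaluated at \<open>r \<ge> 0\<close>. The grid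
  time \<open>N h\<close> is reached from \<open>-k\<tau> = -(k n) h\<close> after \<open>k n + N\<close> steps. The interpolation between grid
  points deliberately has no linear term \<open>A x\<close>.\<close>

definition em_process ::
    "real ^ 'm ^ 'm \<Rightarrow> (real \<Rightarrow> real ^ 'm \<Rightarrow> real ^ 'm) \<Rightarrow> (real \<Rightarrow> real ^ 'm \<Rightarrow> real ^ 'd ^ 'm) \<Rightarrow>
     (real \<Rightarrow> 'w \<Rightarrow> real ^ 'd) \<Rightarrow> real \<Rightarrow> nat \<Rightarrow> nat \<Rightarrow> ('w \<Rightarrow> real ^ 'm) \<Rightarrow> real \<Rightarrow> 'w \<Rightarrow> real ^ 'm" where
  "em_process A f g W \<tau> n k \<xi> r \<omega> =
     (let h = \<tau> / real n;
          N = nat \<lfloor>r / h\<rfloor>;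
          x = em_iterate A f g W (- real k * \<tau>) h \<xi> (k * n + N) \<omega>
      in if r = real N * h then x
         else x + (r - real N * h) *\<^sub>R f (real N * h) x
                + g (real N * h) x *v (W r \<omega> - W (real N * h) \<omega>))"


section \<open>Random periodic solutions and periodic measures\<close>

text \<open>\<open>\<xi> k\<close> is the initial value used at time \<open>-k\<tau>\<close>; the bound is uniform in \<open>k\<close>. A single random
  variable measurable at all times \<open>-k\<tau>\<close> is the case of constant \<open>\<xi>\<close>.\<close>

definition initial_values ::
    "'w measure \<Rightarrow> (real \<Rightarrow> 'w \<Rightarrow> real ^ 'd) \<Rightarrow> real \<Rightarrow> real \<Rightarrow> (nat \<Rightarrow> 'w \<Rightarrow> real ^ 'm) \<Rightarrow> bool" where
  "initial_values M W \<tau> K \<xi> \<longleftrightarrow>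
     (\<forall>k. \<xi> k \<in> borel_measurable (increment_filtration M W (- real k * \<tau>)) \<and>
          in_L2 M (\<xi> k) \<and> L2_norm M (\<xi> k) \<le> K)"

text \<open>\<open>Z\<close> is (a version of) the random periodic solution at time \<open>r\<close>: the common pullback limit for
  all initial values. Whenever solutions exist, \<open>Z\<close> is unique up to null sets, so its law is well
  defined.\<close>

definition is_random_periodic ::
    "'w measure \<Rightarrow> (real \<Rightarrow> 'w \<Rightarrow> real ^ 'd) \<Rightarrow> real ^ 'm ^ 'm \<Rightarrow>
     (real \<Rightarrow> real ^ 'm \<Rightarrow> real ^ 'm) \<Rightarrow> (real \<Rightarrow> real ^ 'm \<Rightarrow> real ^ 'd ^ 'm) \<Rightarrow>
     real \<Rightarrow> real \<Rightarrow> ('w \<Rightarrow> real ^ 'm) \<Rightarrow> bool" where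
  "is_random_periodic M W A f g \<tau> r Z \<longleftrightarrow>
     (\<forall>K \<xi> X. initial_values M W \<tau> K \<xi> \<and>
        (\<forall>k. sde_solution M W A f g (- real k * \<tau>) (\<xi> k) (X k)) \<longrightarrow>
        L2_limit M (\<lambda>k. X k r) Z)"

definition is_em_random_periodic ::
    "'w measure \<Rightarrow> (real \<Rightarrow> 'w \<Rightarrow> real ^ 'd) \<Rightarrow> real ^ 'm ^ 'm \<Rightarrow>
     (real \<Rightarrow> real ^ 'm \<Rightarrow> real ^ 'm) \<Rightarrow> (real \<Rightarrow> real ^ 'm \<Rightarrow> real ^ 'd ^ 'm) \<Rightarrow>
     real \<Rightarrow> nat \<Rightarrow> real \<Rightarrow> ('w \<Rightarrow> real ^ 'm) \<Rightarrow> bool" where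
  "is_em_random_periodic M W A f g \<tau> n r Z \<longleftrightarrow>
     (\<forall>K \<xi>. initial_values M W \<tau> K \<xi> \<longrightarrow>
        L2_limit M (\<lambda>k. em_process A f g W \<tau> n k (\<xi> k) r) Z)"

definition periodic_measure ::
    "'w measure \<Rightarrow> (real \<Rightarrow> 'w \<Rightarrow> real ^ 'd) \<Rightarrow> real ^ 'm ^ 'm \<Rightarrow>
     (real \<Rightarrow> real ^ 'm \<Rightarrow> real ^ 'm) \<Rightarrow> (real \<Rightarrow> real ^ 'm \<Rightarrow> real ^ 'd ^ 'm) \<Rightarrow>
     real \<Rightarrow> real \<Rightarrow> (real ^ 'm) measure" where
  "periodic_measure M W A f g \<tau> r = distr M borel (SOME Z. is_random_periodic M W A f g \<tau> r Z)"

definition em_periodic_measure ::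
    "'w measure \<Rightarrow> (real \<Rightarrow> 'w \<Rightarrow> real ^ 'd) \<Rightarrow> real ^ 'm ^ 'm \<Rightarrow>
     (real \<Rightarrow> real ^ 'm \<Rightarrow> real ^ 'm) \<Rightarrow> (real \<Rightarrow> real ^ 'm \<Rightarrow> real ^ 'd ^ 'm) \<Rightarrow>
     real \<Rightarrow> nat \<Rightarrow> real \<Rightarrow> (real ^ 'm) measure" where
  "em_periodic_measure M W A f g \<tau> n r =
     distr M borel (SOME Z. is_em_random_periodic M W A f g \<tau> n r Z)"


section \<open>Weak convergence and the bounded Lipschitz distance\<close>

text \<open>\<^const>\<open>weak_conv_m\<close> only covers measures on the real line.\<close>

definition converges_weakly ::
    "(nat \<Rightarrow> 'a::euclidean_space measure) \<Rightarrow> 'a measure \<Rightarrow> bool" where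
  "converges_weakly P Q \<longleftrightarrow>
     (\<forall>\<phi> :: 'a \<Rightarrow> real. continuous_on UNIV \<phi> \<and> bounded (range \<phi>) \<longrightarrow>
        (\<lambda>k. \<integral>x. \<phi> x \<partial>P k) \<longlonglongrightarrow> (\<integral>x. \<phi> x \<partial>Q))"

definition bounded_lipschitz_dist ::
    "'a::euclidean_space measure \<Rightarrow> 'a measure \<Rightarrow> real" where
  "bounded_lipschitz_dist P Q =
     (SUP \<phi>\<in>{\<phi> :: 'a \<Rightarrow> real. (\<forall>x y. \<bar>\<phi> x - \<phi> y\<bar> \<le> norm (x - y)) \<and> (\<forall>x. \<bar>\<phi> x\<bar> \<le> 1)}.
        \<bar>(\<integral>x. \<phi> x \<partial>P) - (\<integral>x. \<phi> x \<partial>Q)\<bar>)"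

end

theory Submission
  imports Defs
begin

text \<open>Everything rests on one estimate for a single Euler--Maruyama step: dissipativity and the
  independence of increments shrink squared \<open>L\<^sup>2\<close>-distances by \<open>1 - h \<alpha> / 2\<close>, up to a drift defect
  of order \<open>h \<theta>\<close> and a martingale defect of order \<open>\<surd>h \<theta>\<close>, which accumulate to \<open>O(\<theta>)\<close> uniformly in
  time. With \<open>\<theta> = 0\<close> it gives the pullback limit of the scheme, applied to the zero process it bounds
  the scheme, and with \<open>\<theta> = O(\<surd>h)\<close> it compares the scheme with a solution of the equation. No Ito
  formula is needed: letting \<open>h \<rightarrow> 0\<close>, the solutions inherit the uniform bound and the contraction
  from the scheme, and the distance of the two periodic measures is at most the \<open>L\<^sup>2\<close>-distance of the
  pullback limits.\<close>

section \<open>The space of square-integrable functions\<close>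

text \<open>The solution hypothesis controls second moments only integrated over bounded time
  intervals, while every error constant needs a bound at each single time. The comparison with the
  scheme is therefore run twice. A crude bound, depending on the solution and the time horizon, is
  enough to make the error vanish with the step; in the limit the solution inherits the scheme's own
  bound, which depends on the initial norm and the coefficients alone; with that bound inserted, the
  same comparison gives a constant independent of \<open>r\<close>, \<open>k\<close> and the step.
  Two facts about the noise carry the one-step estimate. An increment after time \<open>s\<close>,
  Ito or frozen, is orthogonal to every square-integrable value known at time \<open>s\<close>, so
  no cross term of order sqrt h appears; and the isometry measures the cost of freezing the
  diffusion coefficient. Both must hold for the augmented filtration, whereas the Wiener process is
  given by independence along monotone time sequences. Pulling back works because periodicity turns
  the schemes started at all times -k \<tau> into one scheme on one grid with one noise.\<close>

lemma in_L2_measurable [measurable_dest]: "in_L2 M Y \<Longrightarrow> Y \<in> borel_measurable M"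
  by (simp add: in_L2_def)

lemma in_L2_integrable: "in_L2 M Y \<Longrightarrow> integrable M (\<lambda>\<omega>. (norm (Y \<omega>))\<^sup>2)"
  by (simp add: in_L2_def)

lemma in_L2_mono:
  assumes "in_L2 M Z" "Y \<in> borel_measurable M" "AE \<omega> in M. norm (Y \<omega>) \<le> norm (Z \<omega>)"
  shows "in_L2 M Y"
  unfolding in_L2_def
proof
  show "integrable M (\<lambda>\<omega>. (norm (Y \<omega>))\<^sup>2)"
    by (rule Bochner_Integration.integrable_bound[OF in_L2_integrable[OF assms(1)]])
      (use assms(2,3) in \<open>auto intro: power_mono\<close>)
qed fact

lemma in_L2_zero [simp]: "in_L2 M (\<lambda>_. 0)"
  by (simp add: in_L2_def)

lemma in_L2_norm: "in_L2 M Y \<Longrightarrow> in_L2 M (\<lambda>\<omega>. norm (Y \<omega>))"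
  by (auto simp: in_L2_def)

lemma in_L2_scaleR: "in_L2 M Y \<Longrightarrow> in_L2 M (\<lambda>\<omega>. c *\<^sub>R Y \<omega>)"
  by (auto simp: in_L2_def power_mult_distrib)

lemma in_L2_add:
  fixes X Y :: "'w \<Rightarrow> 'a::euclidean_space"
  assumes "in_L2 M X" "in_L2 M Y"
  shows "in_L2 M (\<lambda>\<omega>. X \<omega> + Y \<omega>)"
  unfolding in_L2_def
proof
  have [measurable]: "X \<in> borel_measurable M" "Y \<in> borel_measurable M"
    using assms by (auto simp: in_L2_def)
  have *: "(norm (a + b))\<^sup>2 \<le> 2 * (norm a)\<^sup>2 + 2 * (norm b)\<^sup>2" for a b :: 'a
  proof -
    have "(norm (a + b))\<^sup>2 \<le> (norm a + norm b)\<^sup>2"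
      by (intro power_mono norm_triangle_ineq) auto
    also have "\<dots> \<le> 2 * (norm a)\<^sup>2 + 2 * (norm b)\<^sup>2"
      using sum_squares_bound[of "norm a" "norm b"] by (simp add: power2_sum)
    finally show ?thesis .
  qed
  show "integrable M (\<lambda>\<omega>. (norm (X \<omega> + Y \<omega>))\<^sup>2)"
  proof (rule Bochner_Integration.integrable_bound)
    show "integrable M (\<lambda>\<omega>. 2 * (norm (X \<omega>))\<^sup>2 + 2 * (norm (Y \<omega>))\<^sup>2)"
      using assms by (simp add: in_L2_def)
  qed (use * in auto)
  show "(\<lambda>\<omega>. X \<omega> + Y \<omega>) \<in> borel_measurable M"
    by simp
qed

lemma in_L2_diff:
  assumes "in_L2 M X" "in_L2 M Y"
  shows "in_L2 M (\<lambda>\<omega>. X \<omega> - Y \<omega>)"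
  using in_L2_add[OF assms(1) in_L2_scaleR[OF assms(2), of "-1"]] by simp

lemma in_L2_uminus: "in_L2 M X \<Longrightarrow> in_L2 M (\<lambda>\<omega>. - X \<omega>)"
  using in_L2_scaleR[of M X "-1"] by simp

lemma in_L2_integrable_inner:
  fixes X Y :: "'w \<Rightarrow> 'a::euclidean_space"
  assumes "in_L2 M X" "in_L2 M Y"
  shows "integrable M (\<lambda>\<omega>. X \<omega> \<bullet> Y \<omega>)"
proof (rule Bochner_Integration.integrable_bound)
  show "integrable M (\<lambda>\<omega>. (norm (X \<omega>))\<^sup>2 + (norm (Y \<omega>))\<^sup>2)"
    using assms by (simp add: in_L2_def)
  have *: "\<bar>a \<bullet> b\<bar> \<le> (norm a)\<^sup>2 + (norm b)\<^sup>2" for a b :: 'a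
    using Cauchy_Schwarz_ineq2[of a b] sum_squares_bound[of "norm a" "norm b"]
      mult_nonneg_nonneg[OF norm_ge_zero[of a] norm_ge_zero[of b]] by linarith
  show "AE \<omega> in M. norm (X \<omega> \<bullet> Y \<omega>) \<le> norm ((norm (X \<omega>))\<^sup>2 + (norm (Y \<omega>))\<^sup>2)"
    using * by auto
  have [measurable]: "X \<in> borel_measurable M" "Y \<in> borel_measurable M"
    using assms by (auto simp: in_L2_def)
  show "(\<lambda>\<omega>. X \<omega> \<bullet> Y \<omega>) \<in> borel_measurable M"
    by simp
qed

lemma L2_norm_nonneg [simp]: "0 \<le> L2_norm M Y"
  by (simp add: L2_norm_def)

lemma L2_norm_power2: "(L2_norm M Y)\<^sup>2 = (\<integral>\<omega>. (norm (Y \<omega>))\<^sup>2 \<partial>M)"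
  by (simp add: L2_norm_def)

lemma L2_norm_zero [simp]: "L2_norm M (\<lambda>_. 0) = 0"
  by (simp add: L2_norm_def)

lemma L2_norm_norm [simp]: "L2_norm M (\<lambda>\<omega>. norm (Y \<omega>)) = L2_norm M Y"
  by (simp add: L2_norm_def)

lemma L2_norm_minus_commute: "L2_norm M (\<lambda>\<omega>. X \<omega> - Y \<omega>) = L2_norm M (\<lambda>\<omega>. Y \<omega> - X \<omega>)"
  by (simp add: L2_norm_def norm_minus_commute)

lemma L2_norm_scaleR: "L2_norm M (\<lambda>\<omega>. c *\<^sub>R Y \<omega>) = \<bar>c\<bar> * L2_norm M Y"
  by (simp add: L2_norm_def power_mult_distrib real_sqrt_mult)

lemma L2_norm_mono:
  assumes "in_L2 M Z" "Y \<in> borel_measurable M" "AE \<omega> in M. norm (Y \<omega>) \<le> norm (Z \<omega>)"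
  shows "L2_norm M Y \<le> L2_norm M Z"
  unfolding L2_norm_def
  by (intro real_sqrt_le_mono integral_mono_AE in_L2_integrable assms(1) in_L2_mono[OF assms])
    (use assms(3) in \<open>auto intro: power_mono\<close>)

lemma L2_norm_cong_AE:
  assumes "X \<in> borel_measurable M" "Y \<in> borel_measurable M" "AE \<omega> in M. X \<omega> = Y \<omega>"
  shows "L2_norm M X = L2_norm M Y"
  unfolding L2_norm_def using assms by (intro arg_cong[where f=sqrt] integral_cong_AE) auto

text \<open>Cauchy-Schwarz, from the nonnegativity of the second moment of \<open>s X + t Y\<close>
  as a quadratic form in \<open>s\<close> and \<open>t\<close>.\<close>

lemma L2_inner_le:
  fixes X Y :: "'w \<Rightarrow> 'a::euclidean_space"
  assumes X: "in_L2 M X" and Y: "in_L2 M Y"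
  shows "\<bar>\<integral>\<omega>. X \<omega> \<bullet> Y \<omega> \<partial>M\<bar> \<le> L2_norm M X * L2_norm M Y"
proof -
  define a b c where "a = L2_norm M X" and "b = (\<integral>\<omega>. X \<omega> \<bullet> Y \<omega> \<partial>M)" and "c = L2_norm M Y"
  note i = in_L2_integrable[OF X] in_L2_integrable[OF Y] in_L2_integrable_inner[OF X Y]
  have q: "0 \<le> s\<^sup>2 * a\<^sup>2 + 2 * s * t * b + t\<^sup>2 * c\<^sup>2" for s t :: real
  proof -
    have "0 \<le> (\<integral>\<omega>. (norm (s *\<^sub>R X \<omega> + t *\<^sub>R Y \<omega>))\<^sup>2 \<partial>M)"
      by simp
    also have "\<dots> = (\<integral>\<omega>. s\<^sup>2 * (norm (X \<omega>))\<^sup>2 + 2 * s * t * (X \<omega> \<bullet> Y \<omega>) + t\<^sup>2 * (norm (Y \<omega>))\<^sup>2 \<partial>M)"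
      unfolding power2_norm_eq_inner
      by (intro Bochner_Integration.integral_cong refl)
        (simp add: inner_commute power2_eq_square algebra_simps)
    also have "\<dots> = s\<^sup>2 * a\<^sup>2 + 2 * s * t * b + t\<^sup>2 * c\<^sup>2"
      using i by (simp add: a_def b_def c_def L2_norm_power2)
    finally show ?thesis .
  qed
  have ac: "0 \<le> a" "0 \<le> c"
    by (auto simp: a_def c_def)
  have "\<bar>b\<bar> \<le> a * c"
  proof (cases "a = 0 \<or> c = 0")
    case False
    with ac have "a > 0" "c > 0" by auto
    \<comment> \<open>With \<open>s = c\<close> and \<open>t = a\<close> or \<open>t = -a\<close>
      the form is twice the respective product.\<close>
    have "0 \<le> (a * c) * (a * c + b)" "0 \<le> (a * c) * (a * c - b)"
      using q[of c a] q[of c "-a"] by (simp_all add: power2_eq_square algebra_simps)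
    then have "0 \<le> a * c + b" "0 \<le> a * c - b"
      using \<open>a > 0\<close> \<open>c > 0\<close> by (metis zero_le_mult_iff mult_pos_pos not_less)+
    then show ?thesis
      by simp
  next
    case True
    have "b = 0"
    proof (rule ccontr)
      assume "b \<noteq> 0"
      from True show False
      proof
        \<comment> \<open>In both degenerate cases the chosen argument makes the form equal to
          -1.\<close>
        assume "a = 0"
        then show False
          using q[of "- (c\<^sup>2 + 1) / (2 * b)" 1] \<open>b \<noteq> 0\<close> by (simp add: field_simps)
      next
        assume "c = 0"
        then show False
          using q[of 1 "- (a\<^sup>2 + 1) / (2 * b)"] \<open>b \<noteq> 0\<close> by (simp add: field_simps)
      qed
    qed
    with ac show ?thesis by simp
  qed
  then show ?thesis
    by (simp add: a_def b_def c_def)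
qed

lemma L2_norm_add_power2:
  assumes X: "in_L2 M X" and Y: "in_L2 M Y"
  shows "(L2_norm M (\<lambda>\<omega>. X \<omega> + Y \<omega>))\<^sup>2 = (L2_norm M X)\<^sup>2 + 2 * (\<integral>\<omega>. X \<omega> \<bullet> Y \<omega> \<partial>M) + (L2_norm M Y)\<^sup>2"
proof -
  note i = in_L2_integrable[OF X] in_L2_integrable[OF Y] in_L2_integrable_inner[OF X Y]
  have "(\<integral>\<omega>. (norm (X \<omega> + Y \<omega>))\<^sup>2 \<partial>M) = (\<integral>\<omega>. (norm (X \<omega>))\<^sup>2 + 2 * (X \<omega> \<bullet> Y \<omega>) + (norm (Y \<omega>))\<^sup>2 \<partial>M)"
    by (intro Bochner_Integration.integral_cong refl) (simp add: power2_norm_eq_inner inner_commute algebra_simps)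
  then show ?thesis
    using i by (simp add: L2_norm_power2)
qed

lemma L2_norm_triangle:
  assumes X: "in_L2 M X" and Y: "in_L2 M Y"
  shows "L2_norm M (\<lambda>\<omega>. X \<omega> + Y \<omega>) \<le> L2_norm M X + L2_norm M Y"
proof (rule power2_le_imp_le)
  show "(L2_norm M (\<lambda>\<omega>. X \<omega> + Y \<omega>))\<^sup>2 \<le> (L2_norm M X + L2_norm M Y)\<^sup>2"
    using L2_inner_le[OF X Y] by (simp add: L2_norm_add_power2[OF X Y] power2_sum)
qed simp

lemma L2_norm_triangle_diff:
  assumes X: "in_L2 M X" and Y: "in_L2 M Y"
  shows "L2_norm M (\<lambda>\<omega>. X \<omega> - Y \<omega>) \<le> L2_norm M X + L2_norm M Y"
  using L2_norm_triangle[OF X in_L2_scaleR[OF Y, of "-1"]] L2_norm_scaleR[of M "-1" Y] by simp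

lemma L2_norm_triangle3:
  assumes X: "in_L2 M X" and Y: "in_L2 M Y" and Z: "in_L2 M Z"
  shows "L2_norm M (\<lambda>\<omega>. X \<omega> - Z \<omega>) \<le> L2_norm M (\<lambda>\<omega>. X \<omega> - Y \<omega>) + L2_norm M (\<lambda>\<omega>. Y \<omega> - Z \<omega>)"
  using L2_norm_triangle[OF in_L2_diff[OF X Y] in_L2_diff[OF Y Z]] by simp

lemma L2_norm_triangle_sub:
  assumes X: "in_L2 M X" and Y: "in_L2 M Y"
  shows "L2_norm M X \<le> L2_norm M Y + L2_norm M (\<lambda>\<omega>. X \<omega> - Y \<omega>)"
  using L2_norm_triangle[OF Y in_L2_diff[OF X Y]] by simp

lemma nn_integral_L2_norm:
  "in_L2 M Y \<Longrightarrow> (\<integral>\<^sup>+\<omega>. ennreal ((norm (Y \<omega>))\<^sup>2) \<partial>M) = ennreal ((L2_norm M Y)\<^sup>2)"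
  unfolding L2_norm_power2 by (intro nn_integral_eq_integral) (auto simp: in_L2_def)

lemma nn_integral_L2_le:
  assumes "in_L2 M Y" "L2_norm M Y \<le> \<theta>"
  shows "(\<integral>\<^sup>+\<omega>. ennreal ((norm (Y \<omega>))\<^sup>2) \<partial>M) \<le> ennreal (\<theta>\<^sup>2)"
  unfolding nn_integral_L2_norm[OF assms(1)] by (intro ennreal_leI power_mono assms(2)) simp

lemma in_L2_nn_integralI:
  assumes "Y \<in> borel_measurable M" "(\<integral>\<^sup>+\<omega>. ennreal ((norm (Y \<omega>))\<^sup>2) \<partial>M) < \<infinity>"
  shows "in_L2 M Y"
  using assms by (auto simp: in_L2_def integrable_iff_bounded)

lemma in_L2_nn_integral_leI:
  assumes "Y \<in> borel_measurable M" "(\<integral>\<^sup>+\<omega>. ennreal ((norm (Y \<omega>))\<^sup>2) \<partial>M) \<le> ennreal (B\<^sup>2)" "0 \<le> B"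
  shows "in_L2 M Y" "L2_norm M Y \<le> B"
proof -
  show *: "in_L2 M Y"
    using assms(2) by (intro in_L2_nn_integralI assms(1)) (auto simp: less_top[symmetric] top_unique)
  show "L2_norm M Y \<le> B"
    using assms(2,3) by (simp add: nn_integral_L2_norm[OF *] abs_le_square_iff[symmetric])
qed

lemma (in finite_measure) in_L2_const: "in_L2 M (\<lambda>_. c)"
  by (simp add: in_L2_def)

lemma (in finite_measure) in_L2_integrable_vec:
  assumes "in_L2 M Y"
  shows "integrable M Y"
proof (rule Bochner_Integration.integrable_bound)
  show "integrable M (\<lambda>\<omega>. 1 + (norm (Y \<omega>))\<^sup>2)"
    using assms by (simp add: in_L2_def)
  have *: "x \<le> 1 + x\<^sup>2" for x :: real
  proof -
    have "0 \<le> (x - 1 / 2)\<^sup>2"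
      by simp
    then show ?thesis
      by (simp add: power2_diff field_simps)
  qed
  show "AE \<omega> in M. norm (Y \<omega>) \<le> norm (1 + (norm (Y \<omega>))\<^sup>2)"
    using * by auto
qed (use assms in \<open>auto simp: in_L2_def\<close>)

lemma (in prob_space) L2_norm_const: "L2_norm M (\<lambda>_. c) = norm c"
  by (simp add: L2_norm_def prob_space)

lemma (in prob_space) expectation_norm_le_L2_norm:
  assumes "in_L2 M Y"
  shows "expectation (\<lambda>\<omega>. norm (Y \<omega>)) \<le> L2_norm M Y"
  using L2_inner_le[OF in_L2_norm[OF assms] in_L2_const[of "1::real"]]
  by (simp add: L2_norm_const)

text \<open>Minkowski for a pointwise affine bound. It turns linear growth of the coefficients into
  norm bounds, and with \<open>c = 0\<close> or \<open>c = C0 * sqrt h\<close> it does the same for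
  their Lipschitz and Hoelder estimates.\<close>

lemma (in prob_space) in_L2_affine_bound:
  assumes Y: "in_L2 M Y" and Z: "Z \<in> borel_measurable M" and "0 \<le> c" "0 \<le> k"
    and le: "\<And>\<omega>. norm (Z \<omega>) \<le> c + k * norm (Y \<omega>)"
  shows "in_L2 M Z" "L2_norm M Z \<le> c + k * L2_norm M Y"
proof -
  have Y': "in_L2 M (\<lambda>\<omega>. k *\<^sub>R norm (Y \<omega>))"
    by (intro in_L2_scaleR in_L2_norm Y)
  have R: "in_L2 M (\<lambda>\<omega>. c + k *\<^sub>R norm (Y \<omega>))"
    by (intro in_L2_add in_L2_const Y')
  have le': "AE \<omega> in M. norm (Z \<omega>) \<le> norm (c + k *\<^sub>R norm (Y \<omega>))"
    using le assms(3,4) by (intro AE_I2) (auto intro: order_trans[OF le abs_ge_self])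
  show "in_L2 M Z"
    by (rule in_L2_mono[OF R Z le'])
  have "L2_norm M Z \<le> L2_norm M (\<lambda>\<omega>. c + k *\<^sub>R norm (Y \<omega>))"
    by (rule L2_norm_mono[OF R Z le'])
  also have "\<dots> \<le> L2_norm M (\<lambda>\<omega>. c) + L2_norm M (\<lambda>\<omega>. k *\<^sub>R norm (Y \<omega>))"
    by (intro L2_norm_triangle in_L2_const Y')
  also have "\<dots> = c + k * L2_norm M Y"
    using assms(3,4) unfolding L2_norm_scaleR by (simp add: L2_norm_const)
  finally show "L2_norm M Z \<le> c + k * L2_norm M Y" .
qed

section \<open>Mean-square limits, completeness and weak convergence\<close>

lemma L2_limit_diff_bound:
  assumes "L2_limit M Y Z"
  shows "\<bar>L2_norm M (Y k) - L2_norm M Z\<bar> \<le> L2_norm M (\<lambda>\<omega>. Y k \<omega> - Z \<omega>)"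
proof -
  have "in_L2 M (Y k)" "in_L2 M Z"
    using assms by (auto simp: L2_limit_def)
  from L2_norm_triangle_sub[OF this] L2_norm_triangle_sub[OF this(2,1)]
  show ?thesis
    by (auto simp: L2_norm_minus_commute[of M Z])
qed

lemma L2_limit_norm:
  assumes "L2_limit M Y Z"
  shows "(\<lambda>k. L2_norm M (Y k)) \<longlonglongrightarrow> L2_norm M Z"
proof (rule Lim_transform)
  show "(\<lambda>k. L2_norm M (Y k) - L2_norm M Z) \<longlonglongrightarrow> 0"
    by (rule Lim_null_comparison[where g="\<lambda>k. L2_norm M (\<lambda>\<omega>. Y k \<omega> - Z \<omega>)"])
      (use assms L2_limit_diff_bound[OF assms] in \<open>auto simp: L2_limit_def\<close>)
qed auto

lemma L2_limitI:
  assumes "\<And>k. in_L2 M (Y k)" "in_L2 M Z" "(\<lambda>k. L2_norm M (\<lambda>\<omega>. Y k \<omega> - Z \<omega>)) \<longlonglongrightarrow> 0"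
  shows "L2_limit M Y Z"
  using assms by (auto simp: L2_limit_def)

lemma L2_limit_diff:
  assumes "L2_limit M Y Z" "L2_limit M Y' Z'"
  shows "L2_limit M (\<lambda>k \<omega>. Y k \<omega> - Y' k \<omega>) (\<lambda>\<omega>. Z \<omega> - Z' \<omega>)"
proof (rule L2_limitI)
  have i: "in_L2 M (Y k)" "in_L2 M Z" "in_L2 M (Y' k)" "in_L2 M Z'" for k
    using assms by (auto simp: L2_limit_def)
  then show "in_L2 M (\<lambda>\<omega>. Y k \<omega> - Y' k \<omega>)" "in_L2 M (\<lambda>\<omega>. Z \<omega> - Z' \<omega>)" for k
    by (auto intro: in_L2_diff)
  have eq: "(\<lambda>\<omega>. Y k \<omega> - Y' k \<omega> - (Z \<omega> - Z' \<omega>)) = (\<lambda>\<omega>. (Y k \<omega> - Z \<omega>) - (Y' k \<omega> - Z' \<omega>))" for k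
    by (simp add: fun_eq_iff)
  have lim: "(\<lambda>k. L2_norm M (\<lambda>\<omega>. Y k \<omega> - Z \<omega>) + L2_norm M (\<lambda>\<omega>. Y' k \<omega> - Z' \<omega>)) \<longlonglongrightarrow> 0"
    using assms by (intro tendsto_add_zero) (auto simp: L2_limit_def)
  show "(\<lambda>k. L2_norm M (\<lambda>\<omega>. Y k \<omega> - Y' k \<omega> - (Z \<omega> - Z' \<omega>))) \<longlonglongrightarrow> 0"
    unfolding eq by (rule Lim_null_comparison[OF _ lim]) (auto intro!: always_eventually L2_norm_triangle_diff in_L2_diff i)
qed

lemma L2_limit_inner:
  assumes "L2_limit M Y Z" "in_L2 M X"
  shows "(\<lambda>k. \<integral>\<omega>. X \<omega> \<bullet> Y k \<omega> \<partial>M) \<longlonglongrightarrow> (\<integral>\<omega>. X \<omega> \<bullet> Z \<omega> \<partial>M)"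
proof (rule Lim_transform)
  have i: "in_L2 M (Y k)" "in_L2 M Z" for k
    using assms by (auto simp: L2_limit_def)
  have eq: "(\<integral>\<omega>. X \<omega> \<bullet> Y k \<omega> \<partial>M) - (\<integral>\<omega>. X \<omega> \<bullet> Z \<omega> \<partial>M) = (\<integral>\<omega>. X \<omega> \<bullet> (Y k \<omega> - Z \<omega>) \<partial>M)" for k
    using in_L2_integrable_inner[OF assms(2) i(1)[of k]] in_L2_integrable_inner[OF assms(2) i(2)]
    by (simp add: inner_diff_right)
  have lim: "(\<lambda>k. L2_norm M X * L2_norm M (\<lambda>\<omega>. Y k \<omega> - Z \<omega>)) \<longlonglongrightarrow> 0"
    using assms(1) by (intro tendsto_mult_right_zero) (auto simp: L2_limit_def)
  show "(\<lambda>k. (\<integral>\<omega>. X \<omega> \<bullet> Y k \<omega> \<partial>M) - (\<integral>\<omega>. X \<omega> \<bullet> Z \<omega> \<partial>M)) \<longlonglongrightarrow> 0"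
    unfolding eq
    by (rule Lim_null_comparison[OF _ lim]) (auto intro!: always_eventually L2_inner_le assms(2) in_L2_diff i)
qed auto

text \<open>Riesz-Fischer: a Cauchy sequence in mean square is Cauchy in mean, so a subsequence is
  Cauchy almost everywhere and supplies \<open>Z\<close>. Fatou along that subsequence carries the
  Cauchy bound over to \<open>Y k - Z\<close>.\<close>

lemma (in prob_space) L2_complete:
  fixes Y :: "nat \<Rightarrow> 'a \<Rightarrow> 'b::euclidean_space"
  assumes Y: "\<And>k. in_L2 M (Y k)"
    and Cauchy: "\<And>e. 0 < e \<Longrightarrow> \<exists>N. \<forall>i\<ge>N. \<forall>j\<ge>N. L2_norm M (\<lambda>\<omega>. Y i \<omega> - Y j \<omega>) \<le> e"
  obtains Z where "L2_limit M Y Z"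
proof -
  have [measurable]: "Y k \<in> borel_measurable M" for k
    using Y by (rule in_L2_measurable)
  have "\<exists>N. \<forall>i\<ge>N. \<forall>j\<ge>N. expectation (\<lambda>\<omega>. norm (Y i \<omega> - Y j \<omega>)) < e" if "0 < e" for e
  proof -
    obtain N where "\<forall>i\<ge>N. \<forall>j\<ge>N. L2_norm M (\<lambda>\<omega>. Y i \<omega> - Y j \<omega>) \<le> e / 2"
      using Cauchy[OF half_gt_zero[OF \<open>0 < e\<close>]] by auto
    then show ?thesis
      using that by (intro exI[of _ N] allI impI
          le_less_trans[OF expectation_norm_le_L2_norm[OF in_L2_diff[OF Y Y]]]) force
  qed
  then obtain r where r: "strict_mono r" "AE \<omega> in M. Cauchy (\<lambda>i. Y (r i) \<omega>)"
    by (rule cauchy_L1_AE_cauchy_subseq[OF in_L2_integrable_vec[OF Y]])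
  define Z where "Z \<omega> = lim (\<lambda>i. Y (r i) \<omega>)" for \<omega>
  have [measurable]: "Z \<in> borel_measurable M"
    unfolding Z_def by measurable
  have lim: "AE \<omega> in M. (\<lambda>i. Y (r i) \<omega>) \<longlonglongrightarrow> Z \<omega>"
    using r(2) by eventually_elim (auto simp: Z_def Cauchy_convergent_iff convergent_LIMSEQ_iff)
  have key: "in_L2 M (\<lambda>\<omega>. Y k \<omega> - Z \<omega>) \<and> L2_norm M (\<lambda>\<omega>. Y k \<omega> - Z \<omega>) \<le> e"
    if "0 < e" "\<forall>i\<ge>N. \<forall>j\<ge>N. L2_norm M (\<lambda>\<omega>. Y i \<omega> - Y j \<omega>) \<le> e" "k \<ge> N" for e N k
  proof -
    have "(\<integral>\<^sup>+\<omega>. ennreal ((norm (Y k \<omega> - Z \<omega>))\<^sup>2) \<partial>M)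
        = (\<integral>\<^sup>+\<omega>. liminf (\<lambda>i. ennreal ((norm (Y k \<omega> - Y (r i) \<omega>))\<^sup>2)) \<partial>M)"
    proof (intro nn_integral_cong_AE, use lim in eventually_elim)
      fix \<omega> assume "(\<lambda>i. Y (r i) \<omega>) \<longlonglongrightarrow> Z \<omega>"
      then have "(\<lambda>i. ennreal ((norm (Y k \<omega> - Y (r i) \<omega>))\<^sup>2)) \<longlonglongrightarrow> ennreal ((norm (Y k \<omega> - Z \<omega>))\<^sup>2)"
        by (intro tendsto_intros) auto
      then show "ennreal ((norm (Y k \<omega> - Z \<omega>))\<^sup>2) = liminf (\<lambda>i. ennreal ((norm (Y k \<omega> - Y (r i) \<omega>))\<^sup>2))"
        by (intro lim_imp_Liminf[symmetric]) auto
    qed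
    also have "\<dots> \<le> liminf (\<lambda>i. \<integral>\<^sup>+\<omega>. ennreal ((norm (Y k \<omega> - Y (r i) \<omega>))\<^sup>2) \<partial>M)"
      by (rule nn_integral_liminf) simp
    also have "\<dots> = liminf (\<lambda>i. ennreal ((L2_norm M (\<lambda>\<omega>. Y k \<omega> - Y (r i) \<omega>))\<^sup>2))"
      by (subst nn_integral_L2_norm[OF in_L2_diff[OF Y Y]]) simp
    also have "\<dots> \<le> ennreal (e\<^sup>2)"
    proof -
      have "ennreal ((L2_norm M (\<lambda>\<omega>. Y k \<omega> - Y (r i) \<omega>))\<^sup>2) \<le> ennreal (e\<^sup>2)" if "i \<ge> N" for i
        using that \<open>k \<ge> N\<close> \<open>\<forall>i\<ge>N. _\<close> seq_suble[OF r(1), of i]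
        by (intro ennreal_leI power_mono) auto
      then have "limsup (\<lambda>i. ennreal ((L2_norm M (\<lambda>\<omega>. Y k \<omega> - Y (r i) \<omega>))\<^sup>2)) \<le> ennreal (e\<^sup>2)"
        by (intro Limsup_bounded) (auto simp: eventually_sequentially)
      then show ?thesis
        using Liminf_le_Limsup order_trans trivial_limit_sequentially by blast
    qed
    finally show ?thesis
      using in_L2_nn_integral_leI[of "\<lambda>\<omega>. Y k \<omega> - Z \<omega>" M e] \<open>0 < e\<close> by auto
  qed
  \<comment> \<open>\<open>Z\<close> is the difference of \<open>Y N\<close> and
    \<open>Y N - Z\<close>, both square-integrable.\<close>
  have Z: "in_L2 M Z"
  proof -
    obtain N where "\<forall>i\<ge>N. \<forall>j\<ge>N. L2_norm M (\<lambda>\<omega>. Y i \<omega> - Y j \<omega>) \<le> 1"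
      using Cauchy[of 1] by auto
    with key[of 1 N N] have "in_L2 M (\<lambda>\<omega>. Y N \<omega> - Z \<omega>)"
      by auto
    from in_L2_diff[OF Y[of N] this] show ?thesis
      by simp
  qed
  have "L2_limit M Y Z"
  proof (intro L2_limitI Y Z LIMSEQ_I)
    fix e :: real assume "0 < e"
    then obtain N where "\<forall>i\<ge>N. \<forall>j\<ge>N. L2_norm M (\<lambda>\<omega>. Y i \<omega> - Y j \<omega>) \<le> e / 2"
      using Cauchy[OF half_gt_zero[OF \<open>0 < e\<close>]] by auto
    then have "L2_norm M (\<lambda>\<omega>. Y k \<omega> - Z \<omega>) \<le> e / 2" if "k \<ge> N" for k
      using key[of "e / 2" N k] \<open>0 < e\<close> that by simp
    with \<open>0 < e\<close> show "\<exists>N. \<forall>k\<ge>N. norm (L2_norm M (\<lambda>\<omega>. Y k \<omega> - Z \<omega>) - 0) < e"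
      by (intro exI[of _ N]) fastforce
  qed
  with that show thesis .
qed

text \<open>The test function is merely continuous and bounded, so no rate is available. If the
  expectations failed to converge, some subsequence would stay at distance \<open>e\<close>; a
  further subsequence converges almost everywhere, and dominated convergence contradicts
  this.\<close>

lemma (in prob_space) L2_limit_converges_weakly:
  fixes Y :: "nat \<Rightarrow> 'a \<Rightarrow> 'b::euclidean_space"
  assumes "L2_limit M Y Z"
  shows "converges_weakly (\<lambda>k. distr M borel (Y k)) (distr M borel Z)"
  unfolding converges_weakly_def
proof (intro allI impI)
  fix \<phi> :: "'b \<Rightarrow> real"
  assume \<phi>: "continuous_on UNIV \<phi> \<and> bounded (range \<phi>)"
  then obtain B where B: "\<And>x. \<bar>\<phi> x\<bar> \<le> B"
    by (auto simp: bounded_iff)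
  have [measurable]: "\<phi> \<in> borel_measurable borel"
    using \<phi> by (intro borel_measurable_continuous_onI) auto
  have i: "in_L2 M (Y k)" "in_L2 M Z" for k
    using assms by (auto simp: L2_limit_def)
  then have [measurable]: "Y k \<in> borel_measurable M" "Z \<in> borel_measurable M" for k
    by (auto simp: in_L2_def)
  have "(\<lambda>k. expectation (\<lambda>\<omega>. \<phi> (Y k \<omega>))) \<longlonglongrightarrow> expectation (\<lambda>\<omega>. \<phi> (Z \<omega>))"
  proof (rule ccontr)
    assume "\<not> ?thesis"
    then obtain e where "0 < e"
      and "\<exists>\<^sub>F k in sequentially. \<not> dist (expectation (\<lambda>\<omega>. \<phi> (Y k \<omega>))) (expectation (\<lambda>\<omega>. \<phi> (Z \<omega>))) < e"
      by (auto simp: tendsto_iff not_eventually)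
    then have inf: "infinite {k. \<not> dist (expectation (\<lambda>\<omega>. \<phi> (Y k \<omega>))) (expectation (\<lambda>\<omega>. \<phi> (Z \<omega>))) < e}"
      by (simp add: frequently_cofinite flip: cofinite_eq_sequentially)
    define s where "s = enumerate {k. \<not> dist (expectation (\<lambda>\<omega>. \<phi> (Y k \<omega>))) (expectation (\<lambda>\<omega>. \<phi> (Z \<omega>))) < e}"
    have s: "strict_mono s"
      using inf by (auto simp: s_def intro: strict_mono_enumerate)
    have far: "\<not> dist (expectation (\<lambda>\<omega>. \<phi> (Y (s k) \<omega>))) (expectation (\<lambda>\<omega>. \<phi> (Z \<omega>))) < e" for k
      using enumerate_in_set[OF inf, of k] by (simp add: s_def)
    have "(\<lambda>k. L2_norm M (\<lambda>\<omega>. Y (s k) \<omega> - Z \<omega>)) \<longlonglongrightarrow> 0"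
      using assms LIMSEQ_subseq_LIMSEQ[OF _ s] by (auto simp: L2_limit_def comp_def)
    then have "(\<lambda>k. expectation (\<lambda>\<omega>. norm (Y (s k) \<omega> - Z \<omega>))) \<longlonglongrightarrow> 0"
      by (rule tendsto_sandwich[OF _ _ tendsto_const, rotated 2])
        (use expectation_norm_le_L2_norm[OF in_L2_diff[OF i]] in auto)
    with tendsto_L1_AE_subseq[of M "\<lambda>k \<omega>. Y (s k) \<omega> - Z \<omega>"] in_L2_integrable_vec[OF in_L2_diff[OF i]]
    obtain r where r: "strict_mono r" "AE \<omega> in M. (\<lambda>k. Y (s (r k)) \<omega> - Z \<omega>) \<longlonglongrightarrow> 0"
      by auto
    have "(\<lambda>k. expectation (\<lambda>\<omega>. \<phi> (Y (s (r k)) \<omega>))) \<longlonglongrightarrow> expectation (\<lambda>\<omega>. \<phi> (Z \<omega>))"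
    proof (rule integral_dominated_convergence[where w="\<lambda>_. B"])
      show "AE \<omega> in M. (\<lambda>k. \<phi> (Y (s (r k)) \<omega>)) \<longlonglongrightarrow> \<phi> (Z \<omega>)"
        using r(2)
      proof eventually_elim
        case (elim \<omega>)
        then show ?case
          using \<phi> by (intro continuous_on_tendsto_compose[of UNIV \<phi>]) (auto dest: Lim_null[THEN iffD2])
      qed
    qed (use B in auto)
    then have "\<forall>\<^sub>F k in sequentially. dist (expectation (\<lambda>\<omega>. \<phi> (Y (s (r k)) \<omega>))) (expectation (\<lambda>\<omega>. \<phi> (Z \<omega>))) < e"
      using \<open>0 < e\<close> by (rule tendstoD)
    with far show False
      by (auto simp: eventually_sequentially)
  qed
  then show "(\<lambda>k. \<integral>x. \<phi> x \<partial>distr M borel (Y k)) \<longlonglongrightarrow> (\<integral>x. \<phi> x \<partial>distr M borel Z)"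
    by (simp add: integral_distr)
qed

section \<open>Independence of Wiener increments from the past\<close>

lemma Int_stable_vimage_borel: "Int_stable {X -` B \<inter> A | B. B \<in> sets borel}"
proof (rule Int_stableI)
  fix a b assume "a \<in> {X -` B \<inter> A | B. B \<in> sets borel}" "b \<in> {X -` B \<inter> A | B. B \<in> sets borel}"
  then obtain B C where "a = X -` B \<inter> A" "b = X -` C \<inter> A" "B \<in> sets borel" "C \<in> sets borel"
    by blast
  then show "a \<inter> b \<in> {X -` B \<inter> A | B. B \<in> sets borel}"
    by (intro CollectI exI[of _ "B \<inter> C"]) auto
qed

locale wiener_space = prob_space M
  for M :: "'w measure" and W :: "real \<Rightarrow> 'w \<Rightarrow> real ^ 'd" +
  assumes wiener: "two_sided_wiener M W"
begin

abbreviation F :: "real \<Rightarrow> 'w measure" where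
  "F \<equiv> augmented_filtration M W"

lemma measurable_W [measurable]: "W t \<in> borel_measurable M"
  using wiener by (simp add: two_sided_wiener_def)

lemma space_increment_filtration [simp]: "space (increment_filtration M W t) = space M"
  unfolding increment_filtration_def by (rule space_measure_of) auto

lemma sets_increment_filtration:
  "sets (increment_filtration M W t) = sigma_sets (space M)
     {(\<lambda>\<omega>. W u \<omega> - W v \<omega>) -` B \<inter> space M | s u v B. s \<le> v \<and> v \<le> u \<and> u \<le> t \<and> B \<in> sets borel}"
  unfolding increment_filtration_def by (rule sets_measure_of) auto

lemma increment_filtration_subset: "sets (increment_filtration M W t) \<subseteq> sets M"
  unfolding sets_increment_filtration by (intro sets.sigma_sets_subset) auto

lemma increment_filtration_mono:
  "s \<le> t \<Longrightarrow> sets (increment_filtration M W s) \<subseteq> sets (increment_filtration M W t)"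
  unfolding sets_increment_filtration
  by (intro sigma_sets_mono' subsetI) force

lemma F_generator_subset: "sets (increment_filtration M W t) \<union> null_sets M \<subseteq> Pow (space M)"
  using increment_filtration_subset sets.space_closed[of M] by (auto simp: null_sets_def)

lemma space_F [simp]: "space (F t) = space M"
  unfolding augmented_filtration_def by (rule space_measure_of[OF F_generator_subset])

lemma sets_F: "sets (F t) = sigma_sets (space M) (sets (increment_filtration M W t) \<union> null_sets M)"
  unfolding augmented_filtration_def by (rule sets_measure_of[OF F_generator_subset])

lemma sets_F_subset: "sets (F t) \<subseteq> sets M"
  unfolding sets_F by (intro sets.sigma_sets_subset) (use increment_filtration_subset in auto)

lemma sets_F_mono: "s \<le> t \<Longrightarrow> sets (F s) \<subseteq> sets (F t)"
  unfolding sets_F using increment_filtration_mono[of s t] by (intro sigma_sets_mono' Un_mono) simp_all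

lemma increment_filtration_subset_F: "sets (increment_filtration M W t) \<subseteq> sets (F t)"
  unfolding sets_F by (intro subsetI sigma_sets.Basic UnI1)

lemma F_measurable_imp_measurable: "H \<in> measurable (F t) N \<Longrightarrow> H \<in> measurable M N"
  using sets_F_subset by (auto simp: measurable_def)

lemma F_measurable_mono: "H \<in> measurable (F s) N \<Longrightarrow> s \<le> t \<Longrightarrow> H \<in> measurable (F t) N"
  by (rule measurableI) (auto dest: measurable_space measurable_sets intro!: subsetD[OF sets_F_mono[of s t]])

lemma increment_F_measurable:
  assumes "v \<le> u" "u \<le> t"
  shows "(\<lambda>\<omega>. W u \<omega> - W v \<omega>) \<in> borel_measurable (F t)"
proof (rule measurableI)
  fix B :: "(real ^ 'd) set" assume "B \<in> sets borel"
  with assms have "(\<lambda>\<omega>. W u \<omega> - W v \<omega>) -` B \<inter> space M \<in> sets (increment_filtration M W t)"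
    unfolding sets_increment_filtration by (intro sigma_sets.Basic) auto
  then show "(\<lambda>\<omega>. W u \<omega> - W v \<omega>) -` B \<inter> space (F t) \<in> sets (F t)"
    using increment_filtration_subset_F by auto
qed simp

text \<open>The past is generated by increments over arbitrary, possibly overlapping intervals,
  while independence is given for successive increments of a monotone sequence. Finitely many past
  intervals have a common grid ending in \<open>s\<close>; appending \<open>t\<close> makes the last
  increment independent of all earlier ones, of which the past increments are sums. Finite
  intersections form a stable generator, so independence extends to the generated
  \<sigma>-algebra.\<close>

lemma indep_increment_filtration:
  assumes "s < t"
  shows "indep_set (sets (increment_filtration M W s))
    {(\<lambda>\<omega>. W t \<omega> - W s \<omega>) -` B \<inter> space M | B. B \<in> sets borel}"
    (is "indep_set _ ?E")
proof -
  \<comment> \<open>A triple \<open>(v, u, B)\<close> in a list stands for the condition that the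
    increment from \<open>v\<close> to \<open>u\<close> lies in \<open>B\<close>. Lists make
    \<open>P\<close> stable under intersection, by concatenation.\<close>
  define good where "good = (\<lambda>L. \<forall>(v, u, B)\<in>set L. v \<le> u \<and> u \<le> s \<and> B \<in> sets (borel :: (real^'d) measure))"
  define ev where "ev = (\<lambda>L. {\<omega>\<in>space M. \<forall>(v, u, B)\<in>set L. W u \<omega> - W v \<omega> \<in> B})"
  define P where "P = ev ` Collect good"
  have indep: "prob (ev L \<inter> ((\<lambda>\<omega>. W t \<omega> - W s \<omega>) -` B0 \<inter> space M))
      = prob (ev L) * prob ((\<lambda>\<omega>. W t \<omega> - W s \<omega>) -` B0 \<inter> space M)"
    if L: "good L" and B0: "B0 \<in> sets borel" for L B0
  proof -
    define T where "T = insert s (fst ` set L \<union> (fst \<circ> snd) ` set L)"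
    have T: "finite T" "\<And>v. v \<in> T \<Longrightarrow> v \<le> s" "s \<in> T"
      using L unfolding T_def good_def by auto
    define xs where "xs = sorted_list_of_set T"
    have xs: "sorted xs" "set xs = T"
      using T by (auto simp: xs_def)
    define N where "N = length xs - 1"
    have len: "length xs = Suc N"
      using xs(2) T(3) by (cases xs) (auto simp: N_def)
    \<comment> \<open>The sequence must be monotone on all of \<open>nat\<close>. It stays at
      \<open>t\<close> beyond index \<open>N\<close>, so the increment with index \<open>N\<close>
      is the one from \<open>s\<close> to \<open>t\<close>.\<close>
    define x where "x i = (if i \<le> N then xs ! i else t)" for i
    have in_T: "x i \<in> T" if "i \<le> N" for i
      using that xs len by (auto simp: x_def intro: nth_mem)
    have "mono x"
    proof (rule monoI)
      fix i j :: nat assume "i \<le> j"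
      then consider "j \<le> N" | "i \<le> N" "N < j" | "N < i"
        by linarith
      then show "x i \<le> x j"
        using T(2)[OF in_T[of i]] \<open>s < t\<close> \<open>i \<le> j\<close> sorted_nth_mono[OF xs(1), of i j] len
        by cases (auto simp: x_def)
    qed
    have "x N = s"
    proof -
      obtain i where "i < length xs" "xs ! i = s"
        using xs T(3) by (auto simp: in_set_conv_nth)
      then have "s \<le> x N"
        using \<open>mono x\<close> len monoD[of x i N] by (auto simp: x_def)
      with T(2)[OF in_T[of N]] show ?thesis by simp
    qed
    define d where "d i \<omega> = W (x (Suc i)) \<omega> - W (x i) \<omega>" for i \<omega>
    have "indep_vars (\<lambda>_. borel) d {..<Suc N}"
      using wiener \<open>mono x\<close> unfolding two_sided_wiener_def d_def by blast
    from indep_var_restrict[OF this, of "{..<N}" "{N}"]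
    have ind: "indep_var (PiM {..<N} (\<lambda>_. borel)) (\<lambda>\<omega>. \<lambda>i\<in>{..<N}. d i \<omega>)
        (PiM {N} (\<lambda>_. borel)) (\<lambda>\<omega>. \<lambda>i\<in>{N}. d i \<omega>)"
      by auto
    \<comment> \<open>The position of an endpoint in the grid; a past increment telescopes into a
      sum of \<open>d k\<close> with \<open>k < N\<close>.\<close>
    define idx where "idx v = (SOME i. i \<le> N \<and> x i = v)" for v
    have idx: "idx v \<le> N \<and> x (idx v) = v" if "v \<in> T" for v
      unfolding idx_def by (rule someI_ex) (use that xs len in \<open>auto simp: in_set_conv_nth x_def less_Suc_eq_le\<close>)
    have sum: "W u \<omega> - W v \<omega> = (\<Sum>k = idx v..<idx u. d k \<omega>)" if "v \<in> T" "u \<in> T" "v \<le> u" for u v \<omega>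
    proof -
      have "idx v \<le> idx u"
        using idx[OF that(1)] idx[OF that(2)] that(3) monoD[OF \<open>mono x\<close>, of "idx u" "idx v"]
        by (cases "u = v") (auto simp: not_less[symmetric])
      from sum_Suc_diff'[OF this, of "\<lambda>i. W (x i) \<omega>"] show ?thesis
        using idx[OF that(1)] idx[OF that(2)] by (simp add: d_def)
    qed
    define Xa where "Xa = {y \<in> space (PiM {..<N} (\<lambda>_. borel :: (real^'d) measure)).
        \<forall>(v, u, B)\<in>set L. (\<Sum>k = idx v..<idx u. y k) \<in> B}"
    define Xb where "Xb = {y \<in> space (PiM {N} (\<lambda>_. borel :: (real^'d) measure)). y N \<in> B0}"
    have LT: "v \<in> T \<and> u \<in> T \<and> v \<le> u \<and> B \<in> sets borel" if "(v, u, B) \<in> set L" for v u B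
    proof (intro conjI)
      show "v \<le> u" "B \<in> sets borel"
        using L that by (auto simp: good_def)
      show "v \<in> T" "u \<in> T"
        unfolding T_def using that
        by (auto intro: rev_image_eqI)
    qed
    have "Xa \<in> sets (PiM {..<N} (\<lambda>_. borel))"
      unfolding Xa_def
    proof (intro sets.sets_Collect_finite_All finite_set)
      fix z assume z: "z \<in> set L"
      obtain v u B where zv: "z = (v, u, B)"
        by (cases z) auto
      have [measurable]: "B \<in> sets borel" and "idx u \<le> N"
        using LT[of v u B] z idx[of u] by (auto simp: zv)
      then have "(\<lambda>y. \<Sum>k = idx v..<idx u. y k) \<in> borel_measurable (PiM {..<N} (\<lambda>_. borel :: (real^'d) measure))"
        by (intro borel_measurable_sum measurable_component_singleton) auto
      then show "{y \<in> space (PiM {..<N} (\<lambda>_. borel)). case z of (v, u, B) \<Rightarrow> (\<Sum>k = idx v..<idx u. y k) \<in> B}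
          \<in> sets (PiM {..<N} (\<lambda>_. borel))"
        by (simp add: zv)
    qed
    moreover have "Xb \<in> sets (PiM {N} (\<lambda>_. borel))"
      unfolding Xb_def using B0 by measurable
    ultimately have "prob ((\<lambda>\<omega>. (\<lambda>i\<in>{..<N}. d i \<omega>, \<lambda>i\<in>{N}. d i \<omega>)) -` (Xa \<times> Xb) \<inter> space M)
        = prob ((\<lambda>\<omega>. \<lambda>i\<in>{..<N}. d i \<omega>) -` Xa \<inter> space M) * prob ((\<lambda>\<omega>. \<lambda>i\<in>{N}. d i \<omega>) -` Xb \<inter> space M)"
      by (rule indep_varD[OF ind])
    moreover have eqa: "(\<lambda>\<omega>. \<lambda>i\<in>{..<N}. d i \<omega>) -` Xa \<inter> space M = ev L"
    proof -
      have "(\<Sum>k = idx v..<idx u. (\<lambda>i\<in>{..<N}. d i \<omega>) k) = W u \<omega> - W v \<omega>" if "(v, u, B) \<in> set L" for v u B \<omega>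
      proof -
        have "k < N" if "k \<in> {idx v..<idx u}" for k
          using that idx[of u] LT[OF \<open>(v, u, B) \<in> set L\<close>] by auto
        then have "(\<Sum>k = idx v..<idx u. (\<lambda>i\<in>{..<N}. d i \<omega>) k) = (\<Sum>k = idx v..<idx u. d k \<omega>)"
          by (intro sum.cong) auto
        then show ?thesis
          using sum LT[OF that] by auto
      qed
      then show ?thesis
        by (auto simp: Xa_def ev_def space_PiM)
    qed
    moreover have eqb: "(\<lambda>\<omega>. \<lambda>i\<in>{N}. d i \<omega>) -` Xb \<inter> space M = (\<lambda>\<omega>. W t \<omega> - W s \<omega>) -` B0 \<inter> space M"
      using \<open>x N = s\<close> by (auto simp: Xb_def space_PiM d_def x_def)
    moreover have "(\<lambda>\<omega>. (\<lambda>i\<in>{..<N}. d i \<omega>, \<lambda>i\<in>{N}. d i \<omega>)) -` (Xa \<times> Xb) \<inter> space M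
        = ((\<lambda>\<omega>. \<lambda>i\<in>{..<N}. d i \<omega>) -` Xa \<inter> space M) \<inter> ((\<lambda>\<omega>. \<lambda>i\<in>{N}. d i \<omega>) -` Xb \<inter> space M)"
      by auto
    ultimately show ?thesis
      by simp
  qed
  have ev_sets: "ev L \<in> sets M" if "good L" for L
    unfolding ev_def
  proof (intro sets.sets_Collect_finite_All finite_set)
    fix z assume "z \<in> set L"
    with that show "{\<omega> \<in> space M. case z of (v, u, B) \<Rightarrow> W u \<omega> - W v \<omega> \<in> B} \<in> sets M"
      by (cases z) (auto simp: good_def)
  qed
  have "Int_stable P"
  proof (rule Int_stableI)
    fix a b assume "a \<in> P" "b \<in> P"
    then obtain L L' where "good L" "good L'" "a = ev L" "b = ev L'"
      by (auto simp: P_def)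
    then have "a \<inter> b = ev (L @ L')" "good (L @ L')"
      unfolding ev_def good_def set_append ball_Un by blast+
    then show "a \<inter> b \<in> P"
      by (auto simp: P_def)
  qed
  moreover have "Int_stable ?E"
    by (rule Int_stable_vimage_borel)
  moreover have "indep_set P ?E"
    using indep ev_sets by (intro indep_setI) (auto simp: P_def)
  ultimately have "indep_set (sigma_sets (space M) P) (sigma_sets (space M) ?E)"
    by (intro indep_set_sigma_sets)
  moreover have "sets (increment_filtration M W s) \<subseteq> sigma_sets (space M) P"
    unfolding sets_increment_filtration
  proof (rule sigma_sets_mono')
    show "{(\<lambda>\<omega>. W u \<omega> - W v \<omega>) -` B \<inter> space M | r u v B. r \<le> v \<and> v \<le> u \<and> u \<le> s \<and> B \<in> sets borel} \<subseteq> P"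
    proof safe
      fix u v and B :: "(real^'d) set"
      assume "v \<le> u" "u \<le> s" "B \<in> sets borel"
      then show "(\<lambda>\<omega>. W u \<omega> - W v \<omega>) -` B \<inter> space M \<in> P"
        unfolding P_def by (intro image_eqI[of _ _ "[(v, u, B)]"]) (auto simp: good_def ev_def)
    qed
  qed
  ultimately show ?thesis
    unfolding indep_sets2_eq by (blast intro: sigma_sets.Basic)
qed

text \<open>Being almost everywhere equal to an event of the raw filtration is preserved by
  complements and countable unions and holds for null sets. Probabilities do not see the difference,
  so independence passes to the augmentation.\<close>

lemma F_AE_eq_increment:
  assumes "E \<in> sets (F t)"
  shows "\<exists>B\<in>sets (increment_filtration M W t). AE \<omega> in M. \<omega> \<in> E \<longleftrightarrow> \<omega> \<in> B"
  using assms unfolding sets_F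
proof (induction rule: sigma_sets.induct)
  case (Basic a)
  then show ?case
  proof
    assume "a \<in> null_sets M"
    then have "AE \<omega> in M. \<omega> \<in> a \<longleftrightarrow> \<omega> \<in> {}"
      using AE_not_in by fastforce
    then show ?thesis
      by (intro bexI[of _ "{}"]) auto
  qed auto
next
  case Empty
  then show ?case
    by (intro bexI[of _ "{}"]) auto
next
  case (Compl a)
  then obtain B where B: "B \<in> sets (increment_filtration M W t)" "AE \<omega> in M. \<omega> \<in> a \<longleftrightarrow> \<omega> \<in> B"
    by auto
  then show ?case
    using sets.compl_sets[OF B(1)] by (intro bexI[of _ "space M - B"]) auto
next
  case (Union a)
  then obtain B where B: "\<And>i::nat. B i \<in> sets (increment_filtration M W t)"
      "\<And>i. AE \<omega> in M. \<omega> \<in> a i \<longleftrightarrow> \<omega> \<in> B i"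
    by metis
  have "AE \<omega> in M. \<forall>i. \<omega> \<in> a i \<longleftrightarrow> \<omega> \<in> B i"
    using B(2) by (simp add: AE_all_countable)
  then show ?case
    using B(1) by (intro bexI[of _ "\<Union>i. B i"]) (auto intro: sets.countable_UN)
qed

lemma indep_F_increment:
  assumes "s < t"
  shows "indep_set (sets (F s)) {(\<lambda>\<omega>. W t \<omega> - W s \<omega>) -` B \<inter> space M | B. B \<in> sets borel}"
proof (rule indep_setI)
  fix a b assume a: "a \<in> sets (F s)" and b: "b \<in> {(\<lambda>\<omega>. W t \<omega> - W s \<omega>) -` B \<inter> space M | B. B \<in> sets borel}"
  obtain c where c: "c \<in> sets (increment_filtration M W s)" "AE \<omega> in M. \<omega> \<in> a \<longleftrightarrow> \<omega> \<in> c"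
    using F_AE_eq_increment[OF a] by auto
  have m: "a \<in> events" "b \<in> events" "c \<in> events"
    using a b c sets_F_subset increment_filtration_subset by auto
  have "prob (a \<inter> b) = prob (c \<inter> b)" "prob a = prob c"
    using c(2) m by (auto intro!: finite_measure_eq_AE)
  with indep_setD[OF indep_increment_filtration[OF assms] c(1) b]
  show "prob (a \<inter> b) = prob a * prob b"
    by simp
qed (use sets_F_subset in auto)

text \<open>The function \<open>\<phi>\<close> is kept general because both single coordinates of
  the increment and products of two coordinates are needed.\<close>

lemma indep_var_F_increment:
  assumes "s < t" and H: "H \<in> measurable (F s) N" and \<phi> [measurable]: "\<phi> \<in> measurable borel N'"
  shows "indep_var N H N' (\<lambda>\<omega>. \<phi> (W t \<omega> - W s \<omega>))"
proof -
  let ?E = "{(\<lambda>\<omega>. W t \<omega> - W s \<omega>) -` B \<inter> space M | B. B \<in> sets borel}"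
  have "Int_stable ?E"
    by (rule Int_stable_vimage_borel)
  moreover have "Int_stable (sets (F s))"
    by (rule Int_stableI) auto
  ultimately have *: "indep_set (sigma_sets (space M) (sets (F s))) (sigma_sets (space M) ?E)"
    using indep_F_increment[OF assms(1)] by (intro indep_set_sigma_sets)
  have "{H -` A \<inter> space M | A. A \<in> sets N} \<subseteq> sets (F s)"
    using H by (auto simp: measurable_def)
  then have 1: "sigma_sets (space M) {H -` A \<inter> space M | A. A \<in> sets N} \<subseteq> sigma_sets (space M) (sets (F s))"
    by (rule sigma_sets_mono')
  have "{(\<lambda>\<omega>. \<phi> (W t \<omega> - W s \<omega>)) -` A \<inter> space M | A. A \<in> sets N'} \<subseteq> ?E"
  proof safe
    fix A assume "A \<in> sets N'"
    then show "\<exists>B. (\<lambda>\<omega>. \<phi> (W t \<omega> - W s \<omega>)) -` A \<inter> space M = (\<lambda>\<omega>. W t \<omega> - W s \<omega>) -` B \<inter> space M \<and> B \<in> sets borel"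
      using measurable_sets[OF \<phi>] by (intro exI[of _ "\<phi> -` A"]) auto
  qed
  then have 2: "sigma_sets (space M) {(\<lambda>\<omega>. \<phi> (W t \<omega> - W s \<omega>)) -` A \<inter> space M | A. A \<in> sets N'}
      \<subseteq> sigma_sets (space M) ?E"
    by (rule sigma_sets_mono')
  have "random_variable N H" "random_variable N' (\<lambda>\<omega>. \<phi> (W t \<omega> - W s \<omega>))"
    using F_measurable_imp_measurable[OF H] by auto
  then show ?thesis
    unfolding indep_var_eq using * 1 2 unfolding indep_sets2_eq by blast
qed

text \<open>The covariance matrix is \<open>t - s\<close> times the identity: the diagonal is the
  normal variance, the rest vanishes by independence of the coordinates. The densities are given
  only for \<open>s < t\<close>, hence the separate trivial case.\<close>

lemma increment_moments:
  assumes "s \<le> t"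
  shows "integrable M (\<lambda>\<omega>. (W t \<omega> - W s \<omega>) $ j)" (is ?I1)
    and "expectation (\<lambda>\<omega>. (W t \<omega> - W s \<omega>) $ j) = 0" (is ?E1)
    and "integrable M (\<lambda>\<omega>. (W t \<omega> - W s \<omega>) $ j * (W t \<omega> - W s \<omega>) $ k)" (is ?I2)
    and "expectation (\<lambda>\<omega>. (W t \<omega> - W s \<omega>) $ j * (W t \<omega> - W s \<omega>) $ k) = (if j = k then t - s else 0)" (is ?E2)
proof -
  have "?I1 \<and> ?E1 \<and> ?I2 \<and> ?E2"
  proof (cases "s = t")
    case False
    with assms have st: "s < t" by simp
    let ?D = "\<lambda>j \<omega>. (W t \<omega> - W s \<omega>) $ j"
    have ind: "indep_vars (\<lambda>_. borel) ?D UNIV"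
      and D: "distributed M lborel (?D j) (\<lambda>x. ennreal (normal_density 0 (sqrt (t - s)) x))" for j
      using wiener st by (auto simp: two_sided_wiener_def)
    have pos: "0 < sqrt (t - s)"
      using st by simp
    have i1: "integrable M (?D j)" for j
      using distributed_integrable[OF D, of "\<lambda>x. x" j] integrable_normal_moment[OF pos, of 0 1] by simp
    have e1: "expectation (?D j) = 0" for j
      by (rule normal_distributed_expectation[OF pos D])
    have i2: "integrable M (\<lambda>\<omega>. ?D j \<omega> * ?D j \<omega>)" for j
      using distributed_integrable[OF D, of "\<lambda>x. x * x" j] integrable_normal_moment[OF pos, of 0 2]
      by (simp add: power2_eq_square)
    have e2: "expectation (\<lambda>\<omega>. ?D j \<omega> * ?D j \<omega>) = t - s" for j
      using normal_distributed_variance[OF pos D[of j]] e1[of j] st by (simp add: power2_eq_square)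
    have "integrable M (\<lambda>\<omega>. ?D j \<omega> * ?D k \<omega>) \<and> expectation (\<lambda>\<omega>. ?D j \<omega> * ?D k \<omega>) = 0" if "j \<noteq> k"
    proof -
      have "indep_vars (\<lambda>_. borel) ?D {j, k}"
        by (rule indep_vars_subset[OF ind]) auto
      from indep_vars_lebesgue_integral[OF _ this i1] indep_vars_integrable[OF _ this i1] e1 that
      show ?thesis by auto
    qed
    with i1 e1 i2 e2 show ?thesis
      by auto
  qed auto
  then show ?I1 ?E1 ?I2 ?E2
    by auto
qed

text \<open>Conditional moments given the past, stated by testing against an integrable weight
  \<open>H\<close> known at time \<open>s\<close>.\<close>

lemma F_increment_moments:
  assumes "s \<le> t" and H: "H \<in> borel_measurable (F s)" "integrable M (H :: 'w \<Rightarrow> real)"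
  shows "integrable M (\<lambda>\<omega>. H \<omega> * (W t \<omega> - W s \<omega>) $ j)" (is ?I1)
    and "expectation (\<lambda>\<omega>. H \<omega> * (W t \<omega> - W s \<omega>) $ j) = 0" (is ?E1)
    and "integrable M (\<lambda>\<omega>. H \<omega> * ((W t \<omega> - W s \<omega>) $ j * (W t \<omega> - W s \<omega>) $ k))" (is ?I2)
    and "expectation (\<lambda>\<omega>. H \<omega> * ((W t \<omega> - W s \<omega>) $ j * (W t \<omega> - W s \<omega>) $ k))
      = (if j = k then (t - s) * expectation H else 0)" (is ?E2)
proof -
  have "?I1 \<and> ?E1 \<and> ?I2 \<and> ?E2"
  proof (cases "s = t")
    case False
    with assms have st: "s < t" by simp
    have 1: "indep_var borel H borel (\<lambda>\<omega>. (W t \<omega> - W s \<omega>) $ j)"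
      using indep_var_F_increment[OF st H(1), of "\<lambda>x. x $ j" borel] by simp
    have 2: "indep_var borel H borel (\<lambda>\<omega>. (W t \<omega> - W s \<omega>) $ j * (W t \<omega> - W s \<omega>) $ k)"
      using indep_var_F_increment[OF st H(1), of "\<lambda>x. x $ j * x $ k" borel] by simp
    note m = increment_moments[OF assms(1)]
    show ?thesis
      using indep_var_lebesgue_integral[OF 1 H(2) m(1)] indep_var_integrable[OF 1 H(2) m(1)]
        indep_var_lebesgue_integral[OF 2 H(2) m(3)] indep_var_integrable[OF 2 H(2) m(3)]
      unfolding m(2,4) by auto
  qed auto
  then show ?I1 ?E1 ?I2 ?E2
    by auto
qed

end

section \<open>Ito integrals of square-integrable processes\<close>

lemma (in pair_sigma_finite) integrable_mult_pair:
  fixes f :: "'a \<Rightarrow> real" and g :: "'b \<Rightarrow> real"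
  assumes f: "integrable M1 f" and g: "integrable M2 g"
  shows "integrable (M1 \<Otimes>\<^sub>M M2) (\<lambda>x. f (fst x) * g (snd x))"
    and "(\<integral>x. f (fst x) * g (snd x) \<partial>(M1 \<Otimes>\<^sub>M M2)) = (\<integral>x. f x \<partial>M1) * (\<integral>y. g y \<partial>M2)"
proof -
  have [measurable]: "f \<in> borel_measurable M1" "g \<in> borel_measurable M2"
    using assms by auto
  show i: "integrable (M1 \<Otimes>\<^sub>M M2) (\<lambda>x. f (fst x) * g (snd x))"
    by (rule Fubini_integrable) (use f g in \<open>auto simp: abs_mult\<close>)
  show "(\<integral>x. f (fst x) * g (snd x) \<partial>(M1 \<Otimes>\<^sub>M M2)) = (\<integral>x. f x \<partial>M1) * (\<integral>y. g y \<partial>M2)"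
    using integral_fst'[OF i] by simp
qed

section \<open>Matrix-vector products in coordinates\<close>

lemma inner_matrix_vector_mult:
  fixes A B :: "real ^ 'd ^ 'm"
  shows "(A *v v) \<bullet> (B *v v) = (\<Sum>i\<in>UNIV. \<Sum>j\<in>UNIV. \<Sum>k\<in>UNIV. (A $ i $ j * B $ i $ k) * (v $ j * v $ k))"
proof -
  have "(A *v v) \<bullet> (B *v v) = (\<Sum>i\<in>UNIV. (\<Sum>j\<in>UNIV. A $ i $ j * v $ j) * (\<Sum>k\<in>UNIV. B $ i $ k * v $ k))"
    by (simp add: inner_vec_def matrix_vector_mult_def)
  also have "\<dots> = (\<Sum>i\<in>UNIV. \<Sum>j\<in>UNIV. \<Sum>k\<in>UNIV. (A $ i $ j * B $ i $ k) * (v $ j * v $ k))"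
    by (intro sum.cong refl) (simp add: sum_product mult_ac)
  finally show ?thesis .
qed

lemma inner_vector_matrix_vector_mult:
  fixes A :: "real ^ 'd ^ 'm"
  shows "y \<bullet> (A *v v) = (\<Sum>i\<in>UNIV. \<Sum>j\<in>UNIV. (y $ i * A $ i $ j) * v $ j)"
  by (simp add: inner_vec_def matrix_vector_mult_def sum_distrib_left mult_ac)

lemma inner_matrix_entries:
  fixes A B :: "real ^ 'd ^ 'm"
  shows "A \<bullet> B = (\<Sum>i\<in>UNIV. \<Sum>j\<in>UNIV. A $ i $ j * B $ i $ j)"
  by (simp add: inner_vec_def)

text \<open>The norm of the nested vector type is the Frobenius norm, and Cauchy-Schwarz in each row
  bounds the product by it.\<close>

lemma norm_matrix_vector_mult_le:
  fixes A :: "real ^ 'd ^ 'm"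
  shows "norm (A *v v) \<le> norm A * norm v"
proof -
  have "norm (A *v v) = L2_set (\<lambda>i. norm (A $ i \<bullet> v)) UNIV"
    unfolding norm_vec_def[of "A *v v"] by (simp add: matrix_vector_mult_def inner_vec_def)
  also have "\<dots> \<le> L2_set (\<lambda>i. norm (A $ i) * norm v) UNIV"
    by (intro L2_set_mono) (auto simp: Cauchy_Schwarz_ineq2)
  also have "\<dots> = norm A * norm v"
    by (simp add: norm_vec_def[of A] L2_set_left_distrib)
  finally show ?thesis .
qed

lemma borel_measurable_matrix_vector_mult [measurable (raw)]:
  fixes H :: "'w \<Rightarrow> real ^ 'd ^ 'm"
  assumes "H \<in> borel_measurable N" "V \<in> borel_measurable N"
  shows "(\<lambda>\<omega>. H \<omega> *v V \<omega>) \<in> borel_measurable N"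
proof (rule borel_measurable_continuous_Pair[OF assms])
  show "continuous_on UNIV (\<lambda>x. fst x *v snd x :: real ^ 'm)"
    unfolding matrix_vector_mult_def
    by (intro continuous_intros)
qed

lemma borel_measurable_vec_nth' [measurable (raw)]:
  fixes Y :: "'w \<Rightarrow> ('a::euclidean_space) ^ 'm"
  assumes "Y \<in> borel_measurable N"
  shows "(\<lambda>\<omega>. Y \<omega> $ i) \<in> borel_measurable N"
  by (rule borel_measurable_continuous_on[where f="\<lambda>y. y $ i", OF _ assms]) (intro continuous_intros)

lemma in_L2_vec_nth:
  fixes Y :: "'w \<Rightarrow> ('a::euclidean_space) ^ 'm"
  assumes "in_L2 M Y"
  shows "in_L2 M (\<lambda>\<omega>. Y \<omega> $ i)"
proof (rule in_L2_mono[OF assms])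
  show "AE \<omega> in M. norm (Y \<omega> $ i) \<le> norm (Y \<omega>)"
    by (intro AE_I2 Finite_Cartesian_Product.norm_nth_le)
qed (use assms in \<open>auto simp: in_L2_def\<close>)

lemma in_L2_integrable_mult:
  fixes X Y :: "'w \<Rightarrow> real"
  assumes "in_L2 M X" "in_L2 M Y"
  shows "integrable M (\<lambda>\<omega>. X \<omega> * Y \<omega>)"
  using in_L2_integrable_inner[OF assms] by simp

section \<open>Weighted increments, simple integrals and their closure\<close>

context wiener_space
begin

abbreviation PM :: "(real \<times> 'w) measure" where
  "PM \<equiv> lborel \<Otimes>\<^sub>M M"

text \<open>Measurability refers to the augmented filtration, the one to which solutions are
  adapted; these are the weights to which independence of later increments applies.\<close>

definition L2F :: "real \<Rightarrow> ('w \<Rightarrow> 'a::euclidean_space) \<Rightarrow> bool" where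
  "L2F t Y \<longleftrightarrow> Y \<in> borel_measurable (F t) \<and> in_L2 M Y"

lemma L2F_in_L2: "L2F t Y \<Longrightarrow> in_L2 M Y"
  by (simp add: L2F_def)

lemma L2F_mono: "L2F s Y \<Longrightarrow> s \<le> t \<Longrightarrow> L2F t Y"
  by (auto simp: L2F_def intro: F_measurable_mono)

lemma L2F_add: "L2F t X \<Longrightarrow> L2F t Y \<Longrightarrow> L2F t (\<lambda>\<omega>. X \<omega> + Y \<omega>)"
  by (auto simp: L2F_def in_L2_add)

lemma L2F_diff: "L2F t X \<Longrightarrow> L2F t Y \<Longrightarrow> L2F t (\<lambda>\<omega>. X \<omega> - Y \<omega>)"
  by (auto simp: L2F_def in_L2_diff)

lemma L2F_scaleR: "L2F t X \<Longrightarrow> L2F t (\<lambda>\<omega>. c *\<^sub>R X \<omega>)"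
  by (auto simp: L2F_def in_L2_scaleR)

lemma L2F_zero: "L2F t (\<lambda>_. 0)"
  by (simp add: L2F_def)

text \<open>In coordinates the weights \<open>H $ i $ j * H' $ i $ k\<close> are known at time
  \<open>s\<close>, and only the terms with \<open>j = k\<close> survive; they add up to the
  Frobenius inner product.\<close>

lemma increment_inner:
  fixes H H' :: "'w \<Rightarrow> real ^ 'd ^ 'm"
  assumes "s \<le> u" "L2F s H" "L2F s H'"
  shows "integrable M (\<lambda>\<omega>. (H \<omega> *v (W u \<omega> - W s \<omega>)) \<bullet> (H' \<omega> *v (W u \<omega> - W s \<omega>)))"
    and "expectation (\<lambda>\<omega>. (H \<omega> *v (W u \<omega> - W s \<omega>)) \<bullet> (H' \<omega> *v (W u \<omega> - W s \<omega>)))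
      = (u - s) * expectation (\<lambda>\<omega>. H \<omega> \<bullet> H' \<omega>)"
proof -
  have m: "(\<lambda>\<omega>. H \<omega> $ i $ j * H' \<omega> $ i $ k) \<in> borel_measurable (F s)" for i j k
    using assms(2,3) by (auto simp: L2F_def)
  have i: "integrable M (\<lambda>\<omega>. H \<omega> $ i $ j * H' \<omega> $ i $ k)" for i j k
    using assms(2,3) by (intro in_L2_integrable_mult in_L2_vec_nth) (auto simp: L2F_def)
  note mom = F_increment_moments[OF assms(1) m i]
  show "integrable M (\<lambda>\<omega>. (H \<omega> *v (W u \<omega> - W s \<omega>)) \<bullet> (H' \<omega> *v (W u \<omega> - W s \<omega>)))"
    unfolding inner_matrix_vector_mult by (intro Bochner_Integration.integrable_sum mom(3))
  have "expectation (\<lambda>\<omega>. (H \<omega> *v (W u \<omega> - W s \<omega>)) \<bullet> (H' \<omega> *v (W u \<omega> - W s \<omega>)))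
      = (\<Sum>i\<in>UNIV. \<Sum>j\<in>UNIV. \<Sum>k\<in>UNIV. if j = k then (u - s) * expectation (\<lambda>\<omega>. H \<omega> $ i $ j * H' \<omega> $ i $ k) else 0)"
    unfolding inner_matrix_vector_mult mom(4)[symmetric]
    by (simp add: Bochner_Integration.integral_sum Bochner_Integration.integrable_sum mom(3) del: vector_minus_component)
  also have "\<dots> = (u - s) * expectation (\<lambda>\<omega>. H \<omega> \<bullet> H' \<omega>)"
    unfolding inner_matrix_entries
    by (simp add: Bochner_Integration.integral_sum Bochner_Integration.integrable_sum i sum_distrib_left)
  finally show "expectation (\<lambda>\<omega>. (H \<omega> *v (W u \<omega> - W s \<omega>)) \<bullet> (H' \<omega> *v (W u \<omega> - W s \<omega>)))
      = (u - s) * expectation (\<lambda>\<omega>. H \<omega> \<bullet> H' \<omega>)" .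
qed

lemma in_L2_increment:
  fixes H :: "'w \<Rightarrow> real ^ 'd ^ 'm"
  assumes "s \<le> u" "L2F s H"
  shows "in_L2 M (\<lambda>\<omega>. H \<omega> *v (W u \<omega> - W s \<omega>))"
proof -
  have [measurable]: "H \<in> borel_measurable M"
    using assms by (auto simp: L2F_def in_L2_def)
  show ?thesis
    using increment_inner(1)[OF assms assms(2)] by (simp add: in_L2_def power2_norm_eq_inner)
qed

lemma L2_norm_increment:
  fixes H :: "'w \<Rightarrow> real ^ 'd ^ 'm"
  assumes "s \<le> u" "L2F s H"
  shows "L2_norm M (\<lambda>\<omega>. H \<omega> *v (W u \<omega> - W s \<omega>)) = sqrt (u - s) * L2_norm M H"
  using increment_inner(2)[OF assms assms(2)]
  by (simp add: L2_norm_def power2_norm_eq_inner real_sqrt_mult)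

lemma L2F_increment:
  fixes H :: "'w \<Rightarrow> real ^ 'd ^ 'm"
  assumes "s \<le> u" "u \<le> t" "L2F s H"
  shows "L2F t (\<lambda>\<omega>. H \<omega> *v (W u \<omega> - W s \<omega>))"
proof -
  have "(\<lambda>\<omega>. W u \<omega> - W s \<omega>) \<in> borel_measurable (F t)" "H \<in> borel_measurable (F t)"
    using increment_F_measurable[OF assms(1,2)] F_measurable_mono[of H s borel t] assms(1,2,3)[unfolded L2F_def] by auto
  then have "(\<lambda>\<omega>. H \<omega> *v (W u \<omega> - W s \<omega>)) \<in> borel_measurable (F t)"
    by simp
  then show ?thesis
    using in_L2_increment[OF assms(1,3)] by (simp add: L2F_def)
qed

lemma increment_orthogonal:
  fixes H :: "'w \<Rightarrow> real ^ 'd ^ 'm"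
  assumes "s \<le> u" "L2F s H" "L2F s Y"
  shows "expectation (\<lambda>\<omega>. Y \<omega> \<bullet> (H \<omega> *v (W u \<omega> - W s \<omega>))) = 0"
proof -
  have m: "(\<lambda>\<omega>. Y \<omega> $ i * H \<omega> $ i $ j) \<in> borel_measurable (F s)" for i j
    using assms(2,3) by (auto simp: L2F_def)
  have i: "integrable M (\<lambda>\<omega>. Y \<omega> $ i * H \<omega> $ i $ j)" for i j
    using assms(2,3) by (intro in_L2_integrable_mult in_L2_vec_nth) (auto simp: L2F_def)
  note mom = F_increment_moments[OF assms(1) m i]
  show ?thesis
    unfolding inner_vector_matrix_vector_mult
    by (simp add: Bochner_Integration.integral_sum Bochner_Integration.integrable_sum mom(1,2) del: vector_minus_component)
qed

text \<open>Only the common part of the two intervals contributes. The intervals are cut at the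
  later starting time \<open>s'\<close> and at the earlier end \<open>m\<close>; every product of
  increments over distinct pieces vanishes by orthogonality, and the factor that remains is the
  length of the overlap.\<close>

lemma increments_covariance_le:
  fixes H H' :: "'w \<Rightarrow> real ^ 'd ^ 'm"
  assumes "s < u" "s' < u'" "L2F s H" "L2F s' H'" "s \<le> s'"
  shows "expectation (\<lambda>\<omega>. (H \<omega> *v (W u \<omega> - W s \<omega>)) \<bullet> (H' \<omega> *v (W u' \<omega> - W s' \<omega>)))
    = max 0 (min u u' - max s s') * expectation (\<lambda>\<omega>. H \<omega> \<bullet> H' \<omega>)"
proof (cases "u \<le> s'")
  case True
  then show ?thesis
    using increment_orthogonal[OF _ assms(4) L2F_increment[OF _ True assms(3)], of u'] assms by simp
next
  case False
  define m where "m = min u u'"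
  have m: "s' \<le> m" "m \<le> u" "m \<le> u'"
    using False assms by (auto simp: m_def)
  define a b c b' c' where "a \<omega> = H \<omega> *v (W s' \<omega> - W s \<omega>)"
    and "b \<omega> = H \<omega> *v (W m \<omega> - W s' \<omega>)" and "c \<omega> = H \<omega> *v (W u \<omega> - W m \<omega>)"
    and "b' \<omega> = H' \<omega> *v (W m \<omega> - W s' \<omega>)" and "c' \<omega> = H' \<omega> *v (W u' \<omega> - W m \<omega>)" for \<omega>
  have Hs': "L2F s' H" and Hm: "L2F m H" "L2F m H'"
    using L2F_mono assms m by (meson order_trans)+
  have L: "in_L2 M a" "in_L2 M b" "in_L2 M c" "in_L2 M b'" "in_L2 M c'"
    unfolding a_def b_def c_def b'_def c'_def
    using in_L2_increment m assms Hs' Hm by blast+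
  have eq: "H \<omega> *v (W u \<omega> - W s \<omega>) = a \<omega> + b \<omega> + c \<omega>" "H' \<omega> *v (W u' \<omega> - W s' \<omega>) = b' \<omega> + c' \<omega>" for \<omega>
    by (simp_all add: a_def b_def c_def b'_def c'_def flip: matrix_vector_right_distrib)
  have "expectation (\<lambda>\<omega>. a \<omega> \<bullet> (b' \<omega> + c' \<omega>)) = 0"
    unfolding eq(2)[symmetric] unfolding a_def
    using increment_orthogonal[OF _ assms(4) L2F_increment[OF assms(5) order_refl assms(3)], of u'] assms by simp
  moreover have "expectation (\<lambda>\<omega>. b \<omega> \<bullet> b' \<omega>) = (m - s') * expectation (\<lambda>\<omega>. H \<omega> \<bullet> H' \<omega>)"
    unfolding b_def b'_def by (rule increment_inner(2)[OF m(1) Hs' assms(4)])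
  moreover have "expectation (\<lambda>\<omega>. b \<omega> \<bullet> c' \<omega>) = 0"
    unfolding b_def c'_def by (rule increment_orthogonal[OF m(3) Hm(2) L2F_increment[OF m(1) order_refl Hs']])
  moreover have "expectation (\<lambda>\<omega>. b' \<omega> \<bullet> c \<omega>) = 0"
    unfolding b'_def c_def by (rule increment_orthogonal[OF m(2) Hm(1) L2F_increment[OF m(1) order_refl assms(4)]])
  \<comment> \<open>One of the intervals ends at \<open>m\<close>, so one of these two increments is
    trivial.\<close>
  moreover have "c \<omega> \<bullet> c' \<omega> = 0" for \<omega>
    unfolding c_def c'_def m_def by (cases "u \<le> u'") auto
  moreover have "expectation (\<lambda>\<omega>. (a \<omega> + b \<omega> + c \<omega>) \<bullet> (b' \<omega> + c' \<omega>))
      = expectation (\<lambda>\<omega>. a \<omega> \<bullet> (b' \<omega> + c' \<omega>)) + expectation (\<lambda>\<omega>. b \<omega> \<bullet> b' \<omega>) + expectation (\<lambda>\<omega>. b \<omega> \<bullet> c' \<omega>)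
        + expectation (\<lambda>\<omega>. b' \<omega> \<bullet> c \<omega>) + expectation (\<lambda>\<omega>. c \<omega> \<bullet> c' \<omega>)"
    using L by (simp add: inner_add_left inner_add_right in_L2_integrable_inner inner_commute[of "b' _" "c _"])
  ultimately show ?thesis
    unfolding eq using False assms by (simp add: m_def)
qed

lemma increments_covariance:
  fixes H H' :: "'w \<Rightarrow> real ^ 'd ^ 'm"
  assumes "s \<le> u" "s' \<le> u'" "s < u \<Longrightarrow> L2F s H" "s' < u' \<Longrightarrow> L2F s' H'"
  shows "expectation (\<lambda>\<omega>. (H \<omega> *v (W u \<omega> - W s \<omega>)) \<bullet> (H' \<omega> *v (W u' \<omega> - W s' \<omega>)))
    = max 0 (min u u' - max s s') * expectation (\<lambda>\<omega>. H \<omega> \<bullet> H' \<omega>)"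
proof (cases "s = u \<or> s' = u'")
  case True
  then show ?thesis
    using assms by auto
next
  case False
  then consider "s \<le> s'" | "s' \<le> s" "\<not> s \<le> s'"
    by linarith
  then show ?thesis
  proof cases
    case 1
    then show ?thesis
      using increments_covariance_le[of s u s' u' H H'] assms False by auto
  next
    case 2
    then show ?thesis
      using increments_covariance_le[of s' u' s u H' H] assms False
      by (auto simp: inner_commute min.commute max.commute)
  qed
qed

text \<open>Degenerate pieces \<open>s = u\<close> carry no measurability condition, so that cutting a
  simple integrand at a time again yields simple integrands.\<close>

inductive simple_ito :: "(real \<times> 'w \<Rightarrow> real ^ 'd ^ 'm) \<Rightarrow> ('w \<Rightarrow> real ^ 'm) \<Rightarrow> bool" where
  simple_ito_zero: "simple_ito (\<lambda>_. 0) (\<lambda>_. 0)"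
| simple_ito_add_piece: "s \<le> u \<Longrightarrow> (s < u \<Longrightarrow> L2F s H) \<Longrightarrow> in_L2 M H \<Longrightarrow> simple_ito \<phi> J \<Longrightarrow>
    simple_ito (\<lambda>x. indicator {s..<u} (fst x) *\<^sub>R H (snd x) + \<phi> x) (\<lambda>\<omega>. H \<omega> *v (W u \<omega> - W s \<omega>) + J \<omega>)"

lemma simple_ito_piece:
  assumes "s \<le> u" "s < u \<Longrightarrow> L2F s H" "in_L2 M H"
  shows "simple_ito (\<lambda>x. indicator {s..<u} (fst x) *\<^sub>R H (snd x)) (\<lambda>\<omega>. H \<omega> *v (W u \<omega> - W s \<omega>))"
  using simple_ito_add_piece[OF assms simple_ito_zero] by simp

lemma simple_ito_add:
  assumes "simple_ito \<phi> J" "simple_ito \<phi>' J'"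
  shows "simple_ito (\<lambda>x. \<phi> x + \<phi>' x) (\<lambda>\<omega>. J \<omega> + J' \<omega>)"
  using assms(1)
proof induction
  case (simple_ito_add_piece s u H \<phi> J)
  from simple_ito.simple_ito_add_piece[OF this(1-3,5)] show ?case
    by (simp add: add.assoc)
qed (use assms(2) in simp)

lemma simple_ito_uminus:
  assumes "simple_ito \<phi> J"
  shows "simple_ito (\<lambda>x. - \<phi> x) (\<lambda>\<omega>. - J \<omega>)"
  using assms
proof induction
  case (simple_ito_add_piece s u H \<phi> J)
  have neg: "(- A) *v v = - (A *v v)" for A :: "real ^ 'd ^ 'm" and v
    using scaleR_matrix_vector_assoc[of "-1" A v] by simp
  have "L2F s (\<lambda>\<omega>. - H \<omega>)" if "s < u"
    using simple_ito_add_piece(2)[OF that] by (auto simp: L2F_def in_L2_uminus)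
  from simple_ito.simple_ito_add_piece[OF simple_ito_add_piece(1) this in_L2_uminus[OF simple_ito_add_piece(3)] simple_ito_add_piece(5)]
  show ?case
    by (simp add: neg)
qed (auto intro: simple_ito_zero)

lemma simple_ito_diff:
  assumes "simple_ito \<phi> J" "simple_ito \<phi>' J'"
  shows "simple_ito (\<lambda>x. \<phi> x - \<phi>' x) (\<lambda>\<omega>. J \<omega> - J' \<omega>)"
  using simple_ito_add[OF assms(1) simple_ito_uminus[OF assms(2)]] by simp

sublocale pair: pair_sigma_finite lborel M ..

text \<open>The product of the two indicators is the indicator of the overlap. The resulting factor
  is the one in \<open>increments_covariance\<close>, which makes the isometry hold piece by
  piece.\<close>

lemma
  fixes H H' :: "'w \<Rightarrow> 'a::euclidean_space"
  assumes "s \<le> u" "s' \<le> u'" "in_L2 M H" "in_L2 M H'"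
  shows integrable_pieces_inner:
      "integrable PM (\<lambda>x. (indicator {s..<u} (fst x) *\<^sub>R H (snd x)) \<bullet> (indicator {s'..<u'} (fst x) *\<^sub>R H' (snd x)))"
    and integral_pieces_inner:
      "(\<integral>x. (indicator {s..<u} (fst x) *\<^sub>R H (snd x)) \<bullet> (indicator {s'..<u'} (fst x) *\<^sub>R H' (snd x)) \<partial>PM)
        = max 0 (min u u' - max s s') * expectation (\<lambda>\<omega>. H \<omega> \<bullet> H' \<omega>)"
proof -
  let ?I = "{max s s'..<min u u'}"
  have eq: "(indicator {s..<u} (fst x) *\<^sub>R H (snd x)) \<bullet> (indicator {s'..<u'} (fst x) *\<^sub>R H' (snd x))
      = indicator ?I (fst x) * (H (snd x) \<bullet> H' (snd x))" for x :: "real \<times> 'w"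
    by (auto simp: indicator_def)
  have i: "integrable lborel (indicator ?I :: real \<Rightarrow> real)"
    by (cases "max s s' \<le> min u u'") (auto simp: integrable_indicator_iff simp del: max.bounded_iff min.bounded_iff)
  have "integral\<^sup>L lborel (indicator ?I :: real \<Rightarrow> real) = max 0 (min u u' - max s s')"
    by (cases "max s s' \<le> min u u'") (auto simp del: max.bounded_iff min.bounded_iff)
  with pair.integrable_mult_pair[OF i in_L2_integrable_inner[OF assms(3,4)]]
  show "integrable PM (\<lambda>x. (indicator {s..<u} (fst x) *\<^sub>R H (snd x)) \<bullet> (indicator {s'..<u'} (fst x) *\<^sub>R H' (snd x)))"
    "(\<integral>x. (indicator {s..<u} (fst x) *\<^sub>R H (snd x)) \<bullet> (indicator {s'..<u'} (fst x) *\<^sub>R H' (snd x)) \<partial>PM)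
        = max 0 (min u u' - max s s') * expectation (\<lambda>\<omega>. H \<omega> \<bullet> H' \<omega>)"
    unfolding eq by simp_all
qed

lemma in_L2_piece:
  fixes H :: "'w \<Rightarrow> 'a::euclidean_space"
  assumes "s \<le> u" "in_L2 M H"
  shows "in_L2 PM (\<lambda>x. indicator {s..<u} (fst x) *\<^sub>R H (snd x))"
proof -
  have [measurable]: "H \<in> borel_measurable M"
    using assms by (simp add: in_L2_def)
  show ?thesis
    unfolding in_L2_def power2_norm_eq_inner using integrable_pieces_inner[OF assms(1,1,2,2)] by (intro conjI) measurable
qed

lemma in_L2_piece_integral:
  fixes H :: "'w \<Rightarrow> real ^ 'd ^ 'm"
  assumes "s \<le> u" "s < u \<Longrightarrow> L2F s H"
  shows "in_L2 M (\<lambda>\<omega>. H \<omega> *v (W u \<omega> - W s \<omega>))"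
  using assms in_L2_increment[of s u H] by (cases "s = u") auto

lemma simple_ito_in_L2:
  assumes "simple_ito \<phi> J"
  shows "in_L2 PM \<phi>" "in_L2 M J"
  using assms by induction (auto intro!: in_L2_add in_L2_piece in_L2_piece_integral)

lemma simple_ito_covariance_piece:
  fixes H :: "'w \<Rightarrow> real ^ 'd ^ 'm"
  assumes P: "s \<le> u" "s < u \<Longrightarrow> L2F s H" "in_L2 M H" and "simple_ito \<phi> J"
  shows "(\<integral>\<omega>. (H \<omega> *v (W u \<omega> - W s \<omega>)) \<bullet> J \<omega> \<partial>M) = (\<integral>x. (indicator {s..<u} (fst x) *\<^sub>R H (snd x)) \<bullet> \<phi> x \<partial>PM)"
  using assms(4)
proof induction
  case (simple_ito_add_piece s' u' H' \<phi> J)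
  note P' = this(1-3)
  have p: "in_L2 M (\<lambda>\<omega>. H \<omega> *v (W u \<omega> - W s \<omega>))" "in_L2 M (\<lambda>\<omega>. H' \<omega> *v (W u' \<omega> - W s' \<omega>))"
    using P P' by (auto intro: in_L2_piece_integral)
  note i = in_L2_integrable_inner[OF p]
    in_L2_integrable_inner[OF p(1) simple_ito_in_L2(2)[OF simple_ito_add_piece(4)]]
    in_L2_integrable_inner[OF in_L2_piece[OF P(1,3)] in_L2_piece[OF P'(1,3)]]
    in_L2_integrable_inner[OF in_L2_piece[OF P(1,3)] simple_ito_in_L2(1)[OF simple_ito_add_piece(4)]]
  show ?case
    unfolding inner_add_right Bochner_Integration.integral_add[OF i(1,2)] Bochner_Integration.integral_add[OF i(3,4)]
      integral_pieces_inner[OF P(1) P'(1) P(3) P'(3)] simple_ito_add_piece.IH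
    using increments_covariance[OF P(1) P'(1) P(2) P'(2)] by simp
qed simp

text \<open>The isometry in polarised form: by bilinearity each argument is taken apart by its own
  induction, so the pieces of either integrand may overlap arbitrarily.\<close>

lemma simple_ito_covariance:
  assumes "simple_ito \<phi> J" "simple_ito \<phi>' J'"
  shows "(\<integral>\<omega>. J \<omega> \<bullet> J' \<omega> \<partial>M) = (\<integral>x. \<phi> x \<bullet> \<phi>' x \<partial>PM)"
  using assms(1)
proof induction
  case (simple_ito_add_piece s u H \<phi> J)
  note P = this(1-3)
  have p: "in_L2 M (\<lambda>\<omega>. H \<omega> *v (W u \<omega> - W s \<omega>))"
    using P by (auto intro: in_L2_piece_integral)
  note i = in_L2_integrable_inner[OF p simple_ito_in_L2(2)[OF assms(2)]]
    in_L2_integrable_inner[OF simple_ito_in_L2(2)[OF simple_ito_add_piece(4)] simple_ito_in_L2(2)[OF assms(2)]]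
    in_L2_integrable_inner[OF in_L2_piece[OF P(1,3)] simple_ito_in_L2(1)[OF assms(2)]]
    in_L2_integrable_inner[OF simple_ito_in_L2(1)[OF simple_ito_add_piece(4)] simple_ito_in_L2(1)[OF assms(2)]]
  show ?case
    unfolding inner_add_left Bochner_Integration.integral_add[OF i(1,2)] Bochner_Integration.integral_add[OF i(3,4)]
      simple_ito_add_piece.IH using simple_ito_covariance_piece[OF P assms(2)] by (simp only:)
qed simp

lemma simple_ito_isometry:
  assumes "simple_ito \<phi> J"
  shows "L2_norm M J = L2_norm PM \<phi>"
  using simple_ito_covariance[OF assms assms] by (simp add: L2_norm_def power2_norm_eq_inner)

text \<open>Every piece is cut at \<open>t\<close>. The early parts form a simple integral of the
  truncated integrand; the late parts collect in \<open>J2\<close>, each of them an increment after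
  \<open>t\<close> and hence orthogonal to what is known at \<open>t\<close>.\<close>

lemma simple_ito_split:
  assumes "simple_ito \<phi> J"
  shows "\<exists>J1 J2. simple_ito (\<lambda>x. indicator {..<t} (fst x) *\<^sub>R \<phi> x) J1 \<and> in_L2 M J2 \<and>
    (\<forall>\<omega>. J \<omega> = J1 \<omega> + J2 \<omega>) \<and> (\<forall>Y. L2F t Y \<longrightarrow> expectation (\<lambda>\<omega>. Y \<omega> \<bullet> J2 \<omega>) = 0)"
  using assms
proof induction
  case simple_ito_zero
  then show ?case
    by (intro exI[of _ "\<lambda>_. 0"]) (auto intro: simple_ito.simple_ito_zero)
next
  case (simple_ito_add_piece s u H \<phi> J)
  note P = this(1-3)
  obtain J1 J2 where J: "simple_ito (\<lambda>x. indicator {..<t} (fst x) *\<^sub>R \<phi> x) J1" "in_L2 M J2"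
    "\<And>\<omega>. J \<omega> = J1 \<omega> + J2 \<omega>" "\<And>Y. L2F t Y \<Longrightarrow> expectation (\<lambda>\<omega>. Y \<omega> \<bullet> J2 \<omega>) = 0"
    using simple_ito_add_piece.IH by auto
  \<comment> \<open>If \<open>t\<close> lies on one side of the piece, one of the two parts shrinks
    to the single point \<open>t\<close>, and there no measurability is demanded.\<close>
  define s1 u1 where "s1 = min s t" and "u1 = min u t"
  define s2 u2 where "s2 = max s t" and "u2 = max u t"
  have 1: "s1 \<le> u1" "s1 < u1 \<Longrightarrow> L2F s1 H" and 2: "s2 \<le> u2" "s2 < u2 \<Longrightarrow> L2F s2 H"
    using P by (auto simp: s1_def u1_def s2_def u2_def min_def max_def intro: L2F_mono split: if_splits)
  have J2: "in_L2 M (\<lambda>\<omega>. H \<omega> *v (W u2 \<omega> - W s2 \<omega>))"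
    by (rule in_L2_piece_integral[OF 2])
  have "simple_ito (\<lambda>x. indicator {s1..<u1} (fst x) *\<^sub>R H (snd x) + indicator {..<t} (fst x) *\<^sub>R \<phi> x)
      (\<lambda>\<omega>. H \<omega> *v (W u1 \<omega> - W s1 \<omega>) + J1 \<omega>)"
    by (rule simple_ito.simple_ito_add_piece[OF 1 P(3) J(1)])
  also have "(\<lambda>x. indicator {s1..<u1} (fst x) *\<^sub>R H (snd x) + indicator {..<t} (fst x) *\<^sub>R \<phi> x)
      = (\<lambda>x. indicator {..<t} (fst x) *\<^sub>R (indicator {s..<u} (fst x) *\<^sub>R H (snd x) + \<phi> x))"
    by (auto simp: fun_eq_iff indicator_def s1_def u1_def)
  finally have simple: "simple_ito (\<lambda>x. indicator {..<t} (fst x) *\<^sub>R (indicator {s..<u} (fst x) *\<^sub>R H (snd x) + \<phi> x))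
      (\<lambda>\<omega>. H \<omega> *v (W u1 \<omega> - W s1 \<omega>) + J1 \<omega>)" .
  have sum: "H \<omega> *v (W u \<omega> - W s \<omega>) + J \<omega> = (H \<omega> *v (W u1 \<omega> - W s1 \<omega>) + J1 \<omega>) + (H \<omega> *v (W u2 \<omega> - W s2 \<omega>) + J2 \<omega>)" for \<omega>
  proof -
    have "W u \<omega> - W s \<omega> = (W u1 \<omega> - W s1 \<omega>) + (W u2 \<omega> - W s2 \<omega>)"
      using P(1) by (auto simp: s1_def u1_def s2_def u2_def min_def max_def)
    then show ?thesis
      by (simp add: J(3) matrix_vector_right_distrib)
  qed
  have orth: "expectation (\<lambda>\<omega>. Y \<omega> \<bullet> (H \<omega> *v (W u2 \<omega> - W s2 \<omega>) + J2 \<omega>)) = 0" if Y: "L2F t Y" for Y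
  proof -
    have "expectation (\<lambda>\<omega>. Y \<omega> \<bullet> (H \<omega> *v (W u2 \<omega> - W s2 \<omega>))) = 0"
    proof (cases "s2 < u2")
      case True
      have "L2F s2 Y"
        using Y by (rule L2F_mono) (simp add: s2_def)
      with 2 True show ?thesis
        by (intro increment_orthogonal) auto
    qed (use 2(1) in auto)
    with J(4)[OF Y] in_L2_integrable_inner[OF L2F_in_L2[OF Y] J2] in_L2_integrable_inner[OF L2F_in_L2[OF Y] J(2)]
    show ?thesis
      by (simp add: inner_add_right)
  qed
  show ?case
    by (intro exI conjI allI impI, rule simple, rule in_L2_add[OF J2 J(2)], rule sum, rule orth)
qed

text \<open>The closure of the simple integrals in mean square, as a relation because the integral
  is fixed only up to null sets. The time interval is hidden in the support of the integrand, so
  integrals over different intervals can be subtracted.\<close>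

definition ito :: "(real \<times> 'w \<Rightarrow> real ^ 'd ^ 'm) \<Rightarrow> ('w \<Rightarrow> real ^ 'm) \<Rightarrow> bool" where
  "ito \<Phi> I \<longleftrightarrow> (\<exists>\<phi> J. (\<forall>j. simple_ito (\<phi> j) (J j)) \<and> L2_limit PM \<phi> \<Phi> \<and> L2_limit M J I)"

lemma simple_ito_imp_ito: "simple_ito \<phi> J \<Longrightarrow> ito \<phi> J"
  unfolding ito_def
  by (intro exI[of _ "\<lambda>_. \<phi>"] exI[of _ "\<lambda>_. J"]) (auto simp: L2_limit_def simple_ito_in_L2)

lemma ito_in_L2:
  assumes "ito \<Phi> I"
  shows "in_L2 PM \<Phi>" "in_L2 M I"
  using assms by (auto simp: ito_def L2_limit_def)

lemma ito_diff:
  assumes "ito \<Phi> I" "ito \<Phi>' I'"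
  shows "ito (\<lambda>x. \<Phi> x - \<Phi>' x) (\<lambda>\<omega>. I \<omega> - I' \<omega>)"
proof -
  obtain \<phi> J \<phi>' J' where "\<And>j. simple_ito (\<phi> j) (J j)" "L2_limit PM \<phi> \<Phi>" "L2_limit M J I"
    "\<And>j. simple_ito (\<phi>' j) (J' j)" "L2_limit PM \<phi>' \<Phi>'" "L2_limit M J' I'"
    using assms by (auto simp: ito_def)
  then show ?thesis
    unfolding ito_def
    by (intro exI[of _ "\<lambda>j x. \<phi> j x - \<phi>' j x"] exI[of _ "\<lambda>j \<omega>. J j \<omega> - J' j \<omega>"] conjI allI
        simple_ito_diff L2_limit_diff)
qed

lemma ito_isometry:
  assumes "ito \<Phi> I"
  shows "L2_norm M I = L2_norm PM \<Phi>"
proof -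
  obtain \<phi> J where "\<And>j. simple_ito (\<phi> j) (J j)" "L2_limit PM \<phi> \<Phi>" "L2_limit M J I"
    using assms by (auto simp: ito_def)
  from LIMSEQ_unique[OF L2_limit_norm[OF this(3)]] L2_limit_norm[OF this(2)] simple_ito_isometry[OF this(1)]
  show ?thesis by simp
qed

text \<open>The approximating integrands may be nonzero before \<open>t\<close>. Their late parts
  are orthogonal to \<open>Y\<close>; their early parts are small by the isometry, since there
  \<open>\<Phi>\<close> vanishes and the integrand coincides with the approximation error.\<close>

lemma ito_orthogonal:
  assumes "ito \<Phi> I" and zero: "\<And>r \<omega>. r < t \<Longrightarrow> \<Phi> (r, \<omega>) = 0" and Y: "L2F t Y"
  shows "expectation (\<lambda>\<omega>. Y \<omega> \<bullet> I \<omega>) = 0"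
proof -
  obtain \<phi> J where \<phi>: "\<And>j. simple_ito (\<phi> j) (J j)" "L2_limit PM \<phi> \<Phi>" "L2_limit M J I"
    using assms(1) by (auto simp: ito_def)
  have le: "\<bar>expectation (\<lambda>\<omega>. Y \<omega> \<bullet> J j \<omega>)\<bar> \<le> L2_norm M Y * L2_norm PM (\<lambda>x. \<phi> j x - \<Phi> x)" for j
  proof -
    obtain J1 J2 where J: "simple_ito (\<lambda>x. indicator {..<t} (fst x) *\<^sub>R \<phi> j x) J1" "in_L2 M J2"
      "\<And>\<omega>. J j \<omega> = J1 \<omega> + J2 \<omega>" "\<And>Y. L2F t Y \<Longrightarrow> expectation (\<lambda>\<omega>. Y \<omega> \<bullet> J2 \<omega>) = 0"
      using simple_ito_split[OF \<phi>(1)[of j], of t] by - (elim exE conjE, rule that, auto)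
    note i = in_L2_integrable_inner[OF L2F_in_L2[OF Y] simple_ito_in_L2(2)[OF J(1)]]
      in_L2_integrable_inner[OF L2F_in_L2[OF Y] J(2)]
    have "expectation (\<lambda>\<omega>. Y \<omega> \<bullet> J j \<omega>) = expectation (\<lambda>\<omega>. Y \<omega> \<bullet> J1 \<omega>)"
      using i J(4)[OF Y] by (simp add: J(3) inner_add_right)
    also have "\<bar>\<dots>\<bar> \<le> L2_norm M Y * L2_norm M J1"
      by (intro L2_inner_le L2F_in_L2[OF Y] simple_ito_in_L2(2)[OF J(1)])
    also have "L2_norm M J1 = L2_norm PM (\<lambda>x. indicator {..<t} (fst x) *\<^sub>R \<phi> j x)"
      by (rule simple_ito_isometry[OF J(1)])
    also have "\<dots> \<le> L2_norm PM (\<lambda>x. \<phi> j x - \<Phi> x)"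
    proof (rule L2_norm_mono)
      show "in_L2 PM (\<lambda>x. \<phi> j x - \<Phi> x)"
        using \<phi>(2) by (intro in_L2_diff) (auto simp: L2_limit_def)
      show "(\<lambda>x. indicator {..<t} (fst x) *\<^sub>R \<phi> j x) \<in> borel_measurable PM"
        using simple_ito_in_L2(1)[OF J(1)] by (rule in_L2_measurable)
      show "AE x in PM. norm (indicator {..<t} (fst x) *\<^sub>R \<phi> j x) \<le> norm (\<phi> j x - \<Phi> x)"
        by (intro AE_I2) (auto simp: indicator_def zero)
    qed
    finally show ?thesis
      by (simp add: mult_left_mono)
  qed
  have "(\<lambda>j. L2_norm M Y * L2_norm PM (\<lambda>x. \<phi> j x - \<Phi> x)) \<longlonglongrightarrow> 0"
    using \<phi>(2) by (intro tendsto_mult_right_zero) (auto simp: L2_limit_def)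
  then have "(\<lambda>j. expectation (\<lambda>\<omega>. Y \<omega> \<bullet> J j \<omega>)) \<longlonglongrightarrow> 0"
    by (rule Lim_null_comparison[rotated]) (use le in auto)
  with LIMSEQ_unique L2_limit_inner[OF \<phi>(3) L2F_in_L2[OF Y]] show ?thesis
    by blast
qed

lemma elementary_simple_ito:
  assumes "\<forall>i<N. t i \<le> t (Suc i)"
    and "\<forall>i<N. H i \<in> borel_measurable (F (t i)) \<and> bounded (H i ` space (F (t i)))"
  shows "simple_ito (\<lambda>x. elementary_process N t H (fst x) (snd x)) (elementary_integral W N t H)"
  using assms
proof (induction N)
  case 0
  then show ?case
    using simple_ito_zero by (simp add: elementary_process_def elementary_integral_def[abs_def])
next
  case (Suc N)
  obtain B where B: "\<And>\<omega>. \<omega> \<in> space M \<Longrightarrow> norm (H N \<omega>) \<le> B"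
    using Suc.prems(2)[rule_format, of N] by (auto simp: bounded_iff)
  have H: "H N \<in> borel_measurable (F (t N))"
    using Suc.prems(2) by simp
  have "in_L2 M (H N)"
  proof (rule in_L2_mono[OF in_L2_const])
    show "H N \<in> borel_measurable M"
      using H by (rule F_measurable_imp_measurable)
    show "AE \<omega> in M. norm (H N \<omega>) \<le> norm B"
      using B by (intro AE_I2) force
  qed
  with H have L: "L2F (t N) (H N)"
    by (simp add: L2F_def)
  have "simple_ito (\<lambda>x. indicator {t N..<t (Suc N)} (fst x) *\<^sub>R H N (snd x) + elementary_process N t H (fst x) (snd x))
      (\<lambda>\<omega>. H N \<omega> *v (W (t (Suc N)) \<omega> - W (t N) \<omega>) + elementary_integral W N t H \<omega>)"
    by (rule simple_ito_add_piece) (use Suc L \<open>in_L2 M (H N)\<close> in auto)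
  then show ?case
    by (simp add: elementary_process_def elementary_integral_def[abs_def] add.commute)
qed

text \<open>Passage from the iterated integrals of the definition to norms on the product space, by
  Tonelli.\<close>

lemma has_ito_integral_imp_ito:
  assumes "has_ito_integral M F W a b \<Phi> I"
  shows "ito (\<lambda>(s, \<omega>). indicator {a..b} s *\<^sub>R \<Phi> s \<omega>) I"
proof -
  let ?\<Phi> = "\<lambda>(s, \<omega>). indicator {a..b} s *\<^sub>R \<Phi> s \<omega>"
  have \<Phi> [measurable]: "?\<Phi> \<in> borel_measurable PM"
    using assms by (simp add: has_ito_integral_def)
  have Tonelli: "(\<integral>\<^sup>+\<omega>. (\<integral>\<^sup>+s\<in>{a..b}. ennreal ((norm (\<phi> s \<omega>))\<^sup>2) \<partial>lborel) \<partial>M)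
      = (\<integral>\<^sup>+x. ennreal ((norm (indicator {a..b} (fst x) *\<^sub>R \<phi> (fst x) (snd x)))\<^sup>2) \<partial>PM)"
    if m: "(\<lambda>x. indicator {a..b} (fst x) *\<^sub>R \<phi> (fst x) (snd x)) \<in> borel_measurable PM"
    for \<phi> :: "real \<Rightarrow> 'w \<Rightarrow> real ^ 'd ^ 'm"
  proof -
    define u where "u x = indicator {a..b} (fst x) *\<^sub>R \<phi> (fst x) (snd x)" for x
    have [measurable]: "u \<in> borel_measurable PM"
      using m unfolding u_def[abs_def] .
    have "(\<integral>\<^sup>+x. ennreal ((norm (u x))\<^sup>2) \<partial>PM) = (\<integral>\<^sup>+\<omega>. (\<integral>\<^sup>+s. ennreal ((norm (u (s, \<omega>)))\<^sup>2) \<partial>lborel) \<partial>M)"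
      by (rule pair.nn_integral_snd[symmetric]) measurable
    then have "(\<integral>\<^sup>+x. ennreal ((norm (indicator {a..b} (fst x) *\<^sub>R \<phi> (fst x) (snd x)))\<^sup>2) \<partial>PM)
      = (\<integral>\<^sup>+\<omega>. (\<integral>\<^sup>+s. ennreal ((norm (indicator {a..b} s *\<^sub>R \<phi> s \<omega>))\<^sup>2) \<partial>lborel) \<partial>M)"
      by (simp only: u_def fst_conv snd_conv)
    also have "\<dots> = (\<integral>\<^sup>+\<omega>. (\<integral>\<^sup>+s\<in>{a..b}. ennreal ((norm (\<phi> s \<omega>))\<^sup>2) \<partial>lborel) \<partial>M)"
      by (intro nn_integral_cong) (auto simp: indicator_def)
    finally show ?thesis ..
  qed
  have \<Phi>_L2: "in_L2 PM ?\<Phi>"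
    by (rule in_L2_nn_integralI[OF \<Phi>])
      (use assms Tonelli[of \<Phi>] \<Phi> in \<open>simp add: has_ito_integral_def case_prod_beta'\<close>)
  obtain N t H where el: "\<And>j. elementary_integrand F a b (N j) (t j) (H j)"
    and lim: "(\<lambda>j. \<integral>\<^sup>+\<omega>. (\<integral>\<^sup>+s\<in>{a..b}.
           ennreal ((norm (elementary_process (N j) (t j) (H j) s \<omega> - \<Phi> s \<omega>))\<^sup>2) \<partial>lborel) \<partial>M) \<longlonglongrightarrow> 0"
    and I: "L2_limit M (\<lambda>j. elementary_integral W (N j) (t j) (H j)) I"
    using assms unfolding has_ito_integral_def by blast
  define \<phi> where "\<phi> j x = elementary_process (N j) (t j) (H j) (fst x) (snd x)" for j and x :: "real \<times> 'w"
  have simple: "simple_ito (\<phi> j) (elementary_integral W (N j) (t j) (H j))" for j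
    unfolding \<phi>_def using el[of j] by (intro elementary_simple_ito) (auto simp: elementary_integrand_def)
  note \<phi>_L2 = simple_ito_in_L2(1)[OF simple]
  \<comment> \<open>The half-open pieces lie between \<open>t j 0 = a\<close> and
    \<open>t j (N j) = b\<close>. Hence the distance measured over \<open>{a..b}\<close> in the
    definition is the distance over the whole time axis.\<close>
  have supp: "\<phi> j x = 0" if "fst x \<notin> {a..b}" for j x
  proof -
    have t: "t j 0 = a" "t j (N j) = b" "\<And>i. i < N j \<Longrightarrow> t j i \<le> t j (Suc i)"
      using el[of j] by (auto simp: elementary_integrand_def)
    have lo: "a \<le> t j i" if "i \<le> N j" for i
      using that t(1,3) by (induction i) (auto intro: order_trans)
    have up: "t j i \<le> b" if "i \<le> N j" for i
      using that t(2,3) by (induction i rule: inc_induct) (auto intro: order_trans)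
    have "indicator {t j i..<t j (Suc i)} (fst x) = (0::real)" if "i < N j" for i
      using lo[of i] up[of "Suc i"] that \<open>fst x \<notin> {a..b}\<close> by (auto simp: indicator_def)
    then show ?thesis
      by (simp add: \<phi>_def elementary_process_def)
  qed
  have eq: "\<phi> j x - ?\<Phi> x = indicator {a..b} (fst x) *\<^sub>R (elementary_process (N j) (t j) (H j) (fst x) (snd x) - \<Phi> (fst x) (snd x))" for j x
    using supp[of x j] by (cases "fst x \<in> {a..b}") (auto simp: case_prod_beta' \<phi>_def)
  have norm_eq: "ennreal ((L2_norm PM (\<lambda>x. \<phi> j x - ?\<Phi> x))\<^sup>2) = (\<integral>\<^sup>+\<omega>. (\<integral>\<^sup>+s\<in>{a..b}.
           ennreal ((norm (elementary_process (N j) (t j) (H j) s \<omega> - \<Phi> s \<omega>))\<^sup>2) \<partial>lborel) \<partial>M)" for j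
  proof -
    have d: "in_L2 PM (\<lambda>x. \<phi> j x - ?\<Phi> x)"
      by (intro in_L2_diff \<phi>_L2 \<Phi>_L2)
    then show ?thesis
      unfolding nn_integral_L2_norm[OF d, symmetric] unfolding eq
      by (intro Tonelli[symmetric]) (auto dest: in_L2_measurable)
  qed
  have "(\<lambda>j. ennreal ((L2_norm PM (\<lambda>x. \<phi> j x - ?\<Phi> x))\<^sup>2)) \<longlonglongrightarrow> ennreal 0"
    using lim by (simp add: norm_eq)
  then have "(\<lambda>j. (L2_norm PM (\<lambda>x. \<phi> j x - ?\<Phi> x))\<^sup>2) \<longlonglongrightarrow> 0"
    by (subst (asm) tendsto_ennreal_iff) auto
  then have "(\<lambda>j. sqrt ((L2_norm PM (\<lambda>x. \<phi> j x - ?\<Phi> x))\<^sup>2)) \<longlonglongrightarrow> sqrt 0"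
    by (rule tendsto_real_sqrt)
  then have "L2_limit PM \<phi> ?\<Phi>"
    using \<phi>_L2 \<Phi>_L2 by (simp add: L2_limit_def)
  show ?thesis
    unfolding ito_def by (intro exI conjI allI, rule simple) fact+
qed

text \<open>The two integrals come with unrelated approximating sequences; additivity in the
  interval is therefore obtained as linearity of \<open>ito\<close> in the integrand.\<close>

lemma ito_integral_increment:
  assumes I: "has_ito_integral M F W a b \<Phi> I" and I': "has_ito_integral M F W a c \<Phi> I'"
    and "a \<le> b" "b \<le> c"
  shows "ito (\<lambda>(s, \<omega>). indicator {b<..c} s *\<^sub>R \<Phi> s \<omega>) (\<lambda>\<omega>. I' \<omega> - I \<omega>)"
proof -
  have "(\<lambda>x. (case x of (s, \<omega>) \<Rightarrow> indicator {a..c} s *\<^sub>R \<Phi> s \<omega>) - (case x of (s, \<omega>) \<Rightarrow> indicator {a..b} s *\<^sub>R \<Phi> s \<omega>))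
      = (\<lambda>(s, \<omega>). indicator {b<..c} s *\<^sub>R \<Phi> s \<omega>)"
    using assms(3,4) by (auto simp: fun_eq_iff indicator_def)
  with ito_diff[OF I'[THEN has_ito_integral_imp_ito] I[THEN has_ito_integral_imp_ito]] show ?thesis
    by simp
qed

lemma ito_integral_increment_orthogonal:
  assumes "has_ito_integral M F W a b \<Phi> I" "has_ito_integral M F W a c \<Phi> I'" "a \<le> b" "b \<le> c" "L2F b Y"
  shows "expectation (\<lambda>\<omega>. Y \<omega> \<bullet> (I' \<omega> - I \<omega>)) = 0"
  by (rule ito_orthogonal[OF ito_integral_increment[OF assms(1-4)] _ assms(5)]) auto

text \<open>The isometry for the integrand minus its frozen value \<open>G\<close>. With
  \<open>G = 0\<close> it bounds the stochastic increment itself, with \<open>G\<close> the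
  diffusion coefficient at time \<open>b\<close> it bounds the martingale defect of a step.\<close>

lemma ito_integral_increment_le:
  assumes "has_ito_integral M F W a b \<Phi> I" "has_ito_integral M F W a c \<Phi> I'" "a \<le> b" "b \<le> c"
    and G: "L2F b G" and \<beta>: "0 \<le> \<beta>"
    and le: "\<And>s. b < s \<Longrightarrow> s < c \<Longrightarrow> (\<integral>\<^sup>+\<omega>. ennreal ((norm (\<Phi> s \<omega> - G \<omega>))\<^sup>2) \<partial>M) \<le> ennreal (\<beta>\<^sup>2)"
  shows "L2_norm M (\<lambda>\<omega>. I' \<omega> - I \<omega> - G \<omega> *v (W c \<omega> - W b \<omega>)) \<le> \<beta> * sqrt (c - b)"
proof -
  let ?\<Psi> = "\<lambda>x. (case x of (s, \<omega>) \<Rightarrow> indicator {b<..c} s *\<^sub>R \<Phi> s \<omega>) - indicator {b..<c} (fst x) *\<^sub>R G (snd x)"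
  have ito: "ito ?\<Psi> (\<lambda>\<omega>. I' \<omega> - I \<omega> - G \<omega> *v (W c \<omega> - W b \<omega>))"
    using assms(4) G by (intro ito_diff ito_integral_increment[OF assms(1-4)] simple_ito_imp_ito simple_ito_piece)
      (auto simp: L2F_in_L2)
  have \<Psi> [measurable]: "?\<Psi> \<in> borel_measurable PM"
    using ito_in_L2(1)[OF ito] by (rule in_L2_measurable)
  have "(\<integral>\<^sup>+x. ennreal ((norm (?\<Psi> x))\<^sup>2) \<partial>PM) = (\<integral>\<^sup>+s. \<integral>\<^sup>+\<omega>. ennreal ((norm (?\<Psi> (s, \<omega>)))\<^sup>2) \<partial>M \<partial>lborel)"
    by (subst nn_integral_fst[symmetric]) auto
  also have "\<dots> \<le> (\<integral>\<^sup>+s. ennreal (\<beta>\<^sup>2) * indicator {b<..<c} s \<partial>lborel)"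
  proof (rule nn_integral_mono_AE)
    \<comment> \<open>The two half-open intervals differ only at the endpoints, a null set.\<close>
    have "AE s in lborel. s \<noteq> b" "AE s in lborel. s \<noteq> c"
      by (auto simp: AE_lborel_singleton)
    then show "AE s in lborel. (\<integral>\<^sup>+\<omega>. ennreal ((norm (?\<Psi> (s, \<omega>)))\<^sup>2) \<partial>M) \<le> ennreal (\<beta>\<^sup>2) * indicator {b<..<c} s"
    proof eventually_elim
      case (elim s)
      then show ?case
        using le[of s] by (auto simp: indicator_def)
    qed
  qed
  also have "\<dots> = ennreal ((\<beta> * sqrt (c - b))\<^sup>2)"
    using assms(4) by (simp add: nn_integral_cmult_indicator ennreal_mult power_mult_distrib)
  finally have "L2_norm PM ?\<Psi> \<le> \<beta> * sqrt (c - b)"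
    using assms(4) \<beta> by (intro in_L2_nn_integral_leI(2)[OF \<Psi>]) auto
  then show ?thesis
    by (simp only: ito_isometry[OF ito])
qed

end

section \<open>Stability of the Euler--Maruyama scheme\<close>

lemma square_add_le_Young:
  fixes a b c :: real
  assumes "0 < c"
  shows "(a + b)\<^sup>2 \<le> (1 + c) * a\<^sup>2 + (1 + 1 / c) * b\<^sup>2"
proof -
  have "0 \<le> (c * a - b)\<^sup>2 / c"
    using assms by simp
  also have "(c * a - b)\<^sup>2 / c = c * a\<^sup>2 - 2 * a * b + b\<^sup>2 / c"
    using assms by (simp add: power2_eq_square field_simps)
  finally show ?thesis
    by (simp add: power2_sum algebra_simps)
qed

lemma L2_norm_add_Young:
  assumes "in_L2 M X" "in_L2 M Y" "0 < c"
  shows "(L2_norm M (\<lambda>\<omega>. X \<omega> + Y \<omega>))\<^sup>2 \<le> (1 + c) * (L2_norm M X)\<^sup>2 + (1 + 1 / c) * (L2_norm M Y)\<^sup>2"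
proof -
  have "(L2_norm M (\<lambda>\<omega>. X \<omega> + Y \<omega>))\<^sup>2 \<le> (L2_norm M X + L2_norm M Y)\<^sup>2"
    using L2_norm_triangle[OF assms(1,2)] by (intro power_mono) auto
  also note square_add_le_Young[OF assms(3)]
  finally show ?thesis .
qed

text \<open>Writing the inhomogeneity as \<open>q * p\<close> makes \<open>p\<close> the fixed point
  of the recursion, so the accumulated defect does not grow with the number of steps.\<close>

lemma affine_recursion_le:
  fixes a :: "nat \<Rightarrow> real"
  assumes "\<And>i. i < n \<Longrightarrow> a (Suc i) \<le> (1 - q) * a i + q * p" "0 \<le> 1 - q" "0 \<le> p" "0 \<le> q" "i \<le> n"
  shows "a i \<le> (1 - q) ^ i * a 0 + p"
  using assms(5)
proof (induction i)
  case (Suc i)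
  have "a (Suc i) \<le> (1 - q) * a i + q * p"
    using Suc assms(1) by simp
  also have "\<dots> \<le> (1 - q) * ((1 - q) ^ i * a 0 + p) + q * p"
    using Suc assms by (intro add_right_mono mult_left_mono) auto
  also have "\<dots> = (1 - q) ^ Suc i * a 0 + p"
    by (simp add: algebra_simps)
  finally show ?case .
qed (use assms in simp)

lemma periodic_int:
  fixes \<phi> :: "real \<Rightarrow> 'a" and p :: real
  assumes "\<And>t. \<phi> (t + p) = \<phi> t"
  shows "\<phi> (t + of_int k * p) = \<phi> t"
proof (induction k rule: int_induct[where k=0])
  case (step1 i)
  then show ?case
    using assms[of "t + of_int i * p"] by (simp add: algebra_simps)
next
  case (step2 i)
  then show ?case
    using assms[of "t + of_int (i - 1) * p"] by (simp add: algebra_simps)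
qed simp

text \<open>Joint continuity gives measurability of the coefficients along measurable processes and
  integrability of the drift along continuous paths.\<close>

lemma Hoelder_continuous:
  fixes \<phi> :: "real \<Rightarrow> 'a::real_normed_vector \<Rightarrow> 'b::real_normed_vector"
  assumes "\<And>s t x y. norm (\<phi> s x - \<phi> t y) \<le> C * sqrt \<bar>s - t\<bar> + K * norm (x - y)"
  shows "continuous_on UNIV (\<lambda>p. \<phi> (fst p) (snd p))"
proof (clarsimp simp: continuous_on_def)
  fix t and y :: 'a
  have lim: "((\<lambda>p. C * sqrt \<bar>fst p - t\<bar> + K * norm (snd p - y)) \<longlongrightarrow> C * sqrt \<bar>t - t\<bar> + K * norm (y - y)) (at (t, y))"
    by (intro tendsto_intros tendsto_fst[of "\<lambda>p. p" "(t, y)", simplified] tendsto_snd[of "\<lambda>p. p" "(t, y)", simplified] tendsto_ident_at)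
  have "((\<lambda>p. \<phi> (fst p) (snd p) - \<phi> t y) \<longlongrightarrow> 0) (at (t, y))"
    by (rule Lim_null_comparison[OF _ lim[simplified]]) (use assms in auto)
  then show "((\<lambda>p. \<phi> (fst p) (snd p)) \<longlongrightarrow> \<phi> t y) (at (t, y))"
    by (simp add: LIM_zero_iff)
qed

text \<open>The spectral hypotheses on the matrix enter through \<open>A_dissipative\<close>;
  \<open>\<mu>\<close> stands for the absolute value of the largest eigenvalue.\<close>

locale dissipative_sde = wiener_space M W
  for M :: "'w measure" and W :: "real \<Rightarrow> 'w \<Rightarrow> real ^ 'd" +
  fixes A :: "real ^ 'm ^ 'm"
    and f :: "real \<Rightarrow> real ^ 'm \<Rightarrow> real ^ 'm"
    and g :: "real \<Rightarrow> real ^ 'm \<Rightarrow> real ^ 'd ^ 'm"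
    and \<tau> C0 \<beta>1 \<beta>2 \<mu> :: real
  assumes A_dissipative: "v \<bullet> (A *v v) \<le> - \<mu> * (norm v)\<^sup>2"
    and \<tau>_pos: "0 < \<tau>"
    and f_periodic: "f (t + \<tau>) x = f t x"
    and g_periodic: "g (t + \<tau>) x = g t x"
    and C0_pos: "0 < C0" and \<beta>1_pos: "0 < \<beta>1" and \<beta>2_pos: "0 < \<beta>2"
    and dissipativity: "\<beta>1 + \<beta>2\<^sup>2 / 2 < \<mu>"
    and f_Hoelder: "norm (f s x - f t y) \<le> C0 * sqrt \<bar>s - t\<bar> + \<beta>1 * norm (x - y)"
    and g_Hoelder: "norm (g s x - g t y) \<le> C0 * sqrt \<bar>s - t\<bar> + \<beta>2 * norm (x - y)"
begin

definition b :: "real \<Rightarrow> real ^ 'm \<Rightarrow> real ^ 'm" where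
  "b t x = A *v x + f t x"

definition L :: real where "L = norm A + \<beta>1"

text \<open>Mean squares of differences of solutions decay at rate \<open>2 * \<alpha>\<close>. In a
  step of the scheme, \<alpha> of this pays for the quadratic drift term and the splitting of the
  noise defect, and \<open>\<alpha> / 2\<close> for the drift defect; the other half
  remains.\<close>

definition \<alpha> :: real where "\<alpha> = \<mu> - \<beta>1 - \<beta>2\<^sup>2 / 2"

text \<open>\<open>\<eta> h\<close> and \<open>\<eta>\<close> are the weights in Young's inequality when the drift and diffusion defects of a
  step are split off; \<open>max_step\<close> is small enough to leave the factor \<open>1 - h \<alpha> / 2\<close> per step.\<close>

definition \<eta> :: real where "\<eta> = (\<alpha> / 2) / (1 + \<beta>2\<^sup>2)"

definition max_step :: real where "max_step = min 1 (min (\<alpha> / (2 * L\<^sup>2)) (1 / \<alpha>))"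

text \<open>Scaled by \<open>2 / \<alpha>\<close> so that the squared defect of a step has the form
  required by \<open>affine_recursion_le\<close> with \<open>q = h * \<alpha> / 2\<close>. The first
  summand stems from the drift defect, the product from the martingale defect, which passes through
  both Young inequalities.\<close>

definition stab_c :: real where
  "stab_c = 2 / \<alpha> * ((1 + 1 / \<eta>) + (1 + \<eta>) * (1 + 1 / \<eta>))"

definition zero_bound :: real where "zero_bound = norm (f 0 0) + norm (g 0 0) + C0 * sqrt \<tau>"

lemma L_pos: "0 < L"
  using \<beta>1_pos by (simp add: L_def add_nonneg_pos)

lemma \<alpha>_pos: "0 < \<alpha>"
  using dissipativity by (simp add: \<alpha>_def)

lemma \<eta>_pos: "0 < \<eta>"
  using \<alpha>_pos by (simp add: \<eta>_def add_pos_nonneg)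

lemma \<eta>_le: "\<eta> \<le> \<alpha> / 2" "\<eta> * \<beta>2\<^sup>2 \<le> \<alpha> / 2"
proof -
  have "1 + \<beta>2\<^sup>2 \<noteq> 0"
    using zero_le_power2[of \<beta>2] by linarith
  then have "\<eta> * (1 + \<beta>2\<^sup>2) = \<alpha> / 2"
    unfolding \<eta>_def by (rule nonzero_eq_divide_eq[THEN iffD1, OF _ refl])
  then have "\<eta> + \<eta> * \<beta>2\<^sup>2 = \<alpha> / 2"
    by (simp add: distrib_left)
  moreover have "0 \<le> \<eta> * \<beta>2\<^sup>2"
    using \<eta>_pos by simp
  ultimately show "\<eta> \<le> \<alpha> / 2" "\<eta> * \<beta>2\<^sup>2 \<le> \<alpha> / 2"
    using \<eta>_pos by linarith+
qed

lemma max_step_pos: "0 < max_step"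
  using \<alpha>_pos L_pos by (simp add: max_step_def)

lemma max_step_le:
  assumes "h \<le> max_step"
  shows "h \<le> 1" "h * L\<^sup>2 \<le> \<alpha> / 2" "h * \<alpha> \<le> 1"
  using assms \<alpha>_pos L_pos by (auto simp: max_step_def field_simps)

lemma stab_c_nonneg: "0 \<le> stab_c"
  using \<alpha>_pos \<eta>_pos by (simp add: stab_c_def)

lemma zero_bound_nonneg: "0 \<le> zero_bound"
  using C0_pos \<tau>_pos by (simp add: zero_bound_def)

lemma f_periodic_int: "f (t + of_int k * \<tau>) x = f t x"
  by (rule periodic_int[where \<phi>="\<lambda>t. f t x"]) (rule f_periodic)

lemma g_periodic_int: "g (t + of_int k * \<tau>) x = g t x"
  by (rule periodic_int[where \<phi>="\<lambda>t. g t x"]) (rule g_periodic)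

text \<open>Periodicity moves \<open>t\<close> to some \<open>s\<close> in
  \<open>{0..\<tau>}\<close>, and Hoelder continuity compares \<open>s\<close> with time 0. These
  bounds uniform in time are the source of all constants independent of \<open>r\<close>.\<close>

lemma f_zero_le: "norm (f t 0) \<le> zero_bound" and g_zero_le: "norm (g t 0) \<le> zero_bound"
proof -
  define s where "s = t + of_int (- \<lfloor>t / \<tau>\<rfloor>) * \<tau>"
  have "of_int \<lfloor>t / \<tau>\<rfloor> \<le> t / \<tau>" "t / \<tau> < of_int \<lfloor>t / \<tau>\<rfloor> + 1"
    by linarith+
  then have "of_int \<lfloor>t / \<tau>\<rfloor> * \<tau> \<le> t" "t < (of_int \<lfloor>t / \<tau>\<rfloor> + 1) * \<tau>"
    by (simp_all only: pos_le_divide_eq[OF \<tau>_pos] pos_divide_less_eq[OF \<tau>_pos])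
  then have "0 \<le> s" "s \<le> \<tau>"
    by (simp_all add: s_def algebra_simps)
  then have s: "C0 * sqrt \<bar>s - 0\<bar> \<le> C0 * sqrt \<tau>"
    using C0_pos by simp
  have eq: "f t 0 = f s 0" "g t 0 = g s 0"
    unfolding s_def by (simp_all only: f_periodic_int g_periodic_int)
  have "norm (f s 0 - f 0 0) \<le> C0 * sqrt \<bar>s - 0\<bar>" "norm (g s 0 - g 0 0) \<le> C0 * sqrt \<bar>s - 0\<bar>"
    using f_Hoelder[of s 0 0 0] g_Hoelder[of s 0 0 0] by simp_all
  then show "norm (f t 0) \<le> zero_bound" "norm (g t 0) \<le> zero_bound"
    using s norm_triangle_sub[of "f s 0" "f 0 0"] norm_triangle_sub[of "g s 0" "g 0 0"]
      norm_ge_zero[of "f 0 0"] norm_ge_zero[of "g 0 0"]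
    unfolding zero_bound_def eq by linarith+
qed

lemma f_growth: "norm (f t x) \<le> zero_bound + \<beta>1 * norm x"
  using f_Hoelder[of t x t 0] f_zero_le[of t] norm_triangle_sub[of "f t x" "f t 0"] by simp

lemma g_growth: "norm (g t x) \<le> zero_bound + \<beta>2 * norm x"
  using g_Hoelder[of t x t 0] g_zero_le[of t] norm_triangle_sub[of "g t x" "g t 0"] by simp

lemma b_Hoelder: "norm (b s x - b t y) \<le> C0 * sqrt \<bar>s - t\<bar> + L * norm (x - y)"
proof -
  have "b s x - b t y = A *v (x - y) + (f s x - f t y)"
    by (simp add: b_def matrix_vector_mult_diff_distrib)
  also have "norm \<dots> \<le> norm A * norm (x - y) + (C0 * sqrt \<bar>s - t\<bar> + \<beta>1 * norm (x - y))"
    by (intro norm_triangle_mono norm_matrix_vector_mult_le f_Hoelder)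
  finally show ?thesis
    by (simp add: L_def algebra_simps)
qed

lemma b_growth: "norm (b t x) \<le> zero_bound + L * norm x"
  using b_Hoelder[of t x t 0] f_zero_le[of t] norm_triangle_sub[of "b t x" "b t 0"]
  by (simp add: b_def)

lemma b_dissipative: "(x - y) \<bullet> (b t x - b t y) \<le> - (\<mu> - \<beta>1) * (norm (x - y))\<^sup>2"
proof -
  have "(x - y) \<bullet> (b t x - b t y) = (x - y) \<bullet> (A *v (x - y)) + (x - y) \<bullet> (f t x - f t y)"
    by (simp add: b_def matrix_vector_mult_diff_distrib inner_add_right inner_diff_right)
  also have "(x - y) \<bullet> (f t x - f t y) \<le> norm (x - y) * norm (f t x - f t y)"
    by (rule norm_cauchy_schwarz)
  also have "\<dots> \<le> norm (x - y) * (\<beta>1 * norm (x - y))"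
    using f_Hoelder[of t x t y] by (intro mult_left_mono) auto
  also note A_dissipative[of "x - y"]
  finally show ?thesis
    by (simp add: power2_eq_square algebra_simps)
qed

lemmas f_continuous = Hoelder_continuous[of f, OF f_Hoelder]
lemmas g_continuous = Hoelder_continuous[of g, OF g_Hoelder]
lemmas b_continuous = Hoelder_continuous[of b, OF b_Hoelder]

lemma measurable_coefficients [measurable (raw)]:
  assumes "T \<in> borel_measurable N" "Y \<in> borel_measurable N"
  shows "(\<lambda>\<omega>. f (T \<omega>) (Y \<omega>)) \<in> borel_measurable N"
    and "(\<lambda>\<omega>. g (T \<omega>) (Y \<omega>)) \<in> borel_measurable N"
    and "(\<lambda>\<omega>. b (T \<omega>) (Y \<omega>)) \<in> borel_measurable N"
  using borel_measurable_continuous_Pair[OF assms f_continuous]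
    borel_measurable_continuous_Pair[OF assms g_continuous]
    borel_measurable_continuous_Pair[OF assms b_continuous] by simp_all

lemma L2F_coefficients:
  assumes "L2F t Y"
  shows "L2F t (\<lambda>\<omega>. f s (Y \<omega>))" "L2F t (\<lambda>\<omega>. g s (Y \<omega>))" "L2F t (\<lambda>\<omega>. b s (Y \<omega>))"
    and "L2_norm M (\<lambda>\<omega>. f s (Y \<omega>)) \<le> zero_bound + \<beta>1 * L2_norm M Y"
    and "L2_norm M (\<lambda>\<omega>. g s (Y \<omega>)) \<le> zero_bound + \<beta>2 * L2_norm M Y"
    and "L2_norm M (\<lambda>\<omega>. b s (Y \<omega>)) \<le> zero_bound + L * L2_norm M Y"
proof -
  have Y: "in_L2 M Y" and [measurable]: "Y \<in> borel_measurable (F t)" "Y \<in> borel_measurable M"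
    using assms by (auto simp: L2F_def in_L2_def)
  have m: "(\<lambda>\<omega>. f s (Y \<omega>)) \<in> borel_measurable M" "(\<lambda>\<omega>. g s (Y \<omega>)) \<in> borel_measurable M"
    "(\<lambda>\<omega>. b s (Y \<omega>)) \<in> borel_measurable M"
    by measurable
  note fb = in_L2_affine_bound[OF Y m(1) zero_bound_nonneg less_imp_le[OF \<beta>1_pos] f_growth]
  note gb = in_L2_affine_bound[OF Y m(2) zero_bound_nonneg less_imp_le[OF \<beta>2_pos] g_growth]
  note bb = in_L2_affine_bound[OF Y m(3) zero_bound_nonneg less_imp_le[OF L_pos] b_growth]
  show "L2F t (\<lambda>\<omega>. f s (Y \<omega>))" "L2F t (\<lambda>\<omega>. g s (Y \<omega>))" "L2F t (\<lambda>\<omega>. b s (Y \<omega>))"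
    using fb(1) gb(1) bb(1) by (simp_all add: L2F_def)
  show "L2_norm M (\<lambda>\<omega>. f s (Y \<omega>)) \<le> zero_bound + \<beta>1 * L2_norm M Y"
    "L2_norm M (\<lambda>\<omega>. g s (Y \<omega>)) \<le> zero_bound + \<beta>2 * L2_norm M Y"
    "L2_norm M (\<lambda>\<omega>. b s (Y \<omega>)) \<le> zero_bound + L * L2_norm M Y"
    by (fact fb(2) gb(2) bb(2))+
qed

section \<open>One step and whole paths of the scheme\<close>

definition em_step :: "real \<Rightarrow> real \<Rightarrow> ('w \<Rightarrow> real ^ 'm) \<Rightarrow> 'w \<Rightarrow> real ^ 'm" where
  "em_step s h Y \<omega> = Y \<omega> + h *\<^sub>R b s (Y \<omega>) + g s (Y \<omega>) *v (W (s + h) \<omega> - W s \<omega>)"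

lemma L2F_em_step:
  assumes "L2F s Y" "0 < h"
  shows "L2F (s + h) (em_step s h Y)"
  unfolding em_step_def[abs_def] using assms
  by (intro L2F_add L2F_scaleR L2F_increment) (auto intro: L2F_mono L2F_coefficients)

text \<open>The new difference is \<open>U + (V + S) + D\<close>. Here \<open>V + S\<close> is
  orthogonal to \<open>U\<close>, so the squared norms add; dissipativity bounds \<open>U\<close>,
  the Lipschitz constant of the diffusion bounds \<open>V\<close>, and the defects are split off by
  Young's inequality.\<close>

lemma em_step_stable:
  assumes h: "0 < h" "h \<le> max_step" and x: "L2F s x" and y: "L2F s y"
    and D: "in_L2 M D" "L2_norm M D \<le> h * \<theta>" and S: "in_L2 M S" "L2_norm M S \<le> sqrt h * \<theta>"
    and orth: "\<And>Y. L2F s Y \<Longrightarrow> expectation (\<lambda>\<omega>. Y \<omega> \<bullet> S \<omega>) = 0"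
    and x': "\<And>\<omega>. x' \<omega> = em_step s h x \<omega> + D \<omega> + S \<omega>"
    and y': "\<And>\<omega>. y' \<omega> = em_step s h y \<omega>"
  shows "(L2_norm M (\<lambda>\<omega>. x' \<omega> - y' \<omega>))\<^sup>2
    \<le> (1 - h * \<alpha> / 2) * (L2_norm M (\<lambda>\<omega>. x \<omega> - y \<omega>))\<^sup>2 + h * \<alpha> / 2 * (stab_c * \<theta>\<^sup>2)"
proof -
  define e where "e \<omega> = x \<omega> - y \<omega>" for \<omega>
  \<comment> \<open>The part known at time \<open>s\<close>. Both \<open>V\<close> and
    \<open>S\<close> are orthogonal to it, whereas the drift defect \<open>D\<close> may be
    correlated with everything.\<close>
  define U where "U \<omega> = e \<omega> + h *\<^sub>R (b s (x \<omega>) - b s (y \<omega>))" for \<omega>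
  define G where "G \<omega> = g s (x \<omega>) - g s (y \<omega>)" for \<omega>
  define V where "V \<omega> = G \<omega> *v (W (s + h) \<omega> - W s \<omega>)" for \<omega>
  define E where "E = (L2_norm M e)\<^sup>2"
  have e: "L2F s e" and G: "L2F s G" and U: "L2F s U"
    unfolding e_def[abs_def] G_def[abs_def] U_def[abs_def]
    by (intro L2F_add L2F_scaleR L2F_diff x y L2F_coefficients)+
  have V: "in_L2 M V"
    unfolding V_def[abs_def] using h by (intro in_L2_increment G) simp
  have VS: "in_L2 M (\<lambda>\<omega>. V \<omega> + S \<omega>)"
    by (intro in_L2_add V S)
  have UL: "in_L2 M U" and eL: "in_L2 M e" and GL: "in_L2 M G"
    using U e G by (simp_all add: L2F_in_L2)
  have eq: "(\<lambda>\<omega>. x' \<omega> - y' \<omega>) = (\<lambda>\<omega>. (U \<omega> + (V \<omega> + S \<omega>)) + D \<omega>)"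
    by (simp add: fun_eq_iff x' y' em_step_def U_def V_def G_def e_def scaleR_diff_right
        matrix_vector_mult_diff_rdistrib)
  have norm_U: "(L2_norm M U)\<^sup>2 \<le> (1 - 2 * h * (\<mu> - \<beta>1) + h\<^sup>2 * L\<^sup>2) * E"
  proof -
    have "(norm (U \<omega>))\<^sup>2 \<le> (1 - 2 * h * (\<mu> - \<beta>1) + h\<^sup>2 * L\<^sup>2) * (norm (e \<omega>))\<^sup>2" for \<omega>
    proof -
      define d where "d = b s (x \<omega>) - b s (y \<omega>)"
      have "norm d \<le> L * norm (e \<omega>)"
        using b_Hoelder[of s "x \<omega>" s "y \<omega>"] by (simp add: d_def e_def)
      then have "(norm d)\<^sup>2 \<le> (L * norm (e \<omega>))\<^sup>2"
        by (intro power_mono) auto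
      then have d2: "h\<^sup>2 * (norm d)\<^sup>2 \<le> h\<^sup>2 * (L\<^sup>2 * (norm (e \<omega>))\<^sup>2)"
        by (intro mult_left_mono) (auto simp: power_mult_distrib)
      have ed: "h * (e \<omega> \<bullet> d) \<le> h * (- (\<mu> - \<beta>1) * (norm (e \<omega>))\<^sup>2)"
        using b_dissipative[of "x \<omega>" "y \<omega>" s] h unfolding d_def e_def by (intro mult_left_mono) auto
      have "(norm (U \<omega>))\<^sup>2 = (norm (e \<omega>))\<^sup>2 + 2 * (h * (e \<omega> \<bullet> d)) + h\<^sup>2 * (norm d)\<^sup>2"
        unfolding U_def d_def[symmetric] power2_norm_eq_inner
        by (simp add: inner_commute power2_eq_square algebra_simps)
      with d2 ed show ?thesis
        by (simp add: algebra_simps)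
    qed
    then have "expectation (\<lambda>\<omega>. (norm (U \<omega>))\<^sup>2) \<le> expectation (\<lambda>\<omega>. (1 - 2 * h * (\<mu> - \<beta>1) + h\<^sup>2 * L\<^sup>2) * (norm (e \<omega>))\<^sup>2)"
      using in_L2_integrable[OF UL] in_L2_integrable[OF eL] by (intro integral_mono) auto
    then show ?thesis
      by (simp add: E_def L2_norm_power2)
  qed
  have norm_V: "(L2_norm M V)\<^sup>2 \<le> h * \<beta>2\<^sup>2 * E"
  proof -
    have [measurable]: "G \<in> borel_measurable M"
      using GL by (rule in_L2_measurable)
    have "L2_norm M G \<le> 0 + \<beta>2 * L2_norm M e"
      using \<beta>2_pos g_Hoelder[of s "x _" s "y _"]
      by (intro in_L2_affine_bound(2) eL) (auto simp: G_def e_def)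
    then have "(L2_norm M G)\<^sup>2 \<le> (\<beta>2 * L2_norm M e)\<^sup>2"
      by (intro power_mono) auto
    moreover have "L2_norm M V = sqrt h * L2_norm M G"
      unfolding V_def[abs_def] using L2_norm_increment[OF _ G, of "s + h"] h by simp
    ultimately show ?thesis
      using h by (simp add: E_def power_mult_distrib mult.assoc)
  qed
  have UV0: "expectation (\<lambda>\<omega>. U \<omega> \<bullet> (V \<omega> + S \<omega>)) = 0"
    using orth[OF U] increment_orthogonal[OF _ G U, of "s + h"] h
      in_L2_integrable_inner[OF UL V] in_L2_integrable_inner[OF UL S(1)]
    by (simp add: inner_add_right V_def[abs_def])
  have norm_S: "(L2_norm M S)\<^sup>2 \<le> h * \<theta>\<^sup>2"
    using power_mono[OF S(2), of 2] h by (simp add: power_mult_distrib)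
  have norm_D: "(L2_norm M D)\<^sup>2 \<le> h\<^sup>2 * \<theta>\<^sup>2"
    using power_mono[OF D(2), of 2] h by (simp add: power_mult_distrib)
  have E0: "0 \<le> E"
    by (simp add: E_def)
  have "(L2_norm M (\<lambda>\<omega>. U \<omega> + (V \<omega> + S \<omega>)))\<^sup>2 = (L2_norm M U)\<^sup>2 + (L2_norm M (\<lambda>\<omega>. V \<omega> + S \<omega>))\<^sup>2"
    using L2_norm_add_power2[OF UL VS] UV0 by simp
  also have "\<dots> \<le> (1 - 2 * h * (\<mu> - \<beta>1) + h\<^sup>2 * L\<^sup>2) * E + ((1 + \<eta>) * (h * \<beta>2\<^sup>2 * E) + (1 + 1 / \<eta>) * (h * \<theta>\<^sup>2))"
  proof (intro add_mono norm_U)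
    have "(L2_norm M (\<lambda>\<omega>. V \<omega> + S \<omega>))\<^sup>2 \<le> (1 + \<eta>) * (L2_norm M V)\<^sup>2 + (1 + 1 / \<eta>) * (L2_norm M S)\<^sup>2"
      by (rule L2_norm_add_Young[OF V S(1) \<eta>_pos])
    also have "\<dots> \<le> (1 + \<eta>) * (h * \<beta>2\<^sup>2 * E) + (1 + 1 / \<eta>) * (h * \<theta>\<^sup>2)"
      using \<eta>_pos by (intro add_mono mult_left_mono norm_V norm_S) auto
    finally show "(L2_norm M (\<lambda>\<omega>. V \<omega> + S \<omega>))\<^sup>2 \<le> (1 + \<eta>) * (h * \<beta>2\<^sup>2 * E) + (1 + 1 / \<eta>) * (h * \<theta>\<^sup>2)" .
  qed
  \<comment> \<open>The true gain is \<open>2 * h * \<alpha>\<close>. The bound on the step makes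
    \<open>h * L\<^sup>2\<close> at most \<open>\<alpha> / 2\<close>, the choice of
    \<open>\<eta>\<close> does so for \<open>\<eta> * \<beta>2\<^sup>2\<close>, and together they
    use up half of the gain.\<close>
  also have "\<dots> \<le> (1 - h * \<alpha>) * E + (1 + 1 / \<eta>) * (h * \<theta>\<^sup>2)"
  proof -
    have "(h * L\<^sup>2 + \<eta> * \<beta>2\<^sup>2) * (h * E) \<le> \<alpha> * (h * E)"
      using max_step_le(2)[OF h(2)] \<eta>_le(2) h E0 by (intro mult_right_mono) auto
    then show ?thesis
      by (simp add: \<alpha>_def power2_eq_square algebra_simps)
  qed
  finally have UVS: "(L2_norm M (\<lambda>\<omega>. U \<omega> + (V \<omega> + S \<omega>)))\<^sup>2 \<le> (1 - h * \<alpha>) * E + (1 + 1 / \<eta>) * (h * \<theta>\<^sup>2)" .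
  \<comment> \<open>A weight proportional to \<open>h\<close> balances the split: the main term
    loses only a factor of order \<open>h\<close>, and dividing the squared drift defect, of order
    \<open>h\<^sup>2\<close>, by it still leaves order \<open>h\<close>.\<close>
  have \<eta>h: "0 < \<eta> * h"
    using \<eta>_pos h by simp
  have "(L2_norm M (\<lambda>\<omega>. x' \<omega> - y' \<omega>))\<^sup>2
      \<le> (1 + \<eta> * h) * (L2_norm M (\<lambda>\<omega>. U \<omega> + (V \<omega> + S \<omega>)))\<^sup>2 + (1 + 1 / (\<eta> * h)) * (L2_norm M D)\<^sup>2"
    unfolding eq by (rule L2_norm_add_Young[OF in_L2_add[OF UL VS] D(1) \<eta>h])
  also have "\<dots> \<le> (1 + \<eta> * h) * ((1 - h * \<alpha>) * E + (1 + 1 / \<eta>) * (h * \<theta>\<^sup>2)) + (1 + 1 / (\<eta> * h)) * (h\<^sup>2 * \<theta>\<^sup>2)"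
    using \<eta>h by (intro add_mono mult_left_mono UVS norm_D) auto
  also have "\<dots> = (1 + \<eta> * h) * (1 - h * \<alpha>) * E + h * \<theta>\<^sup>2 * ((1 + \<eta> * h) * (1 + 1 / \<eta>) + (h + 1 / \<eta>))"
    using h \<eta>_pos by (simp add: power2_eq_square field_simps)
  also have "\<dots> \<le> (1 - h * \<alpha> / 2) * E + h * \<theta>\<^sup>2 * ((1 + \<eta>) * (1 + 1 / \<eta>) + (1 + 1 / \<eta>))"
  proof (intro add_mono mult_right_mono mult_left_mono E0)
    have "0 \<le> \<eta> * h * (h * \<alpha>)"
      using \<eta>_pos h \<alpha>_pos by simp
    moreover have "\<eta> * h \<le> \<alpha> / 2 * h"
      using \<eta>_le(1) h by (intro mult_right_mono) auto
    ultimately show "(1 + \<eta> * h) * (1 - h * \<alpha>) \<le> 1 - h * \<alpha> / 2"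
      by (simp add: algebra_simps)
  qed (use max_step_le(1)[OF h(2)] h \<eta>_pos in \<open>auto simp: mult_le_cancel_left1\<close>)
  also have "h * \<theta>\<^sup>2 * ((1 + \<eta>) * (1 + 1 / \<eta>) + (1 + 1 / \<eta>)) = h * \<alpha> / 2 * (stab_c * \<theta>\<^sup>2)"
    using \<alpha>_pos by (simp add: stab_c_def field_simps)
  finally show ?thesis
    by (simp add: E_def e_def[abs_def])
qed

definition em_path :: "real \<Rightarrow> real \<Rightarrow> (nat \<Rightarrow> 'w \<Rightarrow> real ^ 'm) \<Rightarrow> bool" where
  "em_path s h y \<longleftrightarrow> L2F s (y 0) \<and> (\<forall>i. y (Suc i) = em_step (s + real i * h) h (y i))"

lemma em_path_L2F:
  assumes "em_path s h y" "0 < h"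
  shows "L2F (s + real i * h) (y i)"
proof (induction i)
  case (Suc i)
  from L2F_em_step[OF this assms(2)] show ?case
    using assms(1) by (simp add: em_path_def algebra_simps)
qed (use assms in \<open>simp add: em_path_def\<close>)

text \<open>A path begun earlier can thus be compared, from a later starting time on, with a path
  begun there.\<close>

lemma em_path_shift:
  assumes "em_path s h y" "0 < h"
  shows "em_path (s + real k * h) h (\<lambda>i. y (k + i))"
  using assms(1) em_path_L2F[OF assms, of k] by (simp add: em_path_def algebra_simps)

lemma em_path_stable:
  assumes h: "0 < h" "h \<le> max_step" and y: "em_path s h y"
    and x: "\<And>i. i \<le> n \<Longrightarrow> L2F (s + real i * h) (x i)"
    and D: "\<And>i. i < n \<Longrightarrow> in_L2 M (D i)" "\<And>i. i < n \<Longrightarrow> L2_norm M (D i) \<le> h * \<theta>"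
    and S: "\<And>i. i < n \<Longrightarrow> in_L2 M (S i)" "\<And>i. i < n \<Longrightarrow> L2_norm M (S i) \<le> sqrt h * \<theta>"
    and orth: "\<And>i Y. i < n \<Longrightarrow> L2F (s + real i * h) Y \<Longrightarrow> expectation (\<lambda>\<omega>. Y \<omega> \<bullet> S i \<omega>) = 0"
    and step: "\<And>i \<omega>. i < n \<Longrightarrow> x (Suc i) \<omega> = em_step (s + real i * h) h (x i) \<omega> + D i \<omega> + S i \<omega>"
    and "i \<le> n"
  shows "(L2_norm M (\<lambda>\<omega>. x i \<omega> - y i \<omega>))\<^sup>2
    \<le> (1 - h * \<alpha> / 2) ^ i * (L2_norm M (\<lambda>\<omega>. x 0 \<omega> - y 0 \<omega>))\<^sup>2 + stab_c * \<theta>\<^sup>2"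
proof (rule affine_recursion_le[where n=n and a="\<lambda>i. (L2_norm M (\<lambda>\<omega>. x i \<omega> - y i \<omega>))\<^sup>2"])
  fix i assume "i < n"
  then show "(L2_norm M (\<lambda>\<omega>. x (Suc i) \<omega> - y (Suc i) \<omega>))\<^sup>2
    \<le> (1 - h * \<alpha> / 2) * (L2_norm M (\<lambda>\<omega>. x i \<omega> - y i \<omega>))\<^sup>2 + h * \<alpha> / 2 * (stab_c * \<theta>\<^sup>2)"
    using y em_path_L2F[OF y h(1), of i] D S orth step x
    by (intro em_step_stable[where s="s + real i * h" and D="D i" and S="S i"] h) (auto simp: em_path_def)
qed (use h \<alpha>_pos max_step_le(3)[OF h(2)] stab_c_nonneg \<open>i \<le> n\<close> in auto)

text \<open>The factor \<open>1 - h * \<alpha> / 2\<close> is at most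
  \<open>exp (- (h * \<alpha> / 2))\<close>, so the decay depends on the elapsed time and not on the
  step; taking the square root halves the rate to \<open>\<alpha> / 4\<close>. Independence of the
  step lets the estimate pass to solutions.\<close>

lemma em_path_contraction:
  assumes h: "0 < h" "h \<le> max_step" and x: "em_path s h x" and y: "em_path s h y" and i: "T \<le> real i * h"
  shows "L2_norm M (\<lambda>\<omega>. x i \<omega> - y i \<omega>) \<le> exp (- (\<alpha> * T / 4)) * L2_norm M (\<lambda>\<omega>. x 0 \<omega> - y 0 \<omega>)"
proof (rule power2_le_imp_le)
  have "(L2_norm M (\<lambda>\<omega>. x i \<omega> - y i \<omega>))\<^sup>2
    \<le> (1 - h * \<alpha> / 2) ^ i * (L2_norm M (\<lambda>\<omega>. x 0 \<omega> - y 0 \<omega>))\<^sup>2 + stab_c * 0\<^sup>2"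
    using x em_path_L2F[OF x h(1)]
    by (intro em_path_stable[where D="\<lambda>_ _. 0" and S="\<lambda>_ _. 0" and s=s and n=i] h y) (auto simp: em_path_def)
  also have "\<dots> \<le> exp (- (\<alpha> * T / 2)) * (L2_norm M (\<lambda>\<omega>. x 0 \<omega> - y 0 \<omega>))\<^sup>2"
  proof -
    have "(1 - h * \<alpha> / 2) ^ i \<le> exp (- (h * \<alpha> / 2)) ^ i"
      using exp_ge_add_one_self[of "- (h * \<alpha> / 2)"] max_step_le(3)[OF h(2)] h by (intro power_mono) auto
    also have "\<dots> = exp (- (\<alpha> * (real i * h) / 2))"
      by (simp add: exp_of_nat_mult[symmetric] algebra_simps)
    also have "\<dots> \<le> exp (- (\<alpha> * T / 2))"
      using i \<alpha>_pos by simp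
    finally show ?thesis
      by (simp add: mult_right_mono)
  qed
  also have "\<dots> = (exp (- (\<alpha> * T / 4)) * L2_norm M (\<lambda>\<omega>. x 0 \<omega> - y 0 \<omega>))\<^sup>2"
    by (simp add: power_mult_distrib exp_double[symmetric])
  finally show "(L2_norm M (\<lambda>\<omega>. x i \<omega> - y i \<omega>))\<^sup>2 \<le> (exp (- (\<alpha> * T / 4)) * L2_norm M (\<lambda>\<omega>. x 0 \<omega> - y 0 \<omega>))\<^sup>2" .
qed simp

text \<open>The zero process is a perturbed path of the scheme, with defect \<open>- h f(t, 0) - g(t, 0) \<Delta>W\<close>.\<close>

lemma em_path_bounded:
  assumes h: "0 < h" "h \<le> max_step" and y: "em_path s h y" and K: "L2_norm M (y 0) \<le> K"
  shows "L2_norm M (y i) \<le> sqrt (K\<^sup>2 + stab_c * zero_bound\<^sup>2)"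
proof -
  have "(L2_norm M (\<lambda>\<omega>. 0 - y i \<omega>))\<^sup>2 \<le> (1 - h * \<alpha> / 2) ^ i * (L2_norm M (\<lambda>\<omega>. 0 - y 0 \<omega>))\<^sup>2 + stab_c * zero_bound\<^sup>2"
  proof (rule em_path_stable[where D="\<lambda>j \<omega>. - h *\<^sub>R f (s + real j * h) 0" and n=i and s=s and x="\<lambda>_ _. 0"
        and S="\<lambda>j \<omega>. (- g (s + real j * h) 0) *v (W (s + real j * h + h) \<omega> - W (s + real j * h) \<omega>)", OF h y])
    fix j
    let ?t = "s + real j * h"
    have G: "L2F ?t (\<lambda>\<omega>. - g ?t 0)"
      by (simp add: L2F_def in_L2_const)
    show "L2F ?t (\<lambda>_. 0)"
      by (rule L2F_zero)
    show "in_L2 M (\<lambda>\<omega>. - h *\<^sub>R f ?t 0)"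
      by (rule in_L2_const)
    show "L2_norm M (\<lambda>\<omega>. - h *\<^sub>R f ?t 0) \<le> h * zero_bound"
      using f_zero_le[of ?t] h by (simp add: L2_norm_const)
    show "in_L2 M (\<lambda>\<omega>. (- g ?t 0) *v (W (?t + h) \<omega> - W ?t \<omega>))"
      using h by (intro in_L2_increment G) simp
    show "L2_norm M (\<lambda>\<omega>. (- g ?t 0) *v (W (?t + h) \<omega> - W ?t \<omega>)) \<le> sqrt h * zero_bound"
      using L2_norm_increment[OF _ G, of "?t + h"] h g_zero_le[of ?t] by (simp add: L2_norm_const)
    show "expectation (\<lambda>\<omega>. Y \<omega> \<bullet> ((- g ?t 0) *v (W (?t + h) \<omega> - W ?t \<omega>))) = 0" if "L2F ?t Y" for Y
      using h by (intro increment_orthogonal G that) simp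
    show "0 = em_step ?t h (\<lambda>_. 0) \<omega> + - h *\<^sub>R f ?t 0 + (- g ?t 0) *v (W (?t + h) \<omega> - W ?t \<omega>)" for \<omega>
      by (simp add: em_step_def b_def flip: matrix_vector_mult_add_rdistrib)
  qed simp
  also have "\<dots> \<le> 1 * K\<^sup>2 + stab_c * zero_bound\<^sup>2"
    using K max_step_le(3)[OF h(2)] h \<alpha>_pos zero_bound_nonneg stab_c_nonneg L2_norm_minus_commute[of M "\<lambda>_. 0" "y 0"]
    by (intro add_mono mult_mono power_le_one power_mono) auto
  finally show ?thesis
    using L2_norm_minus_commute[of M "\<lambda>_. 0" "y i"] by (simp add: real_le_rsqrt)
qed

end

section \<open>Strong convergence of the Euler--Maruyama scheme\<close>

text \<open>Cauchy-Schwarz against the indicator of the interval, stated in \<open>ennreal\<close>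
  because square-integrability of \<open>\<psi>\<close> is not known at this stage.\<close>

lemma norm_set_integral_power2_le:
  fixes \<psi> :: "real \<Rightarrow> 'a::euclidean_space"
  assumes "a \<le> c" and int: "set_integrable lborel {a..c} \<psi>"
  shows "ennreal ((norm (LINT s:{a..c}|lborel. \<psi> s))\<^sup>2)
    \<le> ennreal (c - a) * (\<integral>\<^sup>+s. ennreal ((norm (indicator {a..c} s *\<^sub>R \<psi> s))\<^sup>2) \<partial>lborel)"
proof -
  let ?u = "\<lambda>s. indicator {a..c} s *\<^sub>R \<psi> s"
  have [measurable]: "?u \<in> borel_measurable lborel"
    using int unfolding set_integrable_def by (rule borel_measurable_integrable)
  have "ennreal (norm (LINT s:{a..c}|lborel. \<psi> s)) \<le> (\<integral>\<^sup>+s. ennreal (norm (?u s)) \<partial>lborel)"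
    using int unfolding set_integrable_def set_lebesgue_integral_def by (rule integral_norm_bound_ennreal)
  also have "\<dots> = (\<integral>\<^sup>+s. indicator {a..c} s * ennreal (norm (?u s)) \<partial>lborel)"
    by (intro nn_integral_cong) (auto simp: indicator_def)
  finally have "ennreal ((norm (LINT s:{a..c}|lborel. \<psi> s))\<^sup>2) \<le> (\<integral>\<^sup>+s. indicator {a..c} s * ennreal (norm (?u s)) \<partial>lborel)\<^sup>2"
    by (simp add: power_mono flip: ennreal_power)
  also have "\<dots> \<le> (\<integral>\<^sup>+s. (indicator {a..c} s)\<^sup>2 \<partial>lborel) * (\<integral>\<^sup>+s. (ennreal (norm (?u s)))\<^sup>2 \<partial>lborel)"
    by (rule Cauchy_Schwarz_nn_integral) measurable
  also have "(\<integral>\<^sup>+s. (indicator {a..c} s)\<^sup>2 \<partial>lborel) = ennreal (c - a)"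
  proof -
    have "(\<integral>\<^sup>+s. (indicator {a..c} s :: ennreal)\<^sup>2 \<partial>lborel) = (\<integral>\<^sup>+s. indicator {a..c} s \<partial>lborel)"
      by (intro nn_integral_cong) (auto simp: indicator_def)
    then show ?thesis
      using assms(1) by simp
  qed
  finally show ?thesis
    by (simp add: ennreal_power)
qed

text \<open>Pathwise Cauchy-Schwarz followed by an exchange of the integrals. The time integral
  appears only in an almost sure identity, so measurability in \<open>\<omega>\<close> is carried by
  \<open>D\<close>.\<close>

lemma (in wiener_space) L2_norm_time_integral_le:
  fixes \<psi> :: "real \<Rightarrow> 'w \<Rightarrow> 'a::euclidean_space"
  assumes "a \<le> c" and D: "D \<in> borel_measurable M"
    and int: "AE \<omega> in M. set_integrable lborel {a..c} (\<lambda>s. \<psi> s \<omega>)"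
    and eq: "AE \<omega> in M. D \<omega> = (LINT s:{a..c}|lborel. \<psi> s \<omega>)"
    and m: "(\<lambda>x. indicator {a..c} (fst x) *\<^sub>R \<psi> (fst x) (snd x)) \<in> borel_measurable PM"
    and le: "(\<integral>\<^sup>+s. (\<integral>\<^sup>+\<omega>. ennreal ((norm (indicator {a..c} s *\<^sub>R \<psi> s \<omega>))\<^sup>2) \<partial>M) \<partial>lborel) \<le> ennreal B"
    and B: "(c - a) * B \<le> \<theta>\<^sup>2" "0 \<le> \<theta>" "0 \<le> B"
  shows "in_L2 M D" "L2_norm M D \<le> \<theta>"
proof -
  define u where "u x = indicator {a..c} (fst x) *\<^sub>R \<psi> (fst x) (snd x)" for x
  have [measurable]: "u \<in> borel_measurable PM"
    using m unfolding u_def[abs_def] .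
  have "(\<integral>\<^sup>+\<omega>. ennreal ((norm (D \<omega>))\<^sup>2) \<partial>M) \<le> (\<integral>\<^sup>+\<omega>. ennreal (c - a) * (\<integral>\<^sup>+s. ennreal ((norm (u (s, \<omega>)))\<^sup>2) \<partial>lborel) \<partial>M)"
  proof (rule nn_integral_mono_AE, use int eq in eventually_elim)
    case (elim \<omega>)
    then show ?case
      using norm_set_integral_power2_le[OF assms(1) elim(1)] by (simp add: u_def)
  qed
  also have "\<dots> = ennreal (c - a) * (\<integral>\<^sup>+\<omega>. (\<integral>\<^sup>+s. ennreal ((norm (u (s, \<omega>)))\<^sup>2) \<partial>lborel) \<partial>M)"
    by (rule nn_integral_cmult) measurable
  also have "(\<integral>\<^sup>+\<omega>. (\<integral>\<^sup>+s. ennreal ((norm (u (s, \<omega>)))\<^sup>2) \<partial>lborel) \<partial>M) = (\<integral>\<^sup>+s. (\<integral>\<^sup>+\<omega>. ennreal ((norm (u (s, \<omega>)))\<^sup>2) \<partial>M) \<partial>lborel)"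
    by (rule pair.Fubini') measurable
  also have "\<dots> \<le> ennreal B"
    using le by (simp add: u_def)
  also have "ennreal (c - a) * ennreal B \<le> ennreal (\<theta>\<^sup>2)"
    using B assms(1) by (simp add: ennreal_mult[symmetric] ennreal_leI)
  finally have "(\<integral>\<^sup>+\<omega>. ennreal ((norm (D \<omega>))\<^sup>2) \<partial>M) \<le> ennreal (\<theta>\<^sup>2)"
    by (simp add: mult_left_mono)
  from in_L2_nn_integral_leI[OF D this B(2)] show "in_L2 M D" "L2_norm M D \<le> \<theta>"
    by auto
qed

section \<open>Moments of a solution and its distance to the scheme\<close>

context dissipative_sde
begin

text \<open>A version of the Ito integral of \<open>g s (X s)\<close> from \<open>t0\<close> to
  \<open>t\<close>, read off the integral equation.\<close>

definition stoch :: "real \<Rightarrow> ('w \<Rightarrow> real ^ 'm) \<Rightarrow> (real \<Rightarrow> 'w \<Rightarrow> real ^ 'm) \<Rightarrow> real \<Rightarrow> 'w \<Rightarrow> real ^ 'm" where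
  "stoch t0 \<xi> X t \<omega> = X t \<omega> - \<xi> \<omega> - (LINT s:{t0..t}|lborel. A *v X s \<omega> + f s (X s \<omega>))"

context
  fixes t0 :: real and \<xi> :: "'w \<Rightarrow> real ^ 'm" and X :: "real \<Rightarrow> 'w \<Rightarrow> real ^ 'm"
  assumes sol: "sde_solution M W A f g t0 \<xi> X"
    and \<xi>: "in_L2 M \<xi>"
begin

lemma X_F: "t0 \<le> t \<Longrightarrow> X t \<in> borel_measurable (F t)"
  using sol by (simp add: sde_solution_def)

lemma X_M: "t0 \<le> t \<Longrightarrow> X t \<in> borel_measurable M"
  using X_F F_measurable_imp_measurable by blast

lemma X_initial: "AE \<omega> in M. X t0 \<omega> = \<xi> \<omega>"
  using sol by (simp add: sde_solution_def)

lemma stoch_ito: "t0 \<le> t \<Longrightarrow> has_ito_integral M F W t0 t (\<lambda>s \<omega>. g s (X s \<omega>)) (stoch t0 \<xi> X t)"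
  using sol by (simp add: sde_solution_def stoch_def[abs_def])

lemma stoch_in_L2: "t0 \<le> t \<Longrightarrow> in_L2 M (stoch t0 \<xi> X t)"
  using stoch_ito[of t] unfolding has_ito_integral_def L2_limit_def by blast

lemma X_measurable_pair:
  "(\<lambda>x. indicator {t0..} (fst x) *\<^sub>R X (fst x) (snd x)) \<in> borel_measurable PM"
  using sol by (simp add: sde_solution_def case_prod_beta')

text \<open>Joint measurability of \<open>X\<close> is given after cutting off at \<open>t0\<close>;
  since \<open>t0 \<le> a\<close>, the cut-off inside the drift is invisible under the outer
  indicator.\<close>

lemma drift_measurable_pair:
  assumes "t0 \<le> a" "Y \<in> borel_measurable M"
  shows "(\<lambda>x. indicator {a..c} (fst x) *\<^sub>R (b (fst x) (X (fst x) (snd x)) - Y (snd x))) \<in> borel_measurable PM"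
proof -
  have [measurable]: "Y \<in> borel_measurable M" by fact
  note [measurable] = X_measurable_pair
  have "(\<lambda>x. indicator {a..c} (fst x) *\<^sub>R (b (fst x) (indicator {t0..} (fst x) *\<^sub>R X (fst x) (snd x)) - Y (snd x)))
      \<in> borel_measurable PM"
    by measurable
  moreover have "indicator {a..c} (fst x) *\<^sub>R (b (fst x) (indicator {t0..} (fst x) *\<^sub>R X (fst x) (snd x)) - Y (snd x))
      = indicator {a..c} (fst x) *\<^sub>R (b (fst x) (X (fst x) (snd x)) - Y (snd x))" for x :: "real \<times> 'w"
    using assms(1) by (auto simp: indicator_def)
  ultimately show ?thesis
    by simp
qed

lemma drift_integrable:
  assumes "t0 \<le> a"
  shows "AE \<omega> in M. set_integrable lborel {a..c} (\<lambda>s. b s (X s \<omega>))"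
proof -
  have "AE \<omega> in M. continuous_on {t0..} (\<lambda>t. X t \<omega>)"
    using sol by (simp add: sde_solution_def)
  then show ?thesis
  proof eventually_elim
    case (elim \<omega>)
    have "continuous_on {t0..} (\<lambda>s. (\<lambda>p. b (fst p) (snd p)) (s, X s \<omega>))"
      by (rule continuous_on_compose2[OF b_continuous]) (auto intro!: continuous_intros elim)
    then have "continuous_on {a..c} (\<lambda>s. b s (X s \<omega>))"
      using assms by (auto intro: continuous_on_subset)
    then show ?case
      by (rule borel_integrable_atLeastAtMost')
  qed
qed

lemma drift_increment:
  assumes "t0 \<le> a" "a \<le> c"
  shows "AE \<omega> in M. X c \<omega> - X a \<omega> - (stoch t0 \<xi> X c \<omega> - stoch t0 \<xi> X a \<omega>) = (LINT s:{a..c}|lborel. b s (X s \<omega>))"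
  using drift_integrable[OF order_refl, of a] drift_integrable[OF assms(1), of c]
proof eventually_elim
  case (elim \<omega>)
  have "(LINT s:{t0..c}|lborel. b s (X s \<omega>)) = (LINT s:{t0..a} \<union> {a..c}|lborel. b s (X s \<omega>))"
    using assms by (simp add: ivl_disj_un_two_touch)
  also have "\<dots> = (LINT s:{t0..a}|lborel. b s (X s \<omega>)) + (LINT s:{a..c}|lborel. b s (X s \<omega>))"
  proof (rule set_integral_Un_AE[OF _ _ _ elim])
    have "AE s in lborel. s \<noteq> a"
      by (rule AE_lborel_singleton)
    then show "AE s in lborel. \<not> (s \<in> {t0..a} \<and> s \<in> {a..c})"
      by eventually_elim auto
  qed auto
  finally show ?case
    by (simp add: stoch_def b_def)
qed

text \<open>The definition of a solution bounds only the time integral of the second moment. Linear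
  growth turns this into a bound for the drift integral, and the isometry bounds the stochastic
  integral. The result depends on \<open>X\<close> and \<open>T\<close>;
  \<open>solution_bounded\<close> replaces it by a uniform one.\<close>

lemma X_L2_bound:
  obtains B where "\<And>t. t0 \<le> t \<Longrightarrow> t \<le> T \<Longrightarrow> L2F t (X t) \<and> L2_norm M (X t) \<le> B"
proof (cases "t0 \<le> T")
  case False
  then show thesis
    using that[of 0] by auto
next
  case True
  define T' where "T' = T - t0"
  have T': "0 \<le> T'"
    using True by (simp add: T'_def)
  have fin: "(\<integral>\<^sup>+\<omega>. (\<integral>\<^sup>+s\<in>{t0..T}. ennreal ((norm (X s \<omega>))\<^sup>2) \<partial>lborel) \<partial>M) < \<infinity>"
    using sol True by (simp add: sde_solution_def)
  define u where "u x = indicator {t0..} (fst x) *\<^sub>R X (fst x) (snd x)" for x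
  have [measurable]: "u \<in> borel_measurable PM"
    unfolding u_def[abs_def] by (rule X_measurable_pair)
  have "(\<integral>\<^sup>+s. (\<integral>\<^sup>+\<omega>. indicator {t0..T} s * ennreal ((norm (u (s, \<omega>)))\<^sup>2) \<partial>M) \<partial>lborel)
      = (\<integral>\<^sup>+\<omega>. (\<integral>\<^sup>+s. indicator {t0..T} s * ennreal ((norm (u (s, \<omega>)))\<^sup>2) \<partial>lborel) \<partial>M)"
    by (rule pair.Fubini'[symmetric]) measurable
  also have "\<dots> = (\<integral>\<^sup>+\<omega>. (\<integral>\<^sup>+s\<in>{t0..T}. ennreal ((norm (X s \<omega>))\<^sup>2) \<partial>lborel) \<partial>M)"
    by (intro nn_integral_cong) (auto simp: indicator_def u_def)
  finally have "(\<integral>\<^sup>+s. (\<integral>\<^sup>+\<omega>. indicator {t0..T} s * ennreal ((norm (u (s, \<omega>)))\<^sup>2) \<partial>M) \<partial>lborel) < top"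
    using fin by simp
  define R where "R = enn2real (\<integral>\<^sup>+s. (\<integral>\<^sup>+\<omega>. indicator {t0..T} s * ennreal ((norm (u (s, \<omega>)))\<^sup>2) \<partial>M) \<partial>lborel)"
  have R: "0 \<le> R"
    "(\<integral>\<^sup>+s. (\<integral>\<^sup>+\<omega>. indicator {t0..T} s * ennreal ((norm (u (s, \<omega>)))\<^sup>2) \<partial>M) \<partial>lborel) = ennreal R"
    using \<open>_ < top\<close> by (simp_all add: R_def)
  \<comment> \<open>Bounds the time integral of the second moment of the drift, by linear growth and
    (p + q)^2 \<le> 2 p^2 + 2 q^2.\<close>
  define Q where "Q = 2 * zero_bound\<^sup>2 * T' + 2 * L\<^sup>2 * R"
  have Q: "0 \<le> Q"
    using T' R by (simp add: Q_def)
  define J where "J t \<omega> = X t \<omega> - \<xi> \<omega> - stoch t0 \<xi> X t \<omega>" for t \<omega>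
  have Jb: "in_L2 M (J t) \<and> L2_norm M (J t) \<le> sqrt (T' * Q)" if t: "t0 \<le> t" "t \<le> T" for t
  proof -
    note [measurable] = X_M[OF t(1)] in_L2_measurable[OF \<xi>] in_L2_measurable[OF stoch_in_L2[OF t(1)]]
    have J: "J t \<in> borel_measurable M"
      unfolding J_def[abs_def] by measurable
    have eq: "AE \<omega> in M. J t \<omega> = (LINT s:{t0..t}|lborel. b s (X s \<omega>))"
      by (simp add: J_def stoch_def b_def)
    have m: "(\<lambda>x. indicator {t0..t} (fst x) *\<^sub>R b (fst x) (X (fst x) (snd x))) \<in> borel_measurable PM"
      using drift_measurable_pair[OF order_refl, of "\<lambda>_. 0" t] by simp
    have "(\<integral>\<^sup>+s. (\<integral>\<^sup>+\<omega>. ennreal ((norm (indicator {t0..t} s *\<^sub>R b s (X s \<omega>)))\<^sup>2) \<partial>M) \<partial>lborel)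
        \<le> (\<integral>\<^sup>+s. (\<integral>\<^sup>+\<omega>. ennreal (2 * zero_bound\<^sup>2) * indicator {t0..T} s + ennreal (2 * L\<^sup>2) * (indicator {t0..T} s * ennreal ((norm (u (s, \<omega>)))\<^sup>2)) \<partial>M) \<partial>lborel)"
    proof (intro nn_integral_mono)
      fix s \<omega>
      have "(norm (b s x))\<^sup>2 \<le> 2 * zero_bound\<^sup>2 + 2 * L\<^sup>2 * (norm x)\<^sup>2" for x
      proof -
        have "(norm (b s x))\<^sup>2 \<le> (zero_bound + L * norm x)\<^sup>2"
          by (intro power_mono b_growth) auto
        also have "\<dots> \<le> 2 * zero_bound\<^sup>2 + 2 * L\<^sup>2 * (norm x)\<^sup>2"
          using square_add_le_Young[of 1 zero_bound "L * norm x"] by (simp add: power_mult_distrib)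
        finally show ?thesis .
      qed
      then have "ennreal ((norm (b s (X s \<omega>)))\<^sup>2) \<le> ennreal (2 * zero_bound\<^sup>2 + 2 * L\<^sup>2 * (norm (X s \<omega>))\<^sup>2)"
        by (rule ennreal_leI)
      also have "\<dots> = ennreal (2 * zero_bound\<^sup>2) + ennreal (2 * L\<^sup>2) * ennreal ((norm (X s \<omega>))\<^sup>2)"
        by (subst ennreal_plus) (auto simp: ennreal_mult)
      finally show "ennreal ((norm (indicator {t0..t} s *\<^sub>R b s (X s \<omega>)))\<^sup>2)
          \<le> ennreal (2 * zero_bound\<^sup>2) * indicator {t0..T} s + ennreal (2 * L\<^sup>2) * (indicator {t0..T} s * ennreal ((norm (u (s, \<omega>)))\<^sup>2))"
        using t by (auto simp: indicator_def u_def)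
    qed
    also have "\<dots> = (\<integral>\<^sup>+s. ennreal (2 * zero_bound\<^sup>2) * indicator {t0..T} s \<partial>lborel) + ennreal (2 * L\<^sup>2) * ennreal R"
      unfolding R(2)[symmetric]
      by (subst nn_integral_add, measurable)
        (subst nn_integral_cmult, measurable, simp add: emeasure_space_1 nn_integral_add nn_integral_cmult)
    also have "\<dots> = ennreal Q"
      using R(1) T' True zero_bound_nonneg
      by (simp add: nn_integral_cmult_indicator Q_def T'_def ennreal_mult ennreal_plus)
    finally have le: "(\<integral>\<^sup>+s. (\<integral>\<^sup>+\<omega>. ennreal ((norm (indicator {t0..t} s *\<^sub>R b s (X s \<omega>)))\<^sup>2) \<partial>M) \<partial>lborel) \<le> ennreal Q" .
    have "(t - t0) * Q \<le> (sqrt (T' * Q))\<^sup>2"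
      using t Q T' by (auto simp: T'_def intro: mult_right_mono)
    from L2_norm_time_integral_le[OF t(1) J drift_integrable[OF order_refl] eq m le this _ Q] T' Q
    show ?thesis by auto
  qed
  \<comment> \<open>By the isometry, the integrand on the longest interval \<open>{t0..T}\<close>
    dominates the stochastic integrals up to all earlier times.\<close>
  define I where "I = L2_norm PM (\<lambda>(s, \<omega>). indicator {t0..T} s *\<^sub>R g s (X s \<omega>))"
  have Ib: "L2_norm M (stoch t0 \<xi> X t) \<le> I" if t: "t0 \<le> t" "t \<le> T" for t
  proof -
    note i1 = has_ito_integral_imp_ito[OF stoch_ito[OF t(1)]]
    note i2 = has_ito_integral_imp_ito[OF stoch_ito[OF True]]
    show ?thesis
      unfolding ito_isometry[OF i1] I_def
      by (rule L2_norm_mono[OF ito_in_L2(1)[OF i2] in_L2_measurable[OF ito_in_L2(1)[OF i1]]])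
        (use t in \<open>auto simp: indicator_def\<close>)
  qed
  show thesis
  proof (rule that)
    fix t assume t: "t0 \<le> t" "t \<le> T"
    have X: "X t = (\<lambda>\<omega>. (\<xi> \<omega> + J t \<omega>) + stoch t0 \<xi> X t \<omega>)"
      by (simp add: J_def fun_eq_iff)
    note L = \<xi> conjunct1[OF Jb[OF t]] stoch_in_L2[OF t(1)]
    have "in_L2 M (X t)"
      by (subst X) (intro in_L2_add L)
    moreover have "L2_norm M (X t) \<le> (L2_norm M \<xi> + sqrt (T' * Q)) + I"
      by (subst X) (intro order_trans[OF L2_norm_triangle] order_trans[OF L2_norm_triangle] add_mono in_L2_add L
          conjunct2[OF Jb[OF t]] Ib[OF t] order_refl)
    ultimately show "L2F t (X t) \<and> L2_norm M (X t) \<le> (L2_norm M \<xi> + sqrt (T' * Q)) + I"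
      using X_F[OF t(1)] by (simp add: L2F_def)
  qed
qed

lemma X_L2F: "t0 \<le> t \<Longrightarrow> L2F t (X t)"
  using X_L2_bound[of t] by blast

text \<open>\<open>incr_bound B\<close> bounds the increments of a solution whose norms are at most \<open>B\<close>, relative to the
  square root of the time step; \<open>step_defect B\<close> does so for the one-step defects of the scheme.\<close>

definition incr_bound :: "real \<Rightarrow> real" where "incr_bound B = 2 * zero_bound + (L + \<beta>2) * B"

definition step_defect :: "real \<Rightarrow> real" where "step_defect B = C0 + (L + \<beta>2) * incr_bound B"

text \<open>Serves twice: with \<open>Y = 0\<close> for the drift part of an increment, and with
  \<open>Y\<close> the drift at the left endpoint for the drift defect of a step.\<close>

lemma drift_defect_le:
  assumes "t0 \<le> a" "a \<le> c" and Y: "in_L2 M Y" and "0 \<le> \<theta>"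
    and le: "\<And>s. a \<le> s \<Longrightarrow> s \<le> c \<Longrightarrow> L2_norm M (\<lambda>\<omega>. b s (X s \<omega>) - Y \<omega>) \<le> \<theta>"
  shows "in_L2 M (\<lambda>\<omega>. X c \<omega> - X a \<omega> - (stoch t0 \<xi> X c \<omega> - stoch t0 \<xi> X a \<omega>) - (c - a) *\<^sub>R Y \<omega>)" (is "in_L2 M ?D")
    and "L2_norm M (\<lambda>\<omega>. X c \<omega> - X a \<omega> - (stoch t0 \<xi> X c \<omega> - stoch t0 \<xi> X a \<omega>) - (c - a) *\<^sub>R Y \<omega>) \<le> (c - a) * \<theta>"
proof -
  let ?\<psi> = "\<lambda>s \<omega>. b s (X s \<omega>) - Y \<omega>"
  note [measurable] = X_M[OF assms(1)] X_M[OF order_trans[OF assms(1,2)]] in_L2_measurable[OF Y]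
    in_L2_measurable[OF stoch_in_L2[OF assms(1)]] in_L2_measurable[OF stoch_in_L2[OF order_trans[OF assms(1,2)]]]
  have D: "?D \<in> borel_measurable M"
    by measurable
  have const: "set_integrable lborel {a..c} (\<lambda>s. Y \<omega>)" for \<omega>
    by (rule borel_integrable_atLeastAtMost') simp
  have int: "AE \<omega> in M. set_integrable lborel {a..c} (\<lambda>s. ?\<psi> s \<omega>)"
    using drift_integrable[OF assms(1), of c] by eventually_elim (intro set_integral_diff const)
  have eq: "AE \<omega> in M. ?D \<omega> = (LINT s:{a..c}|lborel. ?\<psi> s \<omega>)"
    using drift_increment[OF assms(1,2)] drift_integrable[OF assms(1), of c]
  proof eventually_elim
    case (elim \<omega>)
    have "(LINT s:{a..c}|lborel. Y \<omega>) = (c - a) *\<^sub>R Y \<omega>"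
      using assms(2) by (simp add: set_lebesgue_integral_def)
    with set_integral_diff(2)[OF elim(2) const] elim(1) show ?case
      by simp
  qed
  have "(\<integral>\<^sup>+s. (\<integral>\<^sup>+\<omega>. ennreal ((norm (indicator {a..c} s *\<^sub>R ?\<psi> s \<omega>))\<^sup>2) \<partial>M) \<partial>lborel)
      \<le> (\<integral>\<^sup>+s. ennreal (\<theta>\<^sup>2) * indicator {a..c} s \<partial>lborel)"
  proof (intro nn_integral_mono)
    fix s
    show "(\<integral>\<^sup>+\<omega>. ennreal ((norm (indicator {a..c} s *\<^sub>R ?\<psi> s \<omega>))\<^sup>2) \<partial>M) \<le> ennreal (\<theta>\<^sup>2) * indicator {a..c} s"
    proof (cases "s \<in> {a..c}")
      case True
      then have "in_L2 M (\<lambda>\<omega>. b s (X s \<omega>) - Y \<omega>)"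
        using assms(1) by (intro in_L2_diff Y L2F_in_L2[OF L2F_coefficients(3)[OF X_L2F]]) auto
      from nn_integral_L2_le[OF this le[of s]] True show ?thesis
        by simp
    qed simp
  qed
  also have "\<dots> = ennreal (\<theta>\<^sup>2 * (c - a))"
    using assms(2) by (simp add: nn_integral_cmult_indicator ennreal_mult)
  finally have le': "(\<integral>\<^sup>+s. (\<integral>\<^sup>+\<omega>. ennreal ((norm (indicator {a..c} s *\<^sub>R ?\<psi> s \<omega>))\<^sup>2) \<partial>M) \<partial>lborel) \<le> ennreal (\<theta>\<^sup>2 * (c - a))" .
  have B: "(c - a) * (\<theta>\<^sup>2 * (c - a)) \<le> ((c - a) * \<theta>)\<^sup>2" "0 \<le> (c - a) * \<theta>" "0 \<le> \<theta>\<^sup>2 * (c - a)"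
    using assms(2,4) by (simp_all add: power2_eq_square)
  from L2_norm_time_integral_le[OF assms(2) D int eq drift_measurable_pair[OF assms(1) in_L2_measurable[OF Y]] le' B]
  show "in_L2 M ?D" "L2_norm M ?D \<le> (c - a) * \<theta>"
    by auto
qed

text \<open>The stochastic part has order sqrt(c - a) by the isometry; the drift part has order c -
  a, which is no larger because the interval has length at most 1.\<close>

lemma X_increment_le:
  assumes "t0 \<le> a" "a \<le> c" "c \<le> a + 1"
    and B: "\<And>t. a \<le> t \<Longrightarrow> t \<le> c \<Longrightarrow> L2_norm M (X t) \<le> B"
  shows "L2_norm M (\<lambda>\<omega>. X c \<omega> - X a \<omega>) \<le> sqrt (c - a) * incr_bound B"
proof -
  have B0: "0 \<le> B"
    using B[of a] assms(2) order_trans[OF L2_norm_nonneg] by blast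
  let ?S = "\<lambda>\<omega>. stoch t0 \<xi> X c \<omega> - stoch t0 \<xi> X a \<omega>"
  let ?D = "\<lambda>\<omega>. X c \<omega> - X a \<omega> - (stoch t0 \<xi> X c \<omega> - stoch t0 \<xi> X a \<omega>)"
  have b: "L2_norm M (\<lambda>\<omega>. b s (X s \<omega>) - 0) \<le> zero_bound + L * B" if "a \<le> s" "s \<le> c" for s
    using L2F_coefficients(6)[OF X_L2F[of s], of s] assms(1) that mult_left_mono[OF B[OF that] less_imp_le[OF L_pos]] by simp
  have cLB: "0 \<le> zero_bound + L * B" "0 \<le> zero_bound + \<beta>2 * B"
    using zero_bound_nonneg L_pos \<beta>2_pos B0 by simp_all
  have D: "in_L2 M ?D" "L2_norm M ?D \<le> (c - a) * (zero_bound + L * B)"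
    using drift_defect_le[OF assms(1,2) in_L2_zero cLB(1) b] by simp_all
  have S: "in_L2 M ?S"
    using assms(1,2) by (intro in_L2_diff stoch_in_L2) auto
  have "L2_norm M (\<lambda>\<omega>. stoch t0 \<xi> X c \<omega> - stoch t0 \<xi> X a \<omega> - 0 *v (W c \<omega> - W a \<omega>)) \<le> (zero_bound + \<beta>2 * B) * sqrt (c - a)"
  proof (rule ito_integral_increment_le[OF stoch_ito stoch_ito assms(1,2) L2F_zero cLB(2)])
    fix s assume s: "a < s" "s < c"
    have "L2_norm M (\<lambda>\<omega>. g s (X s \<omega>)) \<le> zero_bound + \<beta>2 * B"
      using L2F_coefficients(5)[OF X_L2F[of s], of s] assms(1) s mult_left_mono[OF B[of s] less_imp_le[OF \<beta>2_pos]] by simp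
    then show "(\<integral>\<^sup>+\<omega>. ennreal ((norm (g s (X s \<omega>) - 0))\<^sup>2) \<partial>M) \<le> ennreal ((zero_bound + \<beta>2 * B)\<^sup>2)"
      using assms(1) s nn_integral_L2_le[OF L2F_in_L2[OF L2F_coefficients(2)[OF X_L2F[of s]]]] by simp
  qed (use assms(1,2) in auto)
  then have Sb: "L2_norm M ?S \<le> sqrt (c - a) * (zero_bound + \<beta>2 * B)"
    by (simp add: mult.commute)
  have "c - a \<le> sqrt (c - a)"
    using assms(2,3) by (intro real_le_rsqrt) (simp add: power2_eq_square mult_left_le)
  then have Db: "L2_norm M ?D \<le> sqrt (c - a) * (zero_bound + L * B)"
    using D(2) cLB(1) by (meson mult_right_mono order_trans)
  have "L2_norm M (\<lambda>\<omega>. X c \<omega> - X a \<omega>) = L2_norm M (\<lambda>\<omega>. ?D \<omega> + ?S \<omega>)"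
    by simp
  also have "\<dots> \<le> L2_norm M ?D + L2_norm M ?S"
    by (rule L2_norm_triangle[OF D(1) S])
  also have "\<dots> \<le> sqrt (c - a) * incr_bound B"
    using Db Sb by (simp add: incr_bound_def algebra_simps)
  finally show ?thesis .
qed

text \<open>On the grid the solution is a perturbed path of the scheme with
  \<open>\<theta> = sqrt h * step_defect B\<close>. The bound depends on the solution only through
  \<open>B\<close> and does not grow with the elapsed time, so a uniform \<open>B\<close> yields a
  uniform rate. Off the grid, one increment of the solution is added.\<close>

lemma X_em_le:
  assumes h: "0 < h" "h \<le> max_step" and y: "em_path t0 h y" "y 0 = \<xi>"
    and B: "\<And>t. t0 \<le> t \<Longrightarrow> t \<le> T \<Longrightarrow> L2_norm M (X t) \<le> B"
    and t: "t0 \<le> t" "t \<le> T"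
  shows "L2_norm M (\<lambda>\<omega>. X t \<omega> - y (nat \<lfloor>(t - t0) / h\<rfloor>) \<omega>) \<le> sqrt h * (incr_bound B + sqrt stab_c * step_defect B)"
proof -
  define n where "n = nat \<lfloor>(t - t0) / h\<rfloor>"
  define s where "s i = t0 + real i * h" for i
  have h1: "h \<le> 1"
    by (rule max_step_le(1)[OF h(2)])
  have "0 \<le> (t - t0) / h"
    using t h by simp
  then have "real n \<le> (t - t0) / h" "(t - t0) / h < real n + 1"
    unfolding n_def by linarith+
  then have n: "s n \<le> t" "t \<le> s n + h"
    using h by (simp_all add: s_def field_simps)
  have s_Suc: "s (Suc i) = s i + h" for i
    by (simp add: s_def algebra_simps)
  have s0: "t0 \<le> s i" for i
    using h by (simp add: s_def)
  have sn: "s i \<le> s n" if "i \<le> n" for i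
    using that h by (simp add: s_def)
  have B0: "0 \<le> B"
    using B[OF t] order_trans[OF L2_norm_nonneg] by blast
  have inc0: "0 \<le> incr_bound B"
    using B0 zero_bound_nonneg L_pos \<beta>2_pos by (simp add: incr_bound_def)
  have def0: "0 \<le> step_defect B"
    using inc0 C0_pos L_pos \<beta>2_pos by (simp add: step_defect_def)
  have incr: "L2_norm M (\<lambda>\<omega>. X r \<omega> - X (s i) \<omega>) \<le> sqrt h * incr_bound B" if "s i \<le> r" "r \<le> s i + h" "r \<le> T" for i r
  proof -
    have "L2_norm M (\<lambda>\<omega>. X r \<omega> - X (s i) \<omega>) \<le> sqrt (r - s i) * incr_bound B"
      using that s0[of i] h1 by (intro X_increment_le B) auto
    also have "\<dots> \<le> sqrt h * incr_bound B"
      using that inc0 by (intro mult_right_mono) auto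
    finally show ?thesis .
  qed
  define G where "G i \<omega> = g (s i) (X (s i) \<omega>)" for i \<omega>
  define S where "S i \<omega> = stoch t0 \<xi> X (s (Suc i)) \<omega> - stoch t0 \<xi> X (s i) \<omega> - G i \<omega> *v (W (s i + h) \<omega> - W (s i) \<omega>)" for i \<omega>
  define D where "D i \<omega> = X (s (Suc i)) \<omega> - X (s i) \<omega> - (stoch t0 \<xi> X (s (Suc i)) \<omega> - stoch t0 \<xi> X (s i) \<omega>) - h *\<^sub>R b (s i) (X (s i) \<omega>)" for i \<omega>
  have XL: "L2F (s i) (X (s i))" for i
    by (rule X_L2F[OF s0])
  have G: "L2F (s i) (G i)" for i
    unfolding G_def[abs_def] by (rule L2F_coefficients(2)[OF XL])
  \<comment> \<open>Both the Hoelder modulus in time and the increments of the solution have order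
    sqrt h within a step.\<close>
  have coeff: "L2_norm M (\<lambda>\<omega>. b r (X r \<omega>) - b (s i) (X (s i) \<omega>)) \<le> sqrt h * step_defect B \<and>
      L2_norm M (\<lambda>\<omega>. g r (X r \<omega>) - G i \<omega>) \<le> sqrt h * step_defect B"
    if "s i \<le> r" "r \<le> s i + h" "r \<le> T" for i r
  proof -
    have r: "L2F r (X r)"
      using that s0[of i] by (intro X_L2F) auto
    note i = L2F_in_L2[OF r] L2F_in_L2[OF XL[of i]]
    note [measurable] = i[THEN in_L2_measurable]
    have d: "in_L2 M (\<lambda>\<omega>. X r \<omega> - X (s i) \<omega>)"
      by (intro in_L2_diff i)
    have sq: "C0 * sqrt \<bar>r - s i\<bar> \<le> C0 * sqrt h"
      using that C0_pos by simp
    have "L2_norm M (\<lambda>\<omega>. b r (X r \<omega>) - b (s i) (X (s i) \<omega>)) \<le> C0 * sqrt h + L * L2_norm M (\<lambda>\<omega>. X r \<omega> - X (s i) \<omega>)"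
      using C0_pos L_pos h order_trans[OF b_Hoelder add_right_mono[OF sq]]
      by (intro in_L2_affine_bound(2)[OF d]) auto
    moreover have "L2_norm M (\<lambda>\<omega>. g r (X r \<omega>) - G i \<omega>) \<le> C0 * sqrt h + \<beta>2 * L2_norm M (\<lambda>\<omega>. X r \<omega> - X (s i) \<omega>)"
      using C0_pos \<beta>2_pos h order_trans[OF g_Hoelder add_right_mono[OF sq]] unfolding G_def
      by (intro in_L2_affine_bound(2)[OF d]) auto
    moreover have "L * L2_norm M (\<lambda>\<omega>. X r \<omega> - X (s i) \<omega>) \<le> L * (sqrt h * incr_bound B)"
      "\<beta>2 * L2_norm M (\<lambda>\<omega>. X r \<omega> - X (s i) \<omega>) \<le> \<beta>2 * (sqrt h * incr_bound B)"
      using incr[OF that] L_pos \<beta>2_pos by (auto intro!: mult_left_mono)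
    moreover have "0 \<le> L * (sqrt h * incr_bound B)" "0 \<le> \<beta>2 * (sqrt h * incr_bound B)"
      using L_pos \<beta>2_pos h inc0 by simp_all
    ultimately show ?thesis
      by (simp add: step_defect_def algebra_simps)
  qed
  have "(L2_norm M (\<lambda>\<omega>. X (s n) \<omega> - y n \<omega>))\<^sup>2
      \<le> (1 - h * \<alpha> / 2) ^ n * (L2_norm M (\<lambda>\<omega>. X (s 0) \<omega> - y 0 \<omega>))\<^sup>2 + stab_c * (sqrt h * step_defect B)\<^sup>2"
  proof (rule em_path_stable[where x="\<lambda>i. X (s i)" and D=D and S=S and n=n and s=t0, OF h y(1)])
    fix i assume "i < n"
    then have iT: "s i + h \<le> T"
      using sn[of "Suc i"] s_Suc[of i] n t by simp
    have D: "in_L2 M (D i) \<and> L2_norm M (D i) \<le> h * (sqrt h * step_defect B)"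
      using drift_defect_le[OF s0[of i], of "s (Suc i)" "\<lambda>\<omega>. b (s i) (X (s i) \<omega>)" "sqrt h * step_defect B"]
        coeff[of i] h def0 iT L2F_in_L2[OF L2F_coefficients(3)[OF XL[of i]]]
      unfolding D_def[abs_def] by (auto simp: s_Suc)
    then show "in_L2 M (D i)" "L2_norm M (D i) \<le> h * (sqrt h * step_defect B)"
      by auto
    have st: "t0 \<le> s (Suc i)" "s i \<le> s (Suc i)"
      using s0[of "Suc i"] h by (simp_all add: s_Suc)
    have GW: "in_L2 M (\<lambda>\<omega>. G i \<omega> *v (W (s i + h) \<omega> - W (s i) \<omega>))"
      using h by (intro in_L2_increment G) simp
    have SL: "in_L2 M (\<lambda>\<omega>. stoch t0 \<xi> X (s (Suc i)) \<omega> - stoch t0 \<xi> X (s i) \<omega>)"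
      using s0 by (intro in_L2_diff stoch_in_L2) auto
    show "in_L2 M (S i)"
      unfolding S_def[abs_def] by (intro in_L2_diff[OF SL GW])
    have "L2_norm M (S i) \<le> (sqrt h * step_defect B) * sqrt (s (Suc i) - s i)"
      unfolding S_def[abs_def] s_Suc[symmetric]
    proof (rule ito_integral_increment_le[OF stoch_ito[OF s0] stoch_ito[OF s0] s0 st(2) G])
      fix r assume "s i < r" "r < s (Suc i)"
      then have r: "s i \<le> r" "r \<le> s i + h" "r \<le> T"
        using iT by (auto simp: s_Suc)
      then have "in_L2 M (\<lambda>\<omega>. g r (X r \<omega>) - G i \<omega>)"
        using s0[of i] by (intro in_L2_diff L2F_in_L2[OF G] L2F_in_L2[OF L2F_coefficients(2)[OF X_L2F]]) auto
      from nn_integral_L2_le[OF this conjunct2[OF coeff[OF r]]]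
      show "(\<integral>\<^sup>+\<omega>. ennreal ((norm (g r (X r \<omega>) - G i \<omega>))\<^sup>2) \<partial>M) \<le> ennreal ((sqrt h * step_defect B)\<^sup>2)" .
    qed (use h def0 in auto)
    then show "L2_norm M (S i) \<le> sqrt h * (sqrt h * step_defect B)"
      by (simp add: s_Suc mult_ac)
    show "expectation (\<lambda>\<omega>. Y \<omega> \<bullet> S i \<omega>) = 0" if Y: "L2F (t0 + real i * h) Y" for Y
    proof -
      have Y': "L2F (s i) Y"
        using Y by (simp add: s_def)
      have "expectation (\<lambda>\<omega>. Y \<omega> \<bullet> (stoch t0 \<xi> X (s (Suc i)) \<omega> - stoch t0 \<xi> X (s i) \<omega>)) = 0"
        by (rule ito_integral_increment_orthogonal[OF stoch_ito[OF s0] stoch_ito[OF s0] s0 st(2) Y'])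
      moreover have "expectation (\<lambda>\<omega>. Y \<omega> \<bullet> (G i \<omega> *v (W (s i + h) \<omega> - W (s i) \<omega>))) = 0"
        using h by (intro increment_orthogonal G Y') simp
      ultimately show ?thesis
        unfolding S_def inner_diff_right[of _ "stoch t0 \<xi> X (s (Suc i)) _ - stoch t0 \<xi> X (s i) _"]
        using in_L2_integrable_inner[OF L2F_in_L2[OF Y'] SL] in_L2_integrable_inner[OF L2F_in_L2[OF Y'] GW]
        by simp
    qed
    show "X (s (Suc i)) \<omega> = em_step (t0 + real i * h) h (X (s i)) \<omega> + D i \<omega> + S i \<omega>" for \<omega>
      by (simp add: em_step_def D_def S_def G_def s_def)
  qed (use XL in \<open>simp_all add: s_def\<close>)
  also have "L2_norm M (\<lambda>\<omega>. X (s 0) \<omega> - y 0 \<omega>) = 0"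
  proof -
    have "L2_norm M (\<lambda>\<omega>. X (s 0) \<omega> - y 0 \<omega>) = L2_norm M (\<lambda>\<omega>. 0 :: real ^ 'm)"
      using X_initial X_M[of t0] in_L2_measurable[OF \<xi>] by (intro L2_norm_cong_AE) (auto simp: s_def y(2))
    then show ?thesis by simp
  qed
  finally have "(L2_norm M (\<lambda>\<omega>. X (s n) \<omega> - y n \<omega>))\<^sup>2 \<le> (sqrt h * (sqrt stab_c * step_defect B))\<^sup>2"
    using stab_c_nonneg by (simp add: power_mult_distrib mult_ac)
  then have grid: "L2_norm M (\<lambda>\<omega>. X (s n) \<omega> - y n \<omega>) \<le> sqrt h * (sqrt stab_c * step_defect B)"
    using h def0 stab_c_nonneg by (simp add: abs_le_square_iff[symmetric])
  have "L2_norm M (\<lambda>\<omega>. X t \<omega> - y n \<omega>) \<le> L2_norm M (\<lambda>\<omega>. X t \<omega> - X (s n) \<omega>) + L2_norm M (\<lambda>\<omega>. X (s n) \<omega> - y n \<omega>)"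
    using em_path_L2F[OF y(1) h(1)] by (intro L2_norm_triangle3 L2F_in_L2[OF X_L2F[OF t(1)]] L2F_in_L2[OF XL] L2F_in_L2) auto
  also have "\<dots> \<le> sqrt h * incr_bound B + sqrt h * (sqrt stab_c * step_defect B)"
    using incr[of n t] n t grid by (intro add_mono) auto
  finally show ?thesis
    by (simp add: n_def algebra_simps)
qed

end

end

section \<open>Random periodic solutions\<close>

lemma L2_limit_transfer:
  assumes "L2_limit M Y Z" "\<And>k. in_L2 M (Y' k)"
    and le: "\<And>k. L2_norm M (\<lambda>\<omega>. Y' k \<omega> - Y k \<omega>) \<le> e k" and e: "e \<longlonglongrightarrow> 0"
  shows "L2_limit M Y' Z"
proof (rule L2_limitI)
  have i: "in_L2 M (Y k)" "in_L2 M Z" for k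
    using assms(1) by (auto simp: L2_limit_def)
  then show "in_L2 M Z" by simp
  have lim: "(\<lambda>k. e k + L2_norm M (\<lambda>\<omega>. Y k \<omega> - Z \<omega>)) \<longlonglongrightarrow> 0"
    using assms(1) e by (intro tendsto_add_zero) (auto simp: L2_limit_def)
  have "L2_norm M (\<lambda>\<omega>. Y' k \<omega> - Z \<omega>) \<le> e k + L2_norm M (\<lambda>\<omega>. Y k \<omega> - Z \<omega>)" for k
    using L2_norm_triangle3[OF assms(2) i, of k k] le[of k] by linarith
  then show "(\<lambda>k. L2_norm M (\<lambda>\<omega>. Y' k \<omega> - Z \<omega>)) \<longlonglongrightarrow> 0"
    by (intro Lim_null_comparison[OF _ lim]) auto
qed fact

lemma (in prob_space) L2_limit_exists:
  fixes Y :: "nat \<Rightarrow> 'a \<Rightarrow> 'b::euclidean_space"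
  assumes Y: "\<And>k. in_L2 M (Y k)"
    and le: "\<And>k l. k \<le> l \<Longrightarrow> L2_norm M (\<lambda>\<omega>. Y k \<omega> - Y l \<omega>) \<le> e k" and e: "e \<longlonglongrightarrow> 0"
  shows "\<exists>Z. L2_limit M Y Z"
proof -
  have "\<exists>N. \<forall>i\<ge>N. \<forall>j\<ge>N. L2_norm M (\<lambda>\<omega>. Y i \<omega> - Y j \<omega>) \<le> d" if "0 < d" for d
  proof -
    obtain N where N: "\<And>k. k \<ge> N \<Longrightarrow> e k < d"
      using order_tendstoD(2)[OF e \<open>0 < d\<close>] by (auto simp: eventually_sequentially)
    have "L2_norm M (\<lambda>\<omega>. Y i \<omega> - Y j \<omega>) \<le> d" if "i \<ge> N" "j \<ge> N" for i j
      using le[of i j] le[of j i] N[OF that(1)] N[OF that(2)] L2_norm_minus_commute[of M "Y i" "Y j"]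
      by (cases "i \<le> j") auto
    then show ?thesis by blast
  qed
  from L2_complete[OF Y this] show ?thesis by blast
qed

text \<open>Both variables live on one probability space and so couple the two laws; a 1-Lipschitz
  test function sees at most the mean distance.\<close>

lemma (in prob_space) bounded_lipschitz_dist_le:
  fixes Y Z :: "'a \<Rightarrow> 'b::euclidean_space"
  assumes "in_L2 M Y" "in_L2 M Z"
  shows "bounded_lipschitz_dist (distr M borel Y) (distr M borel Z) \<le> L2_norm M (\<lambda>\<omega>. Y \<omega> - Z \<omega>)"
  unfolding bounded_lipschitz_dist_def
proof (rule cSUP_least)
  show "{\<phi> :: 'b \<Rightarrow> real. (\<forall>x y. \<bar>\<phi> x - \<phi> y\<bar> \<le> norm (x - y)) \<and> (\<forall>x. \<bar>\<phi> x\<bar> \<le> 1)} \<noteq> {}"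
    by (auto intro!: exI[of _ "\<lambda>_. 0"])
next
  fix \<phi> :: "'b \<Rightarrow> real"
  assume "\<phi> \<in> {\<phi>. (\<forall>x y. \<bar>\<phi> x - \<phi> y\<bar> \<le> norm (x - y)) \<and> (\<forall>x. \<bar>\<phi> x\<bar> \<le> 1)}"
  then have \<phi>: "\<And>x y. \<bar>\<phi> x - \<phi> y\<bar> \<le> norm (x - y)" "\<And>x. \<bar>\<phi> x\<bar> \<le> 1"
    by auto
  have "1-lipschitz_on UNIV \<phi>"
    using \<phi>(1) by (intro lipschitz_onI) (auto simp: dist_norm)
  then have [measurable]: "\<phi> \<in> borel_measurable borel"
    by (intro borel_measurable_continuous_onI lipschitz_on_continuous_on)
  note [measurable] = assms[THEN in_L2_measurable]
  have i: "integrable M (\<lambda>\<omega>. \<phi> (V \<omega>))" if [measurable]: "V \<in> borel_measurable M" for V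
    using \<phi>(2) by (intro integrable_const_bound[of _ 1]) auto
  have "\<bar>(\<integral>x. \<phi> x \<partial>distr M borel Y) - (\<integral>x. \<phi> x \<partial>distr M borel Z)\<bar> = \<bar>expectation (\<lambda>\<omega>. \<phi> (Y \<omega>) - \<phi> (Z \<omega>))\<bar>"
    by (simp add: integral_distr i)
  also have "\<dots> \<le> expectation (\<lambda>\<omega>. norm (Y \<omega> - Z \<omega>))"
    using \<phi>(1) in_L2_integrable_vec[OF in_L2_diff[OF assms]] i
    by (intro order_trans[OF integral_abs_bound] integral_mono) auto
  also have "\<dots> \<le> L2_norm M (\<lambda>\<omega>. Y \<omega> - Z \<omega>)"
    by (rule expectation_norm_le_L2_norm[OF in_L2_diff[OF assms]])
  finally show "\<bar>(\<integral>x. \<phi> x \<partial>distr M borel Y) - (\<integral>x. \<phi> x \<partial>distr M borel Z)\<bar> \<le> L2_norm M (\<lambda>\<omega>. Y \<omega> - Z \<omega>)" .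
qed

section \<open>Off-grid values, uniform error bounds and pullback limits\<close>

context dissipative_sde
begin

definition em_interp :: "real \<Rightarrow> real \<Rightarrow> ('w \<Rightarrow> real ^ 'm) \<Rightarrow> 'w \<Rightarrow> real ^ 'm" where
  "em_interp s u Y \<omega> = Y \<omega> + (u - s) *\<^sub>R f s (Y \<omega>) + g s (Y \<omega>) *v (W u \<omega> - W s \<omega>)"

lemma in_L2_em_interp:
  assumes "s \<le> u" "L2F s Y"
  shows "in_L2 M (em_interp s u Y)"
  unfolding em_interp_def[abs_def]
  by (intro in_L2_add in_L2_scaleR in_L2_increment assms L2F_in_L2[OF L2F_coefficients(1)[OF assms(2)]] L2F_coefficients(2) L2F_in_L2[OF assms(2)])

text \<open>The interpolation lacks the linear drift term, so it is compared with the last grid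
  value instead of with a partial step; both its terms are at most of order sqrt h.\<close>

lemma em_interp_near:
  assumes "s \<le> u" "u \<le> s + h" "h \<le> 1" and Y: "L2F s Y" "L2_norm M Y \<le> B"
  shows "L2_norm M (\<lambda>\<omega>. Y \<omega> - em_interp s u Y \<omega>) \<le> sqrt h * (2 * zero_bound + (\<beta>1 + \<beta>2) * B)"
proof -
  have B0: "0 \<le> B"
    using Y(2) order_trans[OF L2_norm_nonneg] by blast
  note F = L2F_coefficients(1)[OF Y(1), of s] and G = L2F_coefficients(2)[OF Y(1), of s]
  have us: "u - s \<le> sqrt h" "sqrt (u - s) \<le> sqrt h"
  proof -
    have "h \<le> sqrt h"
      using assms(1-3) by (intro real_le_rsqrt) (simp add: power2_eq_square mult_left_le)
    with assms(1-3) show "u - s \<le> sqrt h" "sqrt (u - s) \<le> sqrt h"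
      by auto
  qed
  have "L2_norm M (\<lambda>\<omega>. Y \<omega> - em_interp s u Y \<omega>) = L2_norm M (\<lambda>\<omega>. em_interp s u Y \<omega> - Y \<omega>)"
    by (rule L2_norm_minus_commute)
  also have "\<dots> = L2_norm M (\<lambda>\<omega>. (u - s) *\<^sub>R f s (Y \<omega>) + g s (Y \<omega>) *v (W u \<omega> - W s \<omega>))"
    by (simp add: em_interp_def)
  also have "\<dots> \<le> L2_norm M (\<lambda>\<omega>. (u - s) *\<^sub>R f s (Y \<omega>)) + L2_norm M (\<lambda>\<omega>. g s (Y \<omega>) *v (W u \<omega> - W s \<omega>))"
    by (intro L2_norm_triangle in_L2_scaleR L2F_in_L2[OF F] in_L2_increment assms(1) G)
  also have "\<dots> = (u - s) * L2_norm M (\<lambda>\<omega>. f s (Y \<omega>)) + sqrt (u - s) * L2_norm M (\<lambda>\<omega>. g s (Y \<omega>))"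
    using L2_norm_increment[OF assms(1) G] assms(1) by (simp add: L2_norm_scaleR)
  also have "\<dots> \<le> sqrt h * (zero_bound + \<beta>1 * B) + sqrt h * (zero_bound + \<beta>2 * B)"
  proof (intro add_mono mult_mono us)
    show "L2_norm M (\<lambda>\<omega>. f s (Y \<omega>)) \<le> zero_bound + \<beta>1 * B"
      using L2F_coefficients(4)[OF Y(1), of s] mult_left_mono[OF Y(2) less_imp_le[OF \<beta>1_pos]] by linarith
    show "L2_norm M (\<lambda>\<omega>. g s (Y \<omega>)) \<le> zero_bound + \<beta>2 * B"
      using L2F_coefficients(5)[OF Y(1), of s] mult_left_mono[OF Y(2) less_imp_le[OF \<beta>2_pos]] by linarith
  qed (use assms(1-3) in auto)
  finally show ?thesis
    by (simp add: algebra_simps)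
qed

text \<open>Carries the contraction at grid points over to the interpolated values, at the price of
  a fixed factor.\<close>

lemma em_interp_Lipschitz:
  assumes "s \<le> u" "u \<le> s + 1" "L2F s Y" "L2F s Y'"
  shows "L2_norm M (\<lambda>\<omega>. em_interp s u Y \<omega> - em_interp s u Y' \<omega>) \<le> (1 + \<beta>1 + \<beta>2) * L2_norm M (\<lambda>\<omega>. Y \<omega> - Y' \<omega>)"
proof -
  define e where "e \<omega> = Y \<omega> - Y' \<omega>" for \<omega>
  define F' where "F' \<omega> = f s (Y \<omega>) - f s (Y' \<omega>)" for \<omega>
  define G where "G \<omega> = g s (Y \<omega>) - g s (Y' \<omega>)" for \<omega>
  have e: "L2F s e" and F': "L2F s F'" and G: "L2F s G"
    unfolding e_def[abs_def] F'_def[abs_def] G_def[abs_def] by (intro L2F_diff assms L2F_coefficients)+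
  have Fe: "L2_norm M F' \<le> 0 + \<beta>1 * L2_norm M e"
    using \<beta>1_pos f_Hoelder[of s "Y _" s "Y' _"] L2F_in_L2[OF F', THEN in_L2_measurable]
    by (intro in_L2_affine_bound(2)[OF L2F_in_L2[OF e]]) (auto simp: F'_def e_def)
  have Ge: "L2_norm M G \<le> 0 + \<beta>2 * L2_norm M e"
    using \<beta>2_pos g_Hoelder[of s "Y _" s "Y' _"] L2F_in_L2[OF G, THEN in_L2_measurable]
    by (intro in_L2_affine_bound(2)[OF L2F_in_L2[OF e]]) (auto simp: G_def e_def)
  have eq: "(\<lambda>\<omega>. em_interp s u Y \<omega> - em_interp s u Y' \<omega>) = (\<lambda>\<omega>. (e \<omega> + (u - s) *\<^sub>R F' \<omega>) + G \<omega> *v (W u \<omega> - W s \<omega>))"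
    by (simp add: fun_eq_iff em_interp_def e_def F'_def G_def scaleR_diff_right matrix_vector_mult_diff_rdistrib)
  have "L2_norm M (\<lambda>\<omega>. em_interp s u Y \<omega> - em_interp s u Y' \<omega>)
      \<le> (L2_norm M e + L2_norm M (\<lambda>\<omega>. (u - s) *\<^sub>R F' \<omega>)) + L2_norm M (\<lambda>\<omega>. G \<omega> *v (W u \<omega> - W s \<omega>))"
    unfolding eq by (intro order_trans[OF L2_norm_triangle] add_mono L2_norm_triangle order_refl in_L2_add in_L2_scaleR
        L2F_in_L2[OF e] L2F_in_L2[OF F'] in_L2_increment assms(1) G)
  also have "\<dots> = L2_norm M e + (u - s) * L2_norm M F' + sqrt (u - s) * L2_norm M G"
    using L2_norm_increment[OF assms(1) G] assms(1) by (simp add: L2_norm_scaleR)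
  also have "\<dots> \<le> L2_norm M e + 1 * (\<beta>1 * L2_norm M e) + 1 * (\<beta>2 * L2_norm M e)"
    using assms(1,2) Fe Ge by (intro add_mono mult_mono order_refl) auto
  also have "\<dots> = (1 + \<beta>1 + \<beta>2) * L2_norm M e"
    by (simp add: algebra_simps)
  finally show ?thesis
    by (simp only: e_def[abs_def])
qed

definition L2_bound :: "real \<Rightarrow> real" where "L2_bound K = sqrt (K\<^sup>2 + stab_c * zero_bound\<^sup>2)"

text \<open>The constant of \<open>X_em_le\<close> with the uniform bound \<open>L2_bound K\<close>
  inserted, plus the interpolation error. It depends on \<open>K\<close> and the coefficients
  alone.\<close>

definition em_error :: "real \<Rightarrow> real" where
  "em_error K = (incr_bound (L2_bound K) + sqrt stab_c * step_defect (L2_bound K)) + (2 * zero_bound + (\<beta>1 + \<beta>2) * L2_bound K)"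

lemma le_L2_bound: "0 \<le> K \<Longrightarrow> K \<le> L2_bound K"
  unfolding L2_bound_def using stab_c_nonneg by (intro real_le_rsqrt) simp

text \<open>The scheme evaluates its coefficients at the time elapsed since the start,
  \<open>em_path\<close> at the actual time; the two differ by \<open>k\<close> periods.\<close>

lemma em_path_em_iterate:
  assumes n: "n \<ge> 1" and \<xi>: "L2F (- real k * \<tau>) \<xi>"
  shows "em_path (- real k * \<tau>) (\<tau> / real n) (em_iterate A f g W (- real k * \<tau>) (\<tau> / real n) \<xi>)"
proof -
  let ?h = "\<tau> / real n"
  have per: "f (- real k * \<tau> + t) x = f t x" "g (- real k * \<tau> + t) x = g t x" for t x
    using f_periodic_int[of t "- int k" x] g_periodic_int[of t "- int k" x] by (simp_all add: algebra_simps)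
  have time: "- real k * \<tau> + real i * ?h + ?h = - real k * \<tau> + real (Suc i) * ?h" for i
    by (simp add: algebra_simps add_divide_distrib)
  show ?thesis
    unfolding em_path_def
  proof (intro conjI allI ext)
    show "L2F (- real k * \<tau>) (em_iterate A f g W (- real k * \<tau>) ?h \<xi> 0)"
      using \<xi> by simp
    fix i \<omega>
    show "em_iterate A f g W (- real k * \<tau>) ?h \<xi> (Suc i) \<omega>
        = em_step (- real k * \<tau> + real i * ?h) ?h (em_iterate A f g W (- real k * \<tau>) ?h \<xi> i) \<omega>"
      unfolding em_iterate.simps em_step_def b_def Let_def per time scaleR_add_right by (simp only: add.assoc)
  qed
qed

lemma em_process_eq_interp:
  assumes n: "n \<ge> 1" and r: "0 \<le> r"
  defines "h \<equiv> \<tau> / real n"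
  defines "N \<equiv> nat \<lfloor>r / h\<rfloor>"
  shows "em_process A f g W \<tau> n k \<xi> r = em_interp (real N * h) r (em_iterate A f g W (- real k * \<tau>) h \<xi> (k * n + N))"
    and "real N * h \<le> r" "r \<le> real N * h + h"
    and "nat \<lfloor>(r - (- real k * \<tau>)) / h\<rfloor> = k * n + N"
    and "- real k * \<tau> + real (k * n + N) * h = real N * h"
proof -
  have h: "0 < h"
    using n \<tau>_pos by (simp add: h_def)
  \<comment> \<open>At a grid time the extra terms of the interpolation vanish, so the case
    distinction in \<open>em_process\<close> disappears.\<close>
  show "em_process A f g W \<tau> n k \<xi> r = em_interp (real N * h) r (em_iterate A f g W (- real k * \<tau>) h \<xi> (k * n + N))"
    by (simp add: em_process_def em_interp_def Let_def h_def N_def fun_eq_iff)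
  have rh: "0 \<le> r / h"
    using r h by simp
  then have "real N \<le> r / h" "r / h < real N + 1"
    unfolding N_def by linarith+
  then show "real N * h \<le> r" "r \<le> real N * h + h"
    using h by (simp_all add: field_simps)
  have kn: "real k * \<tau> = real (k * n) * h"
    using n by (simp add: h_def)
  have "(r - (- real k * \<tau>)) / h = r / h + of_int (int (k * n))"
    using h unfolding minus_mult_left[symmetric] kn by (simp add: field_simps)
  then have "\<lfloor>(r - (- real k * \<tau>)) / h\<rfloor> = \<lfloor>r / h\<rfloor> + int (k * n)"
    by (simp only: floor_add_int)
  with rh show "nat \<lfloor>(r - (- real k * \<tau>)) / h\<rfloor> = k * n + N"
    by (simp add: N_def nat_add_distrib nat_mult_distrib)
  show "- real k * \<tau> + real (k * n + N) * h = real N * h"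
    unfolding minus_mult_left[symmetric] kn by (simp add: distrib_right)
qed

lemma em_process_in_L2:
  assumes "n \<ge> 1" "0 \<le> r" "L2F (- real k * \<tau>) \<xi>"
  shows "in_L2 M (em_process A f g W \<tau> n k \<xi> r)"
proof -
  have h: "0 < \<tau> / real n"
    using assms(1) \<tau>_pos by simp
  show ?thesis
    unfolding em_process_eq_interp(1)[OF assms(1,2)]
    using em_path_L2F[OF em_path_em_iterate[OF assms(1,3)] h, of "k * n + nat \<lfloor>r / (\<tau> / real n)\<rfloor>"]
    by (intro in_L2_em_interp em_process_eq_interp(2)[OF assms(1,2)]) (simp only: em_process_eq_interp(5)[OF assms(1,2)])
qed

text \<open>The scheme started at -l \<tau> reaches -k \<tau> on the same grid with norm at most
  \<open>L2_bound K\<close>. From there both schemes see the same noise for a time of at least k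
  \<tau> and contract.\<close>

lemma em_process_pullback:
  assumes n: "n \<ge> 1" "\<tau> / real n \<le> max_step" and r: "0 \<le> r" and "k \<le> l"
    and \<xi>: "L2F (- real k * \<tau>) \<xi>" "L2_norm M \<xi> \<le> K"
    and \<xi>': "L2F (- real l * \<tau>) \<xi>'" "L2_norm M \<xi>' \<le> K"
  shows "L2_norm M (\<lambda>\<omega>. em_process A f g W \<tau> n k \<xi> r \<omega> - em_process A f g W \<tau> n l \<xi>' r \<omega>)
    \<le> (1 + \<beta>1 + \<beta>2) * (2 * L2_bound K) * exp (- (\<alpha> * \<tau> / 4) * real k)"
proof -
  define h where "h = \<tau> / real n"
  define N where "N = nat \<lfloor>r / h\<rfloor>"
  have h: "0 < h" "h \<le> max_step"
    using n \<tau>_pos by (simp_all add: h_def)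
  have K: "0 \<le> K"
    using \<xi>(2) order_trans[OF L2_norm_nonneg] by blast
  define y where "y = em_iterate A f g W (- real k * \<tau>) h \<xi>"
  define y' where "y' = em_iterate A f g W (- real l * \<tau>) h \<xi>'"
  have y: "em_path (- real k * \<tau>) h y"
    unfolding y_def h_def by (rule em_path_em_iterate[OF n(1) \<xi>(1)])
  have y': "em_path (- real l * \<tau>) h y'"
    unfolding y'_def h_def by (rule em_path_em_iterate[OF n(1) \<xi>'(1)])
  \<comment> \<open>The path started earlier, renumbered from its grid time -k \<tau>, which it
    meets after \<open>(l - k) * n\<close> steps.\<close>
  define z where "z i = y' ((l - k) * n + i)" for i
  have time: "- real l * \<tau> + real ((l - k) * n) * h = - real k * \<tau>"
    using n(1) \<open>k \<le> l\<close> by (simp add: h_def of_nat_diff algebra_simps)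
  have z: "em_path (- real k * \<tau>) h z"
    using em_path_shift[OF y' h(1), of "(l - k) * n"] unfolding time z_def[abs_def] .
  have z_eq: "z (k * n + N) = y' (l * n + N)"
  proof -
    have "(l - k) * n + (k * n + N) = l * n + N"
      using \<open>k \<le> l\<close> by (simp flip: add_mult_distrib add.assoc)
    then show ?thesis
      by (simp only: z_def)
  qed
  have "L2_norm M (\<lambda>\<omega>. y 0 \<omega> - z 0 \<omega>) \<le> L2_norm M (y 0) + L2_norm M (z 0)"
    using y z by (intro L2_norm_triangle_diff L2F_in_L2) (auto simp: em_path_def)
  also have "\<dots> \<le> K + L2_bound K"
    using em_path_bounded[OF h y', of K "(l - k) * n"] \<xi>(2) \<xi>'(2) by (simp add: z_def y_def y'_def L2_bound_def)
  also have "\<dots> \<le> 2 * L2_bound K"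
    using le_L2_bound[OF K] by simp
  finally have init: "L2_norm M (\<lambda>\<omega>. y 0 \<omega> - z 0 \<omega>) \<le> 2 * L2_bound K" .
  have T: "real k * \<tau> \<le> real (k * n + N) * h"
    using n(1) \<tau>_pos by (simp add: h_def algebra_simps)
  have le: "L2_norm M (\<lambda>\<omega>. y (k * n + N) \<omega> - y' (l * n + N) \<omega>) \<le> exp (- (\<alpha> * (real k * \<tau>) / 4)) * (2 * L2_bound K)"
    using em_path_contraction[OF h y z T] init unfolding z_eq by (meson exp_ge_zero mult_left_mono order_trans)
  have N: "real N * h \<le> r" "r \<le> real N * h + h"
    using em_process_eq_interp(2,3)[OF n(1) r] by (simp_all add: N_def h_def)
  have tm: "- real k * \<tau> + real (k * n + N) * h = real N * h" "- real l * \<tau> + real (l * n + N) * h = real N * h"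
    using em_process_eq_interp(5)[OF n(1) r] by (simp_all add: N_def h_def)
  have "L2_norm M (\<lambda>\<omega>. em_process A f g W \<tau> n k \<xi> r \<omega> - em_process A f g W \<tau> n l \<xi>' r \<omega>)
      = L2_norm M (\<lambda>\<omega>. em_interp (real N * h) r (y (k * n + N)) \<omega> - em_interp (real N * h) r (y' (l * n + N)) \<omega>)"
    unfolding em_process_eq_interp(1)[OF n(1) r] by (simp add: N_def h_def y_def y'_def)
  also have "\<dots> \<le> (1 + \<beta>1 + \<beta>2) * L2_norm M (\<lambda>\<omega>. y (k * n + N) \<omega> - y' (l * n + N) \<omega>)"
    using N max_step_le(1)[OF h(2)] em_path_L2F[OF y h(1), of "k * n + N"] em_path_L2F[OF y' h(1), of "l * n + N"]
    unfolding tm by (intro em_interp_Lipschitz) auto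
  also have "\<dots> \<le> (1 + \<beta>1 + \<beta>2) * (exp (- (\<alpha> * (real k * \<tau>) / 4)) * (2 * L2_bound K))"
    using \<beta>1_pos \<beta>2_pos by (intro mult_left_mono le) auto
  finally show ?thesis
    by (simp add: mult_ac)
qed

lemma step_size_tendsto: "(\<lambda>n. sqrt (\<tau> / real (Suc n)) * c) \<longlonglongrightarrow> 0"
proof -
  have "(\<lambda>n. sqrt (\<tau> / real (Suc n))) \<longlonglongrightarrow> sqrt 0"
    by (intro tendsto_real_sqrt LIMSEQ_Suc[OF lim_const_over_n])
  then show ?thesis
    by (intro tendsto_mult_left_zero) simp
qed

lemma step_size_small: "\<forall>\<^sub>F n in sequentially. \<tau> / real (Suc n) \<le> max_step"
  using order_tendstoD(2)[OF LIMSEQ_Suc[OF lim_const_over_n[of \<tau>]] max_step_pos] by (rule eventually_mono) simp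

text \<open>The crude bound \<open>B\<close> is used only to make the distance to the scheme vanish
  as the step tends to 0. The bound on the scheme is uniform in the step and in time, and passes to
  the limit.\<close>

lemma solution_bounded:
  assumes sol: "sde_solution M W A f g (- real k * \<tau>) \<xi> X"
    and \<xi>: "L2F (- real k * \<tau>) \<xi>" "L2_norm M \<xi> \<le> K" and t: "- real k * \<tau> \<le> t"
  shows "L2_norm M (X t) \<le> L2_bound K"
proof -
  note \<xi>L = L2F_in_L2[OF \<xi>(1)]
  obtain B where B: "\<And>s. - real k * \<tau> \<le> s \<Longrightarrow> s \<le> t \<Longrightarrow> L2F s (X s) \<and> L2_norm M (X s) \<le> B"
    using X_L2_bound[OF sol \<xi>L] by blast
  let ?c = "incr_bound B + sqrt stab_c * step_defect B"
  have "\<forall>\<^sub>F n in sequentially. L2_norm M (X t) \<le> L2_bound K + sqrt (\<tau> / real (Suc n)) * ?c"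
    using step_size_small
  proof eventually_elim
    case (elim n)
    define h where "h = \<tau> / real (Suc n)"
    have h: "0 < h" "h \<le> max_step"
      using elim \<tau>_pos by (simp_all add: h_def)
    define y where "y = em_iterate A f g W (- real k * \<tau>) h \<xi>"
    have y: "em_path (- real k * \<tau>) h y" "y 0 = \<xi>"
      unfolding y_def h_def by (rule em_path_em_iterate[OF _ \<xi>(1)]) simp_all
    define i where "i = nat \<lfloor>(t - (- real k * \<tau>)) / h\<rfloor>"
    have "L2_norm M (X t) \<le> L2_norm M (y i) + L2_norm M (\<lambda>\<omega>. X t \<omega> - y i \<omega>)"
      using B[OF t] em_path_L2F[OF y(1) h(1)] by (intro L2_norm_triangle_sub L2F_in_L2) auto
    also have "\<dots> \<le> L2_bound K + sqrt h * ?c"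
      using em_path_bounded[OF h y(1), of K i] X_em_le[OF sol \<xi>L h y _ t order_refl, of B] B \<xi>(2)
      by (intro add_mono) (auto simp: y(2) L2_bound_def i_def)
    finally show ?case
      by (simp add: h_def)
  qed
  moreover have "(\<lambda>n. L2_bound K + sqrt (\<tau> / real (Suc n)) * ?c) \<longlonglongrightarrow> L2_bound K + 0"
    by (intro tendsto_add tendsto_const step_size_tendsto)
  ultimately show ?thesis
    by (intro tendsto_lowerbound[of _ "L2_bound K" sequentially "L2_norm M (X t)"]) auto
qed

text \<open>The second run of the comparison, now with the bound from
  \<open>solution_bounded\<close>, so that the constant is independent of \<open>k\<close>,
  \<open>r\<close> and the solution.\<close>

lemma solution_em_process_le:
  assumes sol: "sde_solution M W A f g (- real k * \<tau>) \<xi> X"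
    and \<xi>: "L2F (- real k * \<tau>) \<xi>" "L2_norm M \<xi> \<le> K"
    and n: "n \<ge> 1" "\<tau> / real n \<le> max_step" and r: "0 \<le> r"
  shows "L2_norm M (\<lambda>\<omega>. X r \<omega> - em_process A f g W \<tau> n k \<xi> r \<omega>) \<le> em_error K * sqrt (\<tau> / real n)"
proof -
  note \<xi>L = L2F_in_L2[OF \<xi>(1)]
  define h where "h = \<tau> / real n"
  define N where "N = nat \<lfloor>r / h\<rfloor>"
  have h: "0 < h" "h \<le> max_step"
    using n \<tau>_pos by (simp_all add: h_def)
  define y where "y = em_iterate A f g W (- real k * \<tau>) h \<xi>"
  have y: "em_path (- real k * \<tau>) h y" "y 0 = \<xi>"
    unfolding y_def h_def by (rule em_path_em_iterate[OF n(1) \<xi>(1)]) simp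
  have t: "- real k * \<tau> \<le> r"
    using r \<tau>_pos by (simp add: order_trans[of _ 0])
  have N: "real N * h \<le> r" "r \<le> real N * h + h" "nat \<lfloor>(r - (- real k * \<tau>)) / h\<rfloor> = k * n + N"
    using em_process_eq_interp(2,3,4)[OF n(1) r] by (simp_all add: N_def h_def)
  have yN: "L2F (real N * h) (y (k * n + N))"
    using em_path_L2F[OF y(1) h(1), of "k * n + N"] em_process_eq_interp(5)[OF n(1) r] by (simp add: N_def h_def)
  have "L2_norm M (\<lambda>\<omega>. X r \<omega> - em_process A f g W \<tau> n k \<xi> r \<omega>)
      = L2_norm M (\<lambda>\<omega>. X r \<omega> - em_interp (real N * h) r (y (k * n + N)) \<omega>)"
    unfolding em_process_eq_interp(1)[OF n(1) r] by (simp add: N_def h_def y_def)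
  also have "\<dots> \<le> L2_norm M (\<lambda>\<omega>. X r \<omega> - y (k * n + N) \<omega>)
      + L2_norm M (\<lambda>\<omega>. y (k * n + N) \<omega> - em_interp (real N * h) r (y (k * n + N)) \<omega>)"
    by (intro L2_norm_triangle3 L2F_in_L2[OF X_L2F[OF sol \<xi>L t]] L2F_in_L2[OF yN] in_L2_em_interp N(1) yN)
  also have "\<dots> \<le> sqrt h * (incr_bound (L2_bound K) + sqrt stab_c * step_defect (L2_bound K)) + sqrt h * (2 * zero_bound + (\<beta>1 + \<beta>2) * L2_bound K)"
  proof (rule add_mono)
    show "L2_norm M (\<lambda>\<omega>. X r \<omega> - y (k * n + N) \<omega>) \<le> sqrt h * (incr_bound (L2_bound K) + sqrt stab_c * step_defect (L2_bound K))"
      using X_em_le[OF sol \<xi>L h y _ t order_refl, of "L2_bound K"] solution_bounded[OF sol \<xi>] unfolding N(3) by blast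
    show "L2_norm M (\<lambda>\<omega>. y (k * n + N) \<omega> - em_interp (real N * h) r (y (k * n + N)) \<omega>)
        \<le> sqrt h * (2 * zero_bound + (\<beta>1 + \<beta>2) * L2_bound K)"
      using em_path_bounded[OF h y(1), of K] \<xi>(2) unfolding L2_bound_def
      by (intro em_interp_near N max_step_le(1)[OF h(2)] yN) (simp add: y(2))
  qed
  also have "\<dots> = em_error K * sqrt h"
    by (simp add: em_error_def algebra_simps)
  finally show ?thesis
    by (simp add: h_def)
qed

text \<open>Both solutions are approximated by schemes with a common step; the contraction of the
  schemes has a rate independent of the step, and the approximation errors vanish in the
  limit.\<close>

lemma solution_pullback:
  assumes sol: "sde_solution M W A f g (- real k * \<tau>) \<xi> X" "sde_solution M W A f g (- real l * \<tau>) \<xi>' X'"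
    and \<xi>: "L2F (- real k * \<tau>) \<xi>" "L2_norm M \<xi> \<le> K"
    and \<xi>': "L2F (- real l * \<tau>) \<xi>'" "L2_norm M \<xi>' \<le> K"
    and "k \<le> l" "0 \<le> r"
  shows "L2_norm M (\<lambda>\<omega>. X r \<omega> - X' r \<omega>) \<le> (1 + \<beta>1 + \<beta>2) * (2 * L2_bound K) * exp (- (\<alpha> * \<tau> / 4) * real k)" (is "_ \<le> ?R")
proof -
  have t: "- real j * \<tau> \<le> r" for j
    using \<open>0 \<le> r\<close> \<tau>_pos by (simp add: order_trans[of _ 0])
  have X: "in_L2 M (X r)" "in_L2 M (X' r)"
    using X_L2F[OF sol(1) L2F_in_L2[OF \<xi>(1)] t] X_L2F[OF sol(2) L2F_in_L2[OF \<xi>'(1)] t] by (simp_all add: L2F_in_L2)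
  have "\<forall>\<^sub>F n in sequentially. L2_norm M (\<lambda>\<omega>. X r \<omega> - X' r \<omega>) \<le> ?R + sqrt (\<tau> / real (Suc n)) * (2 * em_error K)"
    using step_size_small
  proof eventually_elim
    case (elim n)
    let ?Y = "em_process A f g W \<tau> (Suc n) k \<xi> r" and ?Y' = "em_process A f g W \<tau> (Suc n) l \<xi>' r"
    have Y: "in_L2 M ?Y" "in_L2 M ?Y'"
      using \<open>0 \<le> r\<close> \<xi> \<xi>' by (auto intro!: em_process_in_L2)
    have "L2_norm M (\<lambda>\<omega>. X r \<omega> - X' r \<omega>) \<le> L2_norm M (\<lambda>\<omega>. X r \<omega> - ?Y \<omega>) + L2_norm M (\<lambda>\<omega>. ?Y \<omega> - X' r \<omega>)"
      by (rule L2_norm_triangle3[OF X(1) Y(1) X(2)])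
    moreover have "L2_norm M (\<lambda>\<omega>. ?Y \<omega> - X' r \<omega>) \<le> L2_norm M (\<lambda>\<omega>. ?Y \<omega> - ?Y' \<omega>) + L2_norm M (\<lambda>\<omega>. ?Y' \<omega> - X' r \<omega>)"
      by (rule L2_norm_triangle3[OF Y X(2)])
    moreover have "L2_norm M (\<lambda>\<omega>. X r \<omega> - ?Y \<omega>) \<le> em_error K * sqrt (\<tau> / real (Suc n))"
      by (rule solution_em_process_le[OF sol(1) \<xi> _ elim \<open>0 \<le> r\<close>]) simp
    moreover have "L2_norm M (\<lambda>\<omega>. ?Y' \<omega> - X' r \<omega>) \<le> em_error K * sqrt (\<tau> / real (Suc n))"
      unfolding L2_norm_minus_commute[of M ?Y'] by (rule solution_em_process_le[OF sol(2) \<xi>' _ elim \<open>0 \<le> r\<close>]) simp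
    moreover have "L2_norm M (\<lambda>\<omega>. ?Y \<omega> - ?Y' \<omega>) \<le> ?R"
      by (rule em_process_pullback[OF _ elim \<open>0 \<le> r\<close> \<open>k \<le> l\<close> \<xi> \<xi>']) simp
    ultimately show ?case
      by (simp add: algebra_simps)
  qed
  moreover have "(\<lambda>n. ?R + sqrt (\<tau> / real (Suc n)) * (2 * em_error K)) \<longlonglongrightarrow> ?R + 0"
    by (intro tendsto_add tendsto_const step_size_tendsto)
  ultimately show ?thesis
    by (intro tendsto_lowerbound[of _ ?R sequentially "L2_norm M (\<lambda>\<omega>. X r \<omega> - X' r \<omega>)"]) auto
qed

lemma pullback_rate_tendsto: "(\<lambda>k. C * exp (- (\<alpha> * \<tau> / 4) * real k)) \<longlonglongrightarrow> 0"
proof -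
  have "(\<lambda>k. exp (- (\<alpha> * \<tau> / 4)) ^ k) \<longlonglongrightarrow> 0"
    using \<alpha>_pos \<tau>_pos by (intro LIMSEQ_power_zero) simp
  then show ?thesis
    by (intro tendsto_mult_right_zero) (simp add: exp_of_nat_mult[symmetric] mult.commute)
qed

lemma initial_values_L2F:
  assumes "initial_values M W \<tau> K \<xi>"
  shows "L2F (- real k * \<tau>) (\<xi> k)" "L2_norm M (\<xi> k) \<le> K"
proof -
  have \<xi>: "\<xi> k \<in> borel_measurable (increment_filtration M W (- real k * \<tau>))" "in_L2 M (\<xi> k)"
    using assms by (auto simp: initial_values_def)
  have "\<xi> k \<in> borel_measurable (F (- real k * \<tau>))"
    by (rule measurableI) (auto dest: measurable_sets[OF \<xi>(1)] intro!: subsetD[OF increment_filtration_subset_F])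
  with \<xi>(2) show "L2F (- real k * \<tau>) (\<xi> k)"
    by (simp add: L2F_def)
  show "L2_norm M (\<xi> k) \<le> K"
    using assms by (simp add: initial_values_def)
qed

text \<open>\<open>solution_pullback\<close> is used in two ways: for starting times
  \<open>k \<le> l\<close> within one family it gives the Cauchy property, and for equal starting
  times in two families it shows that all initial values lead to the same limit.\<close>

lemma random_periodic_exists:
  fixes \<xi> :: "nat \<Rightarrow> 'w \<Rightarrow> real ^ 'm"
  assumes \<xi>: "initial_values M W \<tau> K \<xi>"
    and sol: "\<And>k. sde_solution M W A f g (- real k * \<tau>) (\<xi> k) (X k)" and r: "0 \<le> r"
  shows "\<exists>Z. is_random_periodic M W A f g \<tau> r Z"
proof -
  have t: "- real j * \<tau> \<le> r" for j
    using r \<tau>_pos by (simp add: order_trans[of _ 0])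
  have in_L2: "in_L2 M (Y k r)"
    if "initial_values M W \<tau> K' \<zeta>" "\<And>k. sde_solution M W A f g (- real k * \<tau>) (\<zeta> k) (Y k)" for K' \<zeta> Y k
    using X_L2F[OF that(2) L2F_in_L2[OF initial_values_L2F(1)[OF that(1)]] t] by (rule L2F_in_L2)
  obtain Z where Z: "L2_limit M (\<lambda>k. X k r) Z"
    using L2_limit_exists[of "\<lambda>k. X k r", OF in_L2[OF \<xi> sol]
        solution_pullback[OF sol sol initial_values_L2F[OF \<xi>] initial_values_L2F[OF \<xi>] _ r] pullback_rate_tendsto]
    by blast
  have "is_random_periodic M W A f g \<tau> r Z"
    unfolding is_random_periodic_def
  proof (intro allI impI, elim conjE)
    fix K' \<zeta> Y
    assume \<zeta>: "initial_values M W \<tau> K' \<zeta>" and Y: "\<forall>k. sde_solution M W A f g (- real k * \<tau>) (\<zeta> k) (Y k)"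
    \<comment> \<open>The pullback estimate takes a single norm bound for both initial
      values.\<close>
    have K: "L2_norm M (\<xi> k) \<le> max K K'" "L2_norm M (\<zeta> k) \<le> max K K'" for k
      using initial_values_L2F(2)[OF \<xi>, of k] initial_values_L2F(2)[OF \<zeta>, of k] by auto
    show "L2_limit M (\<lambda>k. Y k r) Z"
      by (rule L2_limit_transfer[OF Z in_L2[OF \<zeta> Y[rule_format]]
            solution_pullback[OF Y[rule_format] sol initial_values_L2F(1)[OF \<zeta>] K(2) initial_values_L2F(1)[OF \<xi>] K(1) order_refl r]
            pullback_rate_tendsto])
  qed
  then show ?thesis
    by blast
qed

lemma em_random_periodic_exists:
  fixes \<xi> :: "nat \<Rightarrow> 'w \<Rightarrow> real ^ 'm"
  assumes \<xi>: "initial_values M W \<tau> K \<xi>" and n: "n \<ge> 1" "\<tau> / real n \<le> max_step" and r: "0 \<le> r"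
  shows "\<exists>Z. is_em_random_periodic M W A f g \<tau> n r Z"
proof -
  have in_L2: "in_L2 M (em_process A f g W \<tau> n k (\<zeta> k) r)" if "initial_values M W \<tau> K' \<zeta>" for K' \<zeta> k
    by (rule em_process_in_L2[OF n(1) r initial_values_L2F(1)[OF that]])
  obtain Z where Z: "L2_limit M (\<lambda>k. em_process A f g W \<tau> n k (\<xi> k) r) Z"
    using L2_limit_exists[of "\<lambda>k. em_process A f g W \<tau> n k (\<xi> k) r", OF in_L2[OF \<xi>]
        em_process_pullback[OF n r _ initial_values_L2F[OF \<xi>] initial_values_L2F[OF \<xi>]] pullback_rate_tendsto]
    by blast
  have "is_em_random_periodic M W A f g \<tau> n r Z"
    unfolding is_em_random_periodic_def
  proof (intro allI impI)
    fix K' and \<zeta> :: "nat \<Rightarrow> 'w \<Rightarrow> real ^ 'm"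
    assume \<zeta>: "initial_values M W \<tau> K' \<zeta>"
    have K: "L2_norm M (\<xi> k) \<le> max K K'" "L2_norm M (\<zeta> k) \<le> max K K'" for k
      using initial_values_L2F(2)[OF \<xi>, of k] initial_values_L2F(2)[OF \<zeta>, of k] by auto
    show "L2_limit M (\<lambda>k. em_process A f g W \<tau> n k (\<zeta> k) r) Z"
      by (rule L2_limit_transfer[OF Z in_L2[OF \<zeta>]
            em_process_pullback[OF n r order_refl initial_values_L2F(1)[OF \<zeta>] K(2) initial_values_L2F(1)[OF \<xi>] K(1)]
            pullback_rate_tendsto])
  qed
  then show ?thesis
    by blast
qed

text \<open>The chosen \<open>Z\<close> and \<open>Z'\<close> are genuine limits along the given
  solutions and schemes. They are defined on the same probability space, so their mean-square
  distance bounds the distance of their laws.\<close>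

lemma periodic_measures:
  assumes \<xi>: "initial_values M W \<tau> K \<xi>"
    and sol: "\<And>k. sde_solution M W A f g (- real k * \<tau>) (\<xi> k) (X k)" and r: "0 \<le> r"
  shows "converges_weakly (\<lambda>k. distr M borel (X k r)) (periodic_measure M W A f g \<tau> r)"
    and "n \<ge> 1 \<Longrightarrow> \<tau> / real n \<le> max_step \<Longrightarrow>
      converges_weakly (\<lambda>k. distr M borel (em_process A f g W \<tau> n k (\<xi> k) r)) (em_periodic_measure M W A f g \<tau> n r)"
    and "n \<ge> 1 \<Longrightarrow> \<tau> / real n \<le> max_step \<Longrightarrow>
      bounded_lipschitz_dist (periodic_measure M W A f g \<tau> r) (em_periodic_measure M W A f g \<tau> n r) \<le> em_error K * sqrt (\<tau> / real n)"
proof -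
  define Z where "Z = (SOME Z. is_random_periodic M W A f g \<tau> r Z)"
  have "is_random_periodic M W A f g \<tau> r Z"
    unfolding Z_def by (rule someI_ex[OF random_periodic_exists[OF \<xi> sol r]])
  then have Z: "L2_limit M (\<lambda>k. X k r) Z"
    using \<xi> sol unfolding is_random_periodic_def by blast
  show "converges_weakly (\<lambda>k. distr M borel (X k r)) (periodic_measure M W A f g \<tau> r)"
    unfolding periodic_measure_def Z_def[symmetric] by (rule L2_limit_converges_weakly[OF Z])
  assume n: "n \<ge> 1" "\<tau> / real n \<le> max_step"
  define Z' where "Z' = (SOME Z. is_em_random_periodic M W A f g \<tau> n r Z)"
  have "is_em_random_periodic M W A f g \<tau> n r Z'"
    unfolding Z'_def by (rule someI_ex[OF em_random_periodic_exists[OF \<xi> n r]])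
  then have Z': "L2_limit M (\<lambda>k. em_process A f g W \<tau> n k (\<xi> k) r) Z'"
    using \<xi> unfolding is_em_random_periodic_def by blast
  show "converges_weakly (\<lambda>k. distr M borel (em_process A f g W \<tau> n k (\<xi> k) r)) (em_periodic_measure M W A f g \<tau> n r)"
    unfolding em_periodic_measure_def Z'_def[symmetric] by (rule L2_limit_converges_weakly[OF Z'])
  \<comment> \<open>The error bound is the same for every \<open>k\<close> and hence survives the
    pullback limit.\<close>
  have "L2_norm M (\<lambda>\<omega>. Z \<omega> - Z' \<omega>) \<le> em_error K * sqrt (\<tau> / real n)"
    by (rule tendsto_upperbound[OF L2_limit_norm[OF L2_limit_diff[OF Z Z']]])
      (use solution_em_process_le[OF sol initial_values_L2F[OF \<xi>] n r] in auto)
  moreover have "bounded_lipschitz_dist (distr M borel Z) (distr M borel Z') \<le> L2_norm M (\<lambda>\<omega>. Z \<omega> - Z' \<omega>)"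
    using Z Z' by (intro bounded_lipschitz_dist_le) (auto simp: L2_limit_def)
  ultimately show "bounded_lipschitz_dist (periodic_measure M W A f g \<tau> r) (em_periodic_measure M W A f g \<tau> n r)
      \<le> em_error K * sqrt (\<tau> / real n)"
    unfolding periodic_measure_def em_periodic_measure_def Z_def[symmetric] Z'_def[symmetric] by linarith
qed

end

section \<open>Rayleigh quotient and the largest eigenvalue\<close>

text \<open>A maximiser \<open>u\<close> of the quadratic form on the unit sphere exists by
  compactness; vanishing of the first variation makes it an eigenvector.\<close>

lemma symmetric_matrix_le_eigenvalue:
  fixes A :: "real ^ 'm ^ 'm"
  assumes sym: "transpose A = A"
  obtains u m where "u \<noteq> 0" "A *v u = m *\<^sub>R u" "\<And>v. v \<bullet> (A *v v) \<le> m * (norm v)\<^sup>2"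
proof -
  have sa: "x \<bullet> (A *v y) = y \<bullet> (A *v x)" for x y
    by (metis dot_lmul_matrix inner_commute sym transpose_matrix_vector)
  have "continuous_on (sphere 0 1) (\<lambda>v. v \<bullet> (A *v v))"
    by (intro continuous_intros linear_continuous_on) auto
  moreover have "sphere 0 1 \<noteq> ({} :: (real ^ 'm) set)"
  proof -
    have "axis undefined 1 \<in> sphere (0 :: real ^ 'm) 1"
      by (simp add: norm_axis_1)
    then show ?thesis
      by blast
  qed
  ultimately obtain u where u: "norm u = 1" and max: "\<And>v. norm v = 1 \<Longrightarrow> v \<bullet> (A *v v) \<le> u \<bullet> (A *v u)"
    using continuous_attains_sup[of "sphere 0 1" "\<lambda>v. v \<bullet> (A *v v)"] by auto
  define m where "m = u \<bullet> (A *v u)"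
  have le: "v \<bullet> (A *v v) \<le> m * (norm v)\<^sup>2" for v
  proof (cases "v = 0")
    case False
    have "(v /\<^sub>R norm v) \<bullet> (A *v (v /\<^sub>R norm v)) \<le> m"
      unfolding m_def using False by (intro max) simp
    then have "(v \<bullet> (A *v v)) / (norm v)\<^sup>2 \<le> m"
      by (simp add: matrix_vector_mult_scaleR power2_eq_square field_simps)
    with False show ?thesis
      by (simp add: field_simps)
  qed simp
  \<comment> \<open>The form \<open>m * (norm v)\<^sup>2 - v \<bullet> (A *v v)\<close> is
    nonnegative and vanishes at \<open>u\<close>. Moving from \<open>u\<close> in direction
    \<open>- w\<close> changes it to first order by \<open>-2 * t * (w \<bullet> w)\<close>, which
    forces \<open>w = 0\<close>.\<close>
  define w where "w = m *\<^sub>R u - A *v u"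
  define q where "q = m * (norm w)\<^sup>2 - w \<bullet> (A *v w)"
  have q: "0 \<le> q"
    using le[of w] by (simp add: q_def)
  have *: "2 * (w \<bullet> w) \<le> t * q" if "0 < t" for t
  proof -
    have "0 \<le> m * (norm (u - t *\<^sub>R w))\<^sup>2 - (u - t *\<^sub>R w) \<bullet> (A *v (u - t *\<^sub>R w))"
      using le by simp
    also have "\<dots> = (m * (u \<bullet> u) - u \<bullet> (A *v u)) - 2 * t * (w \<bullet> (m *\<^sub>R u - A *v u)) + t\<^sup>2 * q"
      using sa[of u w] unfolding power2_norm_eq_inner q_def
      by (simp add: matrix_vector_mult_diff_distrib matrix_vector_mult_scaleR inner_diff_left inner_diff_right
          inner_commute[of u w] power2_eq_square algebra_simps)
    also have "m * (u \<bullet> u) - u \<bullet> (A *v u) = 0"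
      using u by (simp add: m_def norm_eq_1)
    finally have "0 \<le> t * (t * q - 2 * (w \<bullet> w))"
      by (simp add: w_def[symmetric] power2_eq_square algebra_simps)
    with that show ?thesis
      by (simp add: zero_le_mult_iff)
  qed
  have "w \<bullet> w \<le> 0"
  proof (rule ccontr)
    assume "\<not> w \<bullet> w \<le> 0"
    then have ww: "0 < w \<bullet> w"
      by linarith
    \<comment> \<open>For this \<open>t\<close> the product \<open>t * q\<close> is at most
      \<open>w \<bullet> w\<close>, which contradicts the inequality just proved; adding 1 covers
      \<open>q = 0\<close>.\<close>
    with q have pos: "0 < w \<bullet> w / (q + 1)"
      by (intro divide_pos_pos) auto
    have "w \<bullet> w / (q + 1) * q \<le> w \<bullet> w"
      using q ww by (simp add: pos_divide_le_eq mult_left_mono)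
    with *[OF pos] ww show False
      by linarith
  qed
  then have "w = 0"
    by (metis inner_eq_zero_iff inner_ge_zero order_antisym)
  then have "A *v u = m *\<^sub>R u"
    by (simp add: w_def)
  moreover have "u \<noteq> 0"
    using u by auto
  ultimately show thesis
    using le that by blast
qed

text \<open>The maximal value of the Rayleigh quotient is an eigenvalue, hence a root of the
  characteristic polynomial and one of the listed numbers, so at most the first.\<close>

lemma Rayleigh_le_largest_eigenvalue:
  fixes A :: "real ^ 'm ^ 'm"
  assumes "transpose A = A" "eigenvalue_list A lam"
    and sorted: "\<And>j. 1 \<le> j \<Longrightarrow> j \<le> CARD('m) \<Longrightarrow> lam j \<le> lam 1"
  shows "v \<bullet> (A *v v) \<le> lam 1 * (norm v)\<^sup>2"
proof -
  obtain u m where u: "u \<noteq> 0" "A *v u = m *\<^sub>R u" "\<And>v. v \<bullet> (A *v v) \<le> m * (norm v)\<^sup>2"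
    using symmetric_matrix_le_eigenvalue[OF assms(1)] by blast
  have "mat m *v u = m *\<^sub>R u"
    by (simp add: vec_eq_iff matrix_vector_mult_def mat_def if_distrib if_distribR sum.delta cong: if_cong)
  then have "(mat m - A) *v u = 0"
    by (simp add: matrix_vector_mult_diff_rdistrib u(2))
  then have "\<not> invertible (mat m - A)"
    using u(1) by (metis invertible_def matrix_left_invertible_ker)
  then have "det (mat m - A) = 0"
    by (simp add: invertible_det_nz)
  then have "(\<Prod>i = 1..CARD('m). m - lam i) = 0"
    using assms(2) by (simp add: eigenvalue_list_def)
  then obtain i where "1 \<le> i" "i \<le> CARD('m)" "m = lam i"
    by (auto simp: prod_zero_iff)
  then have "m \<le> lam 1"
    using sorted by simp
  then have "m * (norm v)\<^sup>2 \<le> lam 1 * (norm v)\<^sup>2"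
    by (intro mult_right_mono) auto
  with u(3)[of v] show ?thesis
    by linarith
qed

theorem theorem5p2:
  fixes M :: "'w measure"
    and W :: "real \<Rightarrow> 'w \<Rightarrow> real ^ 'd"
    and A :: "real ^ 'm ^ 'm"
    and lam :: "nat \<Rightarrow> real"
    and f :: "real \<Rightarrow> real ^ 'm \<Rightarrow> real ^ 'm"
    and g :: "real \<Rightarrow> real ^ 'm \<Rightarrow> real ^ 'd ^ 'm"
    and \<tau> C0 \<beta>1 \<beta>2 Kstar :: real
    and \<xi> :: "nat \<Rightarrow> 'w \<Rightarrow> real ^ 'm"
    and X :: "nat \<Rightarrow> real \<Rightarrow> 'w \<Rightarrow> real ^ 'm"
  assumes "prob_space M"
    and "two_sided_wiener M W"
    and "\<tau> > 0"
    and "transpose A = A"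
    and "eigenvalue_list A lam"
    and "\<And>i j. 1 \<le> i \<Longrightarrow> i \<le> j \<Longrightarrow> j \<le> CARD('m) \<Longrightarrow> lam j \<le> lam i"
    and "lam 1 < 0"
    and "\<And>t x. f (t + \<tau>) x = f t x"
    and "\<And>t x. g (t + \<tau>) x = g t x"
    and "C0 > 0" and "\<beta>1 > 0" and "\<beta>2 > 0"
    and "\<beta>1 + \<beta>2\<^sup>2 / 2 < \<bar>lam 1\<bar>"
    and "\<And>s t x y. norm (f s x - f t y) \<le> C0 * sqrt \<bar>s - t\<bar> + \<beta>1 * norm (x - y)"
    and "\<And>s t x y. norm (g s x - g t y) \<le> C0 * sqrt \<bar>s - t\<bar> + \<beta>2 * norm (x - y)"
    and "Kstar > 0"
    and "initial_values M W \<tau> Kstar \<xi>"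
    and "\<And>k. sde_solution M W A f g (- real k * \<tau>) (\<xi> k) (X k)"
  shows "(\<forall>r\<ge>0.
            (\<exists>Z. is_random_periodic M W A f g \<tau> r Z) \<and>
            converges_weakly (\<lambda>k. distr M borel (X k r)) (periodic_measure M W A f g \<tau> r)) \<and>
         (\<exists>\<delta>>0. \<exists>Ktilde. \<forall>n\<ge>1.
            \<tau> / real n \<le> 1 / \<bar>lam CARD('m)\<bar> \<and> \<tau> / real n \<le> \<delta> \<longrightarrow>
            (\<forall>r\<ge>0.
               (\<exists>Z. is_em_random_periodic M W A f g \<tau> n r Z) \<and>
               converges_weakly (\<lambda>k. distr M borel (em_process A f g W \<tau> n k (\<xi> k) r))
                 (em_periodic_measure M W A f g \<tau> n r) \<and>
               bounded_lipschitz_dist (periodic_measure M W A f g \<tau> r)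
                 (em_periodic_measure M W A f g \<tau> n r) \<le> Ktilde * sqrt (\<tau> / real n)))"
proof -
  have neg: "lam 1 < 0" by fact
  interpret dissipative_sde M W A f g \<tau> C0 \<beta>1 \<beta>2 "\<bar>lam 1\<bar>"
  proof (intro dissipative_sde.intro wiener_space.intro wiener_space_axioms.intro dissipative_sde_axioms.intro)
    show "v \<bullet> (A *v v) \<le> - \<bar>lam 1\<bar> * (norm v)\<^sup>2" for v
      using Rayleigh_le_largest_eigenvalue[OF assms(4,5) assms(6)[of 1]] neg by simp
  qed (fact assms)+
  note exists = random_periodic_exists[OF assms(17,18)]
  note measures = periodic_measures[OF assms(17,18)]
  show ?thesis
  proof (rule conjI)
    show "\<exists>\<delta>>0. \<exists>Ktilde. \<forall>n\<ge>1.
            \<tau> / real n \<le> 1 / \<bar>lam CARD('m)\<bar> \<and> \<tau> / real n \<le> \<delta> \<longrightarrow>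
            (\<forall>r\<ge>0.
               (\<exists>Z. is_em_random_periodic M W A f g \<tau> n r Z) \<and>
               converges_weakly (\<lambda>k. distr M borel (em_process A f g W \<tau> n k (\<xi> k) r))
                 (em_periodic_measure M W A f g \<tau> n r) \<and>
               bounded_lipschitz_dist (periodic_measure M W A f g \<tau> r)
                 (em_periodic_measure M W A f g \<tau> n r) \<le> Ktilde * sqrt (\<tau> / real n))"
      \<comment> \<open>The witnesses \<open>max_step\<close> and \<open>em_error Kstar\<close> are
        fixed before the step and \<open>r\<close> are chosen, which is the asserted
        uniformity.\<close>
      using max_step_pos measures(2,3) em_random_periodic_exists[OF assms(17)]
      by (intro exI[of _ max_step] conjI exI[of _ "em_error Kstar"]) auto
  qed (use exists measures(1) in auto)
qed

end
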